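(* Let $\Gamma$ be a non-Abelian, torsion-free hyperbolic group, let $G$ be an iterated extension of centralizers over $\Gamma$, and let $G'$ be a rank $n$ extension of a cyclic centralizer of $G$. Then the $G$-discriminating complexity of $G'$ is asymptotically dominated by a polynomial of degree $n$, i.e. $C_{G'}^{G} \preceq (R\mapsto R^n)$.
   Context: For $u \in G$ with $C = C_G(u)$ Abelian, the (free, rank $n$) extension of the centralizer $C$ is $G(u,A) := G *_{C} A$ where $A = C \times \mathbb{Z}^n$ and $C$ is amalgamated with the factor $C$ of $A$. An iterated extension of centralizers over $\Gamma$ is a group $H$ with a finite chain $\Gamma = G_0 \le G_1 \le \dots \le G_k = H$ where each $G_{i+1}$ is a free finite-rank extension of a centralizer of $G_i$. A group $G'$ is fully residually $G$ if for every finite set $S \subseteq G'-\{1\}$ there is a homomorphism $\phi: G' \to G$ with $1 \notin \phi(S)$. For finite generating sets $X$ of $G'$ and $Y$ of $G$, $|\phi|_X^Y := \max_{x\in X}|\phi(x)|_Y$, and the $G$-discriminating complexity of $G'$ is $C(R) := \min\{|\phi|_X^Y : \phi: G'\to G,\ 1 \notin \phi(B_R(G',X)-\{1\})\}$, with $B_R$ the closed word-metric ball of radius $R$. For $f,g:\mathbb{N}\to\mathbb{N}$, $f \preceq g$ means there is $K$ with $f(R) \le K g(KR)+K$ for all $R$; this class of $C$ is independent of the generating sets. *)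

theory Defs
  imports "HOL-Algebra.Algebra"
begin

definition eval_word :: "('a, 'm) monoid_scheme \<Rightarrow> ('a \<times> bool) list \<Rightarrow> 'a" where
  "eval_word G w = foldr (\<lambda>(x, b) acc. monoid.mult G (if b then x else m_inv G x) acc) w (monoid.one G)"

definition word_len :: "('a, 'm) monoid_scheme \<Rightarrow> 'a set \<Rightarrow> 'a \<Rightarrow> nat" where
  "word_len G S g = (LEAST n. \<exists>w. (\<forall>p\<in>set w. fst p \<in> S) \<and> length w = n \<and> eval_word G w = g)"

definition fin_gen_set :: "('a, 'm) monoid_scheme \<Rightarrow> 'a set \<Rightarrow> bool" where
  "fin_gen_set G S \<longleftrightarrow> finite S \<and> S \<subseteq> carrier G \<and> generate G S = carrier G"

definition word_dist :: "('a, 'm) monoid_scheme \<Rightarrow> 'a set \<Rightarrow> 'a \<Rightarrow> 'a \<Rightarrow> real" where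
  "word_dist G S x y = real (word_len G S (inv\<^bsub>G\<^esub> x \<otimes>\<^bsub>G\<^esub> y))"

definition gromov_prod :: "('a, 'm) monoid_scheme \<Rightarrow> 'a set \<Rightarrow> 'a \<Rightarrow> 'a \<Rightarrow> 'a \<Rightarrow> real" where
  "gromov_prod G S x y w = (word_dist G S x w + word_dist G S y w - word_dist G S x y) / 2"

definition hyperbolic_group :: "('a, 'm) monoid_scheme \<Rightarrow> bool" where
  "hyperbolic_group G \<longleftrightarrow> group G \<and> (\<exists>S. fin_gen_set G S \<and> (\<exists>\<delta>::real.
     \<forall>x\<in>carrier G. \<forall>y\<in>carrier G. \<forall>z\<in>carrier G. \<forall>w\<in>carrier G.
       gromov_prod G S x y w \<ge> min (gromov_prod G S x z w) (gromov_prod G S y z w) - \<delta>))"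

definition torsion_free :: "('a, 'm) monoid_scheme \<Rightarrow> bool" where
  "torsion_free G \<longleftrightarrow> (\<forall>g\<in>carrier G. g \<noteq> \<one>\<^bsub>G\<^esub> \<longrightarrow> (\<forall>k::nat. k > 0 \<longrightarrow> g [^]\<^bsub>G\<^esub> k \<noteq> \<one>\<^bsub>G\<^esub>))"

definition non_abelian :: "('a, 'm) monoid_scheme \<Rightarrow> bool" where
  "non_abelian G \<longleftrightarrow> (\<exists>x\<in>carrier G. \<exists>y\<in>carrier G. x \<otimes>\<^bsub>G\<^esub> y \<noteq> y \<otimes>\<^bsub>G\<^esub> x)"

definition centralizer :: "('a, 'm) monoid_scheme \<Rightarrow> 'a \<Rightarrow> 'a set" where
  "centralizer G u = {g \<in> carrier G. g \<otimes>\<^bsub>G\<^esub> u = u \<otimes>\<^bsub>G\<^esub> g}"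

text \<open>The group A = C \<times> Z^m, with Z^m realised as integer sequences vanishing from index m on.\<close>

definition ext_factor :: "('a, 'm) monoid_scheme \<Rightarrow> 'a set \<Rightarrow> nat \<Rightarrow> ('a \<times> (nat \<Rightarrow> int)) monoid" where
  "ext_factor G C m =
     \<lparr>carrier = Sigma C (\<lambda>_. {v. \<forall>i\<ge>m. v i = 0}),
      monoid.mult = (\<lambda>(a, v) (b, w). (a \<otimes>\<^bsub>G\<^esub> b, \<lambda>i. v i + w i)),
      one = (\<one>\<^bsub>G\<^esub>, \<lambda>_. 0)\<rparr>"

text \<open>H (with maps i, j) is the amalgamated free product G *_C A of the maps
  alpha : C \<rightarrow> G, beta : C \<rightarrow> A, characterised by its universal property (pushout
  in the category of groups). The test groups K range over groups whose elements
  have the type of those of H.\<close>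

definition is_amalgam ::
  "('g, 'm1) monoid_scheme \<Rightarrow> ('b, 'm2) monoid_scheme \<Rightarrow> 'c set \<Rightarrow> ('c \<Rightarrow> 'g) \<Rightarrow> ('c \<Rightarrow> 'b)
    \<Rightarrow> ('h, 'm3) monoid_scheme \<Rightarrow> ('g \<Rightarrow> 'h) \<Rightarrow> ('b \<Rightarrow> 'h) \<Rightarrow> bool" where
  "is_amalgam G A C \<alpha> \<beta> H i j \<longleftrightarrow>
     group H \<and> i \<in> hom G H \<and> j \<in> hom A H \<and> (\<forall>c\<in>C. i (\<alpha> c) = j (\<beta> c)) \<and>
     (\<forall>K :: 'h monoid. group K \<longrightarrow>
        (\<forall>f\<in>hom G K. \<forall>g\<in>hom A K. (\<forall>c\<in>C. f (\<alpha> c) = g (\<beta> c)) \<longrightarrow>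
           (\<exists>h\<in>hom H K. (\<forall>x\<in>carrier G. h (i x) = f x) \<and> (\<forall>y\<in>carrier A. h (j y) = g y)) \<and>
           (\<forall>h1\<in>hom H K. \<forall>h2\<in>hom H K.
              (\<forall>x\<in>carrier G. h1 (i x) = f x) \<and> (\<forall>y\<in>carrier A. h1 (j y) = g y) \<and>
              (\<forall>x\<in>carrier G. h2 (i x) = f x) \<and> (\<forall>y\<in>carrier A. h2 (j y) = g y)
              \<longrightarrow> (\<forall>z\<in>carrier H. h1 z = h2 z))))"

definition centralizer_ext ::
  "('a, 'm1) monoid_scheme \<Rightarrow> 'a \<Rightarrow> nat \<Rightarrow> ('h, 'm3) monoid_scheme \<Rightarrow> ('a \<Rightarrow> 'h) \<Rightarrow> bool" where
  "centralizer_ext G u m H i \<longleftrightarrow>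
     group G \<and> u \<in> carrier G \<and> comm_group (G\<lparr>carrier := centralizer G u\<rparr>) \<and>
     (\<exists>j. is_amalgam G (ext_factor G (centralizer G u) m) (centralizer G u) id (\<lambda>c. (c, \<lambda>_. 0)) H i j)"

definition cyclic_subset :: "('a, 'm) monoid_scheme \<Rightarrow> 'a set \<Rightarrow> bool" where
  "cyclic_subset G C \<longleftrightarrow> (\<exists>c\<in>carrier G. C = {c [^]\<^bsub>G\<^esub> (k::int) | k. True})"

definition iterated_ext :: "('a, 'm1) monoid_scheme \<Rightarrow> ('b, 'm2) monoid_scheme \<Rightarrow> bool" where
  "iterated_ext \<Gamma> H \<longleftrightarrow> group H \<and>
     (\<exists>Ss :: 'b set list. Ss \<noteq> [] \<and> (\<forall>l<length Ss. subgroup (Ss ! l) H) \<and>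
        last Ss = carrier H \<and> \<Gamma> \<cong> H\<lparr>carrier := hd Ss\<rparr> \<and>
        (\<forall>l. Suc l < length Ss \<longrightarrow> Ss ! l \<subseteq> Ss ! Suc l \<and>
           (\<exists>u m. centralizer_ext (H\<lparr>carrier := Ss ! l\<rparr>) u m (H\<lparr>carrier := Ss ! Suc l\<rparr>) id)))"

definition cyclic_centralizer_ext ::
  "('a, 'm1) monoid_scheme \<Rightarrow> nat \<Rightarrow> ('h, 'm3) monoid_scheme \<Rightarrow> bool" where
  "cyclic_centralizer_ext G n G' \<longleftrightarrow>
     (\<exists>u i. cyclic_subset G (centralizer G u) \<and> centralizer_ext G u n G' i)"

definition disc_complexity ::
  "('c, 'm1) monoid_scheme \<Rightarrow> 'c set \<Rightarrow> ('a, 'm2) monoid_scheme \<Rightarrow> 'a set \<Rightarrow> nat \<Rightarrow> nat" where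
  "disc_complexity G' S G T R = (LEAST k. \<exists>\<phi>\<in>hom G' G.
      (\<forall>g\<in>carrier G'. word_len G' S g \<le> R \<and> g \<noteq> \<one>\<^bsub>G'\<^esub> \<longrightarrow> \<phi> g \<noteq> \<one>\<^bsub>G\<^esub>) \<and>
      k = Max ((\<lambda>x. word_len G T (\<phi> x)) ` S))"

definition dominated :: "(nat \<Rightarrow> nat) \<Rightarrow> (nat \<Rightarrow> nat) \<Rightarrow> bool" where
  "dominated f g \<longleftrightarrow> (\<exists>K. \<forall>R. f R \<le> K * g (K * R) + K)"

end

theory Submission
  imports Defs
begin

text \<open>
  Call \<open>c\<close> a \<^emph>\<open>big powers\<close> element if \<open>c\<^sup>n\<^sup>1 g\<^sub>1 \<dots> c\<^sup>n\<^sup>k g\<^sub>k \<noteq> 1\<close> whenever \<open>g\<^sub>1, \<dots>, g\<^sub>k\<^sub>-\<^sub>1\<close> do not commute with \<open>c\<close>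
  and all \<open>\<bar>n\<^sub>i\<bar>\<close> exceed a fixed multiple of the lengths of the \<open>g\<^sub>i\<close>. If \<open>u\<close> is such an element of \<open>G\<close>, then the
  retraction \<open>G' \<rightarrow> G\<close> with \<open>t\<^sub>i \<mapsto> u\<^bsup>P^i\<^esup>\<close>, \<open>P\<close> a large multiple of \<open>R\<close>, is injective on the ball of radius \<open>R\<close>:
  the exponents of reduced words are base-\<open>P\<close> expansions, hence big. This costs \<open>O(R\<^sup>n)\<close>.

  In \<open>\<Gamma>\<close> all nontrivial elements have linear big powers, because such products follow local quasi-geodesics. Hence
  each group of the tower is discriminated by \<open>\<Gamma>\<close>, which makes it torsion-free and CSA and yields the normal form theorem
  for the amalgams. Linear big powers climb the tower for elements \<open>c\<close> with cyclic centralizer: if \<open>c\<close> is hyperbolic on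
  the Bass--Serre tree, by the same quasi-geodesic argument in the tree; if \<open>c\<close> is conjugate into the previous group, by
  reading off normal forms; and \<open>c\<close> is never conjugate into \<open>C \<times> \<int>\<^sup>m\<close> with \<open>m > 0\<close>.
\<close>


section \<open>Hyperbolic length functions and big powers\<close>

text \<open>Discrimination of \<open>G\<close> by \<Gamma> alone would not give degree n: the
  exponent \<open>P\<close> must be linear in the radius, and thresholds found by composing
  retractions down to \<Gamma> need not be linear. Hence the linear threshold is itself the
  invariant of the induction along the tower. It is carried for elements of rank one, such as the
  \<open>u\<close> of the last extension: an element commuting with both the amalgamated
  \<open>u\<close> and a stable letter \<open>t\<close> would force a relation
  \<open>u^a = t^b\<close>, against the normal form.

  The universal property admits only test groups on the element type of the amalgam. A retraction
  onto \<open>G\<close> therefore needs a copy of \<open>G\<close> inside that type, which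
  countability provides once the type is infinite.

  Finally, discriminating the elements of an amalgam and knowing its normal form seem to presuppose
  each other. The circle is broken by discriminating reduced words instead of elements: a retraction
  followed by a map to \<Gamma> turns a reduced word into a product of big powers.\<close>

definition group_norm :: "('a, 'm) monoid_scheme \<Rightarrow> 'a set \<Rightarrow> ('a \<Rightarrow> nat) \<Rightarrow> bool" where
  "group_norm M S l \<longleftrightarrow> l \<one>\<^bsub>M\<^esub> = 0 \<and> (\<forall>x\<in>S. l (inv\<^bsub>M\<^esub> x) = l x) \<and>
     (\<forall>x\<in>S. \<forall>y\<in>S. l (x \<otimes>\<^bsub>M\<^esub> y) \<le> l x + l y)"

fun power_word :: "('a, 'm) monoid_scheme \<Rightarrow> 'a \<Rightarrow> (int \<times> 'a) list \<Rightarrow> 'a" where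
  "power_word M c [] = \<one>\<^bsub>M\<^esub>"
| "power_word M c ((n, g) # ws) = (c [^]\<^bsub>M\<^esub> n \<otimes>\<^bsub>M\<^esub> g) \<otimes>\<^bsub>M\<^esub> power_word M c ws"

text \<open>For a single syllable this says that \<open>c\<close> is undistorted: \<open>l\<close>
  grows at least linearly along its powers. The last letter is exempt from the commutation
  condition, so it can absorb whatever closes the word. \<open>R + 1\<close> instead of
  \<open>R\<close> keeps the threshold meaningful at \<open>R = 0\<close>.\<close>

definition big_powers :: "('a, 'm) monoid_scheme \<Rightarrow> 'a set \<Rightarrow> ('a \<Rightarrow> nat) \<Rightarrow> 'a \<Rightarrow> bool" where
  "big_powers M S l c \<longleftrightarrow> (\<exists>K::nat. \<forall>R ws. ws \<noteq> [] \<longrightarrow>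
     (\<forall>(n, g)\<in>set ws. g \<in> S \<and> l g \<le> R \<and> int (K * (R + 1)) \<le> \<bar>n\<bar>) \<longrightarrow>
     (\<forall>(n, g)\<in>set (butlast ws). g \<otimes>\<^bsub>M\<^esub> c \<noteq> c \<otimes>\<^bsub>M\<^esub> g) \<longrightarrow>
     power_word M c ws \<noteq> \<one>\<^bsub>M\<^esub>)"

fun list_prod :: "('a, 'm) monoid_scheme \<Rightarrow> 'a list \<Rightarrow> 'a" where
  "list_prod M [] = \<one>\<^bsub>M\<^esub>"
| "list_prod M (x # xs) = x \<otimes>\<^bsub>M\<^esub> list_prod M xs"

section \<open>Length functions and Gromov products\<close>

lemma (in group) cancel_left [simp]:
  assumes "x \<in> carrier G" "y \<in> carrier G"
  shows "inv x \<otimes> (x \<otimes> y) = y" "x \<otimes> (inv x \<otimes> y) = y"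
  using assms by (simp_all add: m_assoc[symmetric])

lemma (in group) commute_inv:
  assumes "x \<in> carrier G" "y \<in> carrier G" "x \<otimes> y = y \<otimes> x"
  shows "inv x \<otimes> y = y \<otimes> inv x"
proof -
  have "inv x \<otimes> (x \<otimes> y) \<otimes> inv x = inv x \<otimes> (y \<otimes> x) \<otimes> inv x" by (simp only: assms(3))
  then show ?thesis using assms(1,2) by (simp add: m_assoc)
qed

lemma (in group) conj_int_pow:
  assumes "g \<in> carrier G" "x \<in> carrier G"
  shows "(g \<otimes> x \<otimes> inv g) [^] (k::int) = g \<otimes> x [^] k \<otimes> inv g"
proof -
  have "group_hom G G (\<lambda>x. g \<otimes> x \<otimes> inv g)"
    by (unfold_locales) (auto simp: hom_def m_assoc assms)
  then show ?thesis using group_hom.hom_int_pow[of G G "\<lambda>x. g \<otimes> x \<otimes> inv g" x k] assms by simp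
qed

lemma (in group) conj_rel_pow:
  assumes "g \<in> carrier G" "c \<in> carrier G" "g \<otimes> c [^] (r::int) = c [^] (s::int) \<otimes> g"
  shows "g \<otimes> c [^] (r * k) = c [^] (s * k) \<otimes> g"
proof -
  have "c [^] s = g \<otimes> c [^] r \<otimes> inv g" using assms by (simp add: m_assoc)
  then have "c [^] (s * k) = g \<otimes> c [^] (r * k) \<otimes> inv g"
    using conj_int_pow[of g "c [^] r" k] assms by (simp add: int_pow_pow[symmetric])
  then show ?thesis using assms by (simp add: m_assoc)
qed

text \<open>Stated for a subgroup \<open>S\<close> of an ambient group, because the groups of the
  tower are subgroups of one group and the tree length is a length function on one of them.\<close>

locale length_group = group G for G (structure) +
  fixes S :: "'a set" and L :: "'a \<Rightarrow> real"
  assumes S_subgroup: "subgroup S G"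
    and L_one: "L \<one> = 0"
    and L_inv: "x \<in> S \<Longrightarrow> L (inv x) = L x"
    and L_mult: "x \<in> S \<Longrightarrow> y \<in> S \<Longrightarrow> L (x \<otimes> y) \<le> L x + L y"
begin

lemma S_carrier [simp]: "x \<in> S \<Longrightarrow> x \<in> carrier G"
  by (rule subgroup.mem_carrier[OF S_subgroup])

lemma S_mult [simp]: "x \<in> S \<Longrightarrow> y \<in> S \<Longrightarrow> x \<otimes> y \<in> S"
  by (rule subgroup.m_closed[OF S_subgroup])

lemma S_inv [simp]: "x \<in> S \<Longrightarrow> inv x \<in> S"
  by (rule subgroup.m_inv_closed[OF S_subgroup])

lemma S_one [simp]: "\<one> \<in> S"
  by (rule subgroup.one_closed[OF S_subgroup])

lemma S_pow [simp]: "x \<in> S \<Longrightarrow> x [^] (n::int) \<in> S"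
  by (rule subgroup_int_pow_closed[OF S_subgroup])

lemma S_nat_pow [simp]: "x \<in> S \<Longrightarrow> x [^] (n::nat) \<in> S"
  using S_pow[of x "int n"] by (simp add: int_pow_int)

lemma L_nonneg: assumes "x \<in> S" shows "0 \<le> L x"
  using L_mult[OF assms S_inv[OF assms]] L_inv[OF assms] L_one assms by simp

definition dst :: "'a \<Rightarrow> 'a \<Rightarrow> real" where
  "dst x y = L (inv x \<otimes> y)"

definition gprod :: "'a \<Rightarrow> 'a \<Rightarrow> 'a \<Rightarrow> real" where
  "gprod p x y = (dst p x + dst p y - dst x y) / 2"

lemma dst_commute: "x \<in> S \<Longrightarrow> y \<in> S \<Longrightarrow> dst x y = dst y x"
  using L_inv[of "inv x \<otimes> y"] by (simp add: dst_def inv_mult_group)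

lemma dst_refl: "x \<in> S \<Longrightarrow> dst x x = 0"
  by (simp add: dst_def L_one)

lemma dst_triangle: "x \<in> S \<Longrightarrow> y \<in> S \<Longrightarrow> z \<in> S \<Longrightarrow> dst x z \<le> dst x y + dst y z"
  using L_mult[of "inv x \<otimes> y" "inv y \<otimes> z"] by (simp add: dst_def m_assoc)

lemma dst_left: "g \<in> S \<Longrightarrow> x \<in> S \<Longrightarrow> y \<in> S \<Longrightarrow> dst (g \<otimes> x) (g \<otimes> y) = dst x y"
  by (simp add: dst_def inv_mult_group m_assoc)

lemma dst_one: "x \<in> S \<Longrightarrow> dst \<one> x = L x"
  by (simp add: dst_def)

lemma gprod_left:
  "g \<in> S \<Longrightarrow> p \<in> S \<Longrightarrow> x \<in> S \<Longrightarrow> y \<in> S \<Longrightarrow> gprod (g \<otimes> p) (g \<otimes> x) (g \<otimes> y) = gprod p x y"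
  by (simp add: gprod_def dst_left)

lemma gprod_left_inv:
  assumes "p \<in> S" "g \<in> S" "x \<in> S" "y \<in> S"
  shows "gprod (inv g \<otimes> p) x y = gprod p (g \<otimes> x) (g \<otimes> y)"
  using gprod_left[of g "inv g \<otimes> p" x y] assms by simp

lemma gprod_commute: "x \<in> S \<Longrightarrow> y \<in> S \<Longrightarrow> gprod p x y = gprod p y x"
  by (simp add: gprod_def dst_commute)

lemma gprod_nonneg: "p \<in> S \<Longrightarrow> x \<in> S \<Longrightarrow> y \<in> S \<Longrightarrow> 0 \<le> gprod p x y"
  using dst_triangle[of x p y] by (simp add: gprod_def dst_commute)

lemma gprod_le: "p \<in> S \<Longrightarrow> x \<in> S \<Longrightarrow> y \<in> S \<Longrightarrow> gprod p x y \<le> dst p x"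
  using dst_triangle[of p x y] by (simp add: gprod_def)

lemma gprod_refl: "p \<in> S \<Longrightarrow> x \<in> S \<Longrightarrow> gprod p x x = dst p x"
  by (simp add: gprod_def dst_refl)

lemma gprod_flip: "p \<in> S \<Longrightarrow> x \<in> S \<Longrightarrow> y \<in> S \<Longrightarrow> gprod x p y = dst p x - gprod p x y"
  by (simp add: gprod_def dst_commute field_simps)

lemma gprod_ge_dst: "p \<in> S \<Longrightarrow> x \<in> S \<Longrightarrow> y \<in> S \<Longrightarrow> dst p x - dst x y \<le> gprod p x y"
  using dst_triangle[of p y x] by (simp add: gprod_def dst_commute)

lemma gprod_change: "p \<in> S \<Longrightarrow> x \<in> S \<Longrightarrow> y \<in> S \<Longrightarrow> z \<in> S \<Longrightarrow> gprod p x y \<le> gprod p x z + dst y z"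
  using dst_triangle[of p z y] dst_triangle[of x y z]
  by (simp add: gprod_def dst_commute field_simps)

lemma gprod_change_base: "p \<in> S \<Longrightarrow> x \<in> S \<Longrightarrow> y \<in> S \<Longrightarrow> q \<in> S \<Longrightarrow> gprod p x y \<le> gprod q x y + dst p q"
  using dst_triangle[of p q x] dst_triangle[of p q y]
  by (simp add: gprod_def dst_commute field_simps)

lemma L_pow_le: assumes "c \<in> S" shows "L (c [^] (n::int)) \<le> real_of_int \<bar>n\<bar> * L c"
proof -
  have nat: "L (c [^] (k::nat)) \<le> real k * L c" for k
  proof (induction k)
    case 0 then show ?case by (simp add: L_one)
  next
    case (Suc k)
    have "L (c [^] k \<otimes> c) \<le> L (c [^] k) + L c" using assms by (intro L_mult) auto
    then show ?case using Suc by (simp add: algebra_simps)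
  qed
  show ?thesis
  proof (cases "n \<ge> 0")
    case True
    then show ?thesis using nat[of "nat n"] int_pow_int[of G c "nat n"] by simp
  next
    case False
    then have "c [^] n = inv (c [^] nat (-n))"
      using int_pow_neg_int[of c "nat (-n)"] assms by simp
    then show ?thesis using nat[of "nat (-n)"] False assms L_inv[of "c [^] nat (-n)"] by simp
  qed
qed

lemma L_pow_abs: "c \<in> S \<Longrightarrow> L (c [^] (n::int)) = L (c [^] \<bar>n\<bar>)"
  using L_inv[of "c [^] n"] by (cases "n \<ge> 0") (auto simp: int_pow_neg)

lemma list_prod_in: "set ss \<subseteq> S \<Longrightarrow> list_prod G ss \<in> S"
  by (induction ss) auto

lemma inv_pow_mult_pow:
  assumes "c \<in> S"
  shows "inv (c [^] (i::int)) \<otimes> c [^] j = c [^] (j - i)"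
  using int_pow_mult[of c "-i" j] int_pow_neg[of c i] assms by (simp add: add.commute)

lemma dst_pow:
  assumes "c \<in> S"
  shows "dst (c [^] (i::int)) (c [^] j) = L (c [^] (j - i))"
  using assms by (simp add: dst_def inv_pow_mult_pow)

end

section \<open>Hyperbolic length functions and local quasi-geodesics\<close>

locale hyp_length = length_group +
  fixes \<delta> :: real
  assumes \<delta>_nonneg: "0 \<le> \<delta>"
    and hyp_one: "x \<in> S \<Longrightarrow> y \<in> S \<Longrightarrow> z \<in> S \<Longrightarrow> min (gprod \<one> x y) (gprod \<one> y z) - \<delta> \<le> gprod \<one> x z"
begin

lemma hyp:
  assumes "p \<in> S" "x \<in> S" "y \<in> S" "z \<in> S"
  shows "min (gprod p x y) (gprod p y z) - \<delta> \<le> gprod p x z"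
proof -
  have "gprod p a b = gprod \<one> (inv p \<otimes> a) (inv p \<otimes> b)" if "a \<in> S" "b \<in> S" for a b
    using gprod_left[of "inv p" p a b] that assms by simp
  then show ?thesis using hyp_one[of "inv p \<otimes> x" "inv p \<otimes> y" "inv p \<otimes> z"] assms by simp
qed

lemma four_point:
  assumes "w \<in> S" "x \<in> S" "y \<in> S" "z \<in> S"
  shows "dst w x + dst y z \<le> max (dst w y + dst x z) (dst w z + dst x y) + 2 * \<delta>"
  using hyp[of w y x z] assms
  by (auto simp: gprod_def dst_commute min_def max_def field_simps split: if_splits)

text \<open>Local quasi-geodesics are global. Reading from the right, the letter \<open>t\<close>
  loses at most \<open>a + \<delta>\<close> to its successors, so \<open>t\<close> and the whole
  remaining product \<open>W\<close> share more than \<open>a + 2\<delta>\<close>. Hyperbolicity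
  then transfers the bound \<open>a\<close> for the pair \<open>s\<close>, \<open>t\<close> to a
  bound \<open>a + \<delta>\<close> for \<open>s\<close>, \<open>W\<close>. A letter of length
  \<open>2a + 3\<delta> + 1\<close> thus still gains at least 1.\<close>

lemma chain:
  assumes "ss \<noteq> []" "set ss \<subseteq> S" "\<And>s. s \<in> set ss \<Longrightarrow> 2 * a + 3 * \<delta> + 1 \<le> L s"
    and "successively (\<lambda>s t. gprod \<one> (inv s) t \<le> a) ss" and a: "0 \<le> a"
  shows "real (length ss) \<le> L (list_prod G ss) \<and>
    (tl ss \<noteq> [] \<longrightarrow> gprod \<one> (inv (hd ss)) (list_prod G (tl ss)) \<le> a + \<delta>)"
  using assms(1-4)
proof (induction ss)
  case Nil then show ?case by simp
next
  case (Cons s ss)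
  show ?case
  proof (cases ss)
    case Nil
    then show ?thesis using Cons.prems \<delta>_nonneg a by force
  next
    case (Cons t r)
    define W where "W = list_prod G ss"
    define W' where "W' = list_prod G r"
    have mem: "s \<in> S" "t \<in> S" "W \<in> S" "W' \<in> S"
      using Cons.prems Cons list_prod_in[of ss] list_prod_in[of r] by (auto simp: W_def W'_def)
    have W: "W = t \<otimes> W'" using Cons by (simp add: W_def W'_def)
    have IH: "real (length ss) \<le> L W" "r \<noteq> [] \<longrightarrow> gprod \<one> (inv t) W' \<le> a + \<delta>"
      using Cons.IH Cons.prems Cons unfolding W_def W'_def by auto
    have Lt: "2 * a + 3 * \<delta> + 1 \<le> L t" "2 * a + 3 * \<delta> + 1 \<le> L s" using Cons.prems Cons by auto
    have big: "a + 2 * \<delta> + 1 \<le> gprod \<one> t W"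
    proof (cases "r = []")
      case True
      then have "W = t" using W mem by (simp add: W'_def)
      then show ?thesis using Lt mem a \<delta>_nonneg by (simp add: gprod_refl dst_one)
    next
      case False
      have "gprod t \<one> W = gprod \<one> (inv t) W'"
        using gprod_left[of t \<one> "inv t" W'] mem W by simp
      moreover have "gprod t \<one> W = dst \<one> t - gprod \<one> t W"
        using mem by (intro gprod_flip) auto
      ultimately show ?thesis using IH(2) False Lt mem by (simp add: dst_one)
    qed
    have "gprod \<one> (inv s) t \<le> a" using Cons.prems Cons by auto
    moreover have "min (gprod \<one> (inv s) W) (gprod \<one> W t) - \<delta> \<le> gprod \<one> (inv s) t"
      using mem by (intro hyp) auto
    ultimately have le: "gprod \<one> (inv s) W \<le> a + \<delta>"
      using big mem gprod_commute[of W t \<one>] \<delta>_nonneg by (auto simp: min_def split: if_splits)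
    have "L (s \<otimes> W) = L s + L W - 2 * gprod \<one> (inv s) W"
      using mem by (simp add: gprod_def dst_one L_inv dst_def field_simps)
    then have "real (length ss) + 1 \<le> L (s \<otimes> W)" using le Lt IH(1) \<delta>_nonneg by linarith
    then show ?thesis using le by (simp add: W_def)
  qed
qed

text \<open>The overlap hypothesis says that the quasi-axes of \<open>c\<close> and of its conjugates by elements outside
  the centralizer diverge; then the points \<open>c\<^sup>n\<^sup>1 g\<^sub>1 \<dots> c\<^sup>n\<^sup>i g\<^sub>i\<close> form a local quasi-geodesic.\<close>

lemma big_powers_from_overlap:
  assumes c: "c \<in> S" and e: "0 < \<epsilon>" and growth: "\<And>n::int. \<epsilon> * real_of_int \<bar>n\<bar> - \<kappa> \<le> L (c [^] n)"
    and overlap: "\<And>g N M. g \<in> S \<Longrightarrow> g \<otimes> c \<noteq> c \<otimes> g \<Longrightarrow>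
       gprod \<one> (c [^] (N::int)) (g \<otimes> c [^] (M::int)) \<le> B * (L g + 1)"
    and l: "\<And>g. g \<in> S \<Longrightarrow> L g \<le> real (l g)"
  shows "big_powers G S l c"
proof -
  define B' where "B' = \<bar>B\<bar>"
  \<comment> \<open>Makes \<open>\<epsilon> K (R + 1) - \<kappa> - R\<close>, a lower bound for the
    length of a syllable, at least the \<open>2a + 3\<delta> + 1\<close> that \<open>chain\<close>
    demands for the \<open>a\<close> defined below.\<close>
  define K where "K = nat \<lceil>(2 * B' + 3 + 3 * \<delta> + 1 + \<bar>\<kappa>\<bar>) / \<epsilon>\<rceil>"
  have K: "2 * B' + 3 + 3 * \<delta> + 1 + \<bar>\<kappa>\<bar> \<le> \<epsilon> * real K"
  proof -
    have "(2 * B' + 3 + 3 * \<delta> + 1 + \<bar>\<kappa>\<bar>) / \<epsilon> \<le> real K" unfolding K_def by linarith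
    then show ?thesis using e by (simp add: field_simps)
  qed
  have "power_word G c ws \<noteq> \<one>"
    if ws: "ws \<noteq> []" and all: "\<forall>(n, g)\<in>set ws. g \<in> S \<and> l g \<le> R \<and> int (K * (R + 1)) \<le> \<bar>n\<bar>"
      and nc: "\<forall>(n, g)\<in>set (butlast ws). g \<otimes> c \<noteq> c \<otimes> g" for R ws
  proof -
    \<comment> \<open>The first summand bounds the overlap of two axes, the second the error made by
      moving the endpoint of a syllable by its letter of length at most \<open>R\<close>.\<close>
    define a where "a = B' * (real R + 1) + real R"
    have a: "0 \<le> a" by (simp add: a_def B'_def)
    define ss where "ss = map (\<lambda>(n, g). c [^] n \<otimes> g) ws"
    have pw: "power_word G c us = list_prod G (map (\<lambda>(n, g). c [^] n \<otimes> g) us)" for us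
      by (induction us) auto
    have "set ss \<subseteq> S" using all c by (auto simp: ss_def)
    moreover have "2 * a + 3 * \<delta> + 1 \<le> L s" if s: "s \<in> set ss" for s
    proof -
      obtain n g where ng: "(n, g) \<in> set ws" "s = c [^] n \<otimes> g" using s by (auto simp: ss_def)
      then have g: "g \<in> S" "l g \<le> R" "int (K * (R + 1)) \<le> \<bar>n\<bar>" using all by auto
      have "L (s \<otimes> inv g) \<le> L s + L (inv g)" using g ng c by (intro L_mult) auto
      then have "L (c [^] n) \<le> L s + L g" using ng g c by (simp add: m_assoc L_inv)
      moreover have "real K * (real R + 1) \<le> real_of_int \<bar>n\<bar>"
      proof -
        have "real_of_int (int (K * (R + 1))) \<le> real_of_int \<bar>n\<bar>" using g(3) by (simp only: of_int_le_iff)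
        then show ?thesis by (simp add: algebra_simps)
      qed
      then have "\<epsilon> * (real K * (real R + 1)) \<le> \<epsilon> * real_of_int \<bar>n\<bar>" using e by simp
      moreover have "(2 * B' + 3 + 3 * \<delta> + 1 + \<bar>\<kappa>\<bar>) * (real R + 1) \<le> \<epsilon> * real K * (real R + 1)"
        using K by (intro mult_right_mono) auto
      moreover have "2 * a + 3 * \<delta> + 1 + \<bar>\<kappa>\<bar> + real R \<le> (2 * B' + 3 + 3 * \<delta> + 1 + \<bar>\<kappa>\<bar>) * (real R + 1)"
        unfolding a_def using \<delta>_nonneg by (simp add: algebra_simps)
      ultimately show ?thesis using growth[of n] l[OF g(1)] g(2) by (simp add: algebra_simps)
    qed
    moreover have "successively (\<lambda>s t. gprod \<one> (inv s) t \<le> a) ss"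
      unfolding ss_def using all nc
    proof (induction ws)
      case (Cons x us)
      show ?case
      proof (cases us)
        case (Cons y vs)
        obtain n g m h where xy: "x = (n, g)" "y = (m, h)" by fastforce
        have gh: "g \<in> S" "l g \<le> R" "h \<in> S" "l h \<le> R" "g \<otimes> c \<noteq> c \<otimes> g"
          using Cons.prems Cons xy by auto
        have "inv g \<otimes> c \<noteq> c \<otimes> inv g"
        proof
          assume "inv g \<otimes> c = c \<otimes> inv g"
          then have "g \<otimes> (inv g \<otimes> c) \<otimes> g = g \<otimes> (c \<otimes> inv g) \<otimes> g" by simp
          then show False using gh c by (simp add: m_assoc)
        qed
        then have "gprod \<one> (c [^] m) (inv g \<otimes> c [^] (-n)) \<le> B * (L g + 1)"
          using overlap[of "inv g" m "-n"] gh L_inv by simp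
        also have "\<dots> \<le> B' * (L g + 1)"
          using L_nonneg[of g] gh by (intro mult_right_mono) (auto simp: B'_def)
        also have "\<dots> \<le> B' * (real R + 1)"
          using l[of g] gh by (intro mult_left_mono) (auto simp: B'_def)
        finally have 1: "gprod \<one> (c [^] m) (inv g \<otimes> c [^] (-n)) \<le> B' * (real R + 1)" .
        have "gprod \<one> (inv (c [^] n \<otimes> g)) (c [^] m \<otimes> h)
            \<le> gprod \<one> (inv (c [^] n \<otimes> g)) (c [^] m) + dst (c [^] m \<otimes> h) (c [^] m)"
          using gh c by (intro gprod_change) auto
        also have "gprod \<one> (inv (c [^] n \<otimes> g)) (c [^] m) = gprod \<one> (c [^] m) (inv g \<otimes> c [^] (-n))"
          using gh c by (simp add: inv_mult_group int_pow_neg gprod_commute)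
        also have "dst (c [^] m \<otimes> h) (c [^] m) = L h"
          using gh c by (simp add: dst_def inv_mult_group m_assoc L_inv)
        finally have "gprod \<one> (inv (c [^] n \<otimes> g)) (c [^] m \<otimes> h) \<le> a"
          using 1 l[of h] gh by (simp add: a_def)
        moreover have "successively (\<lambda>s t. gprod \<one> (inv s) t \<le> a) (map (\<lambda>(n, g). c [^] n \<otimes> g) us)"
          using Cons.IH Cons.prems Cons by auto
        ultimately show ?thesis using Cons xy by simp
      qed simp
    qed simp
    ultimately have "real (length ss) \<le> L (list_prod G ss)"
      using chain[of ss a] ws a by (simp add: ss_def)
    then show ?thesis using ws L_one by (auto simp: pw ss_def)
  qed
  then show ?thesis unfolding big_powers_def by blast
qed

end

section \<open>Torsion-free hyperbolic groups\<close>

text \<open>\<open>midpoint\<close> is what is kept of geodesics; \<open>finite_ball\<close> turns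
  bounded displacements into equalities by the pigeonhole principle.\<close>

locale hyp_group = hyp_length G "carrier G" L \<delta> for G (structure) and L and \<delta> +
  assumes finite_ball: "finite {g \<in> carrier G. L g \<le> r}"
    and midpoint: "g \<in> carrier G \<Longrightarrow>
      \<exists>m\<in>carrier G. L m \<le> L g / 2 + 1 \<and> L (inv m \<otimes> g) \<le> L g / 2 + 1"
    and tf: "torsion_free G"
begin

section \<open>Linear growth of powers\<close>

lemma pow_eq_one:
  assumes "c \<in> carrier G" "c \<noteq> \<one>" "c [^] (n::int) = \<one>"
  shows "n = 0"
proof (rule ccontr)
  assume n: "n \<noteq> 0"
  have "c [^] \<bar>n\<bar> = \<one>" using assms int_pow_neg[of c n] by (cases "n \<ge> 0") auto
  then have "c [^] nat \<bar>n\<bar> = \<one>" using int_pow_int[of G c "nat \<bar>n\<bar>"] by simp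
  moreover have "0 < nat \<bar>n\<bar>" using n by simp
  ultimately show False using tf assms unfolding torsion_free_def by blast
qed

lemma pow_inj:
  assumes "c \<in> carrier G" "c \<noteq> \<one>" "c [^] (i::int) = c [^] j"
  shows "i = j"
proof -
  have "c [^] (j - i) = \<one>" using inv_pow_mult_pow[of c i j] assms by simp
  then show ?thesis using pow_eq_one assms by fastforce
qed

lemma ball_repeat:
  fixes f :: "nat \<Rightarrow> 'a"
  assumes "\<And>i. i \<in> A \<Longrightarrow> f i \<in> carrier G \<and> L (f i) \<le> r"
    and "card {g \<in> carrier G. L g \<le> r} < card A"
  shows "\<exists>i\<in>A. \<exists>j\<in>A. i < j \<and> f i = f j"
proof -
  have "card (f ` A) \<le> card {g \<in> carrier G. L g \<le> r}"
    using assms(1) by (intro card_mono finite_ball) auto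
  then have "\<not> inj_on f A" using assms(2) pigeonhole[of f A] by linarith
  then obtain i j where ij: "i \<in> A" "j \<in> A" "i \<noteq> j" "f i = f j" unfolding inj_on_def by blast
  then show ?thesis by (metis linorder_neqE_nat)
qed

text \<open>If the lengths of the powers of \<open>c\<close> were quasi-ultrametric, then the midpoint of a longest
  \<open>c\<^sup>i\<close> with \<open>0 \<le> i \<le> B\<close> would be moved a uniformly bounded amount by all these powers at once, too many
  for a ball.\<close>

lemma exists_good_pair:
  assumes c: "c \<in> carrier G" "c \<noteq> \<one>"
  shows "\<exists>i j::int. max (L (c [^] i)) (L (c [^] j)) + 3 * \<delta> + 1 \<le> L (c [^] (i + j))"
proof (rule ccontr)
  assume "\<not> ?thesis"
  then have ultra: "L (c [^] (i + j)) \<le> max (L (c [^] i)) (L (c [^] j)) + 3 * \<delta> + 1" for i j :: int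
    by (meson linorder_le_cases)
  \<comment> \<open>Three uses of the four point inequality: \<open>m\<close> is within
    \<open>\<rho>/2 + 2 + 5\<delta>\<close> of both ends of the translated segment, hence within
    \<open>3 + 7\<delta>\<close> of the translated midpoint. The index set \<open>{0..B}\<close> has
    one element more than the ball of this radius.\<close>
  define r where "r = 2 + 7 * \<delta> + 1"
  define B where "B = card {g \<in> carrier G. L g \<le> r}"
  have "\<exists>i0\<in>{0..B}. \<forall>i\<in>{0..B}. L (c [^] int i) \<le> L (c [^] int i0)"
    using finite_imageI[of "{0..B}" "\<lambda>i. L (c [^] int i)"]
      Max_in[of "(\<lambda>i. L (c [^] int i)) ` {0..B}"] Max_ge[of "(\<lambda>i. L (c [^] int i)) ` {0..B}"]
    by fastforce
  then obtain i0 where i0: "i0 \<le> B" "\<And>i. i \<le> B \<Longrightarrow> L (c [^] int i) \<le> L (c [^] int i0)" by auto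
  define \<rho> where "\<rho> = L (c [^] int i0)"
  have mx: "L (c [^] n) \<le> \<rho>" if "\<bar>n\<bar> \<le> int B" for n :: int
    using i0(2)[of "nat \<bar>n\<bar>"] that L_pow_abs[of c n] c by (simp add: \<rho>_def)
  obtain m where m: "m \<in> carrier G" "L m \<le> \<rho> / 2 + 1" "L (inv m \<otimes> c [^] int i0) \<le> \<rho> / 2 + 1"
    using midpoint[of "c [^] int i0"] c by (auto simp: \<rho>_def)
  have disp: "L (inv m \<otimes> (c [^] int j \<otimes> m)) \<le> r" if j: "j \<in> {0..B}" for j
  proof -
    define x y x' y' m' where "x = \<one>" and "y = c [^] int i0" and "x' = c [^] int j"
      and "y' = c [^] (int i0 + int j)" and "m' = c [^] int j \<otimes> m"
    have mem: "x \<in> carrier G" "y \<in> carrier G" "x' \<in> carrier G" "y' \<in> carrier G" "m' \<in> carrier G"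
      using c m by (auto simp: x_def y_def x'_def y'_def m'_def)
    have y': "y' = c [^] int j \<otimes> y" using c by (simp add: y'_def y_def int_pow_mult[symmetric] add.commute)
    have dxy: "dst x y = \<rho>" using mem by (simp add: x_def y_def dst_one \<rho>_def)
    have dx'y': "dst x' y' = \<rho>"
      using c by (simp add: x'_def y'_def dst_pow \<rho>_def)
    have dmx: "dst m x \<le> \<rho> / 2 + 1" "dst m y \<le> \<rho> / 2 + 1"
      using m mem by (simp_all add: x_def dst_commute[of m \<one>] dst_one) (simp add: y_def dst_def)
    have dm'x': "dst m' x' \<le> \<rho> / 2 + 1" "dst m' y' \<le> \<rho> / 2 + 1"
      using dst_left[of "c [^] int j" m \<one>] dst_left[of "c [^] int j" m y] dmx c m mem
      by (auto simp: m'_def x'_def x_def y')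
    have d1: "dst x' x \<le> \<rho>" "dst x' y \<le> \<rho>" "dst y' y \<le> \<rho>" "dst y' x \<le> \<rho> + 3 * \<delta> + 1"
    proof -
      show "dst x' x \<le> \<rho>" using mx[of "int j"] j mem by (simp add: x_def dst_commute[of x'] dst_one) (simp add: x'_def)
      show "dst x' y \<le> \<rho>" using mx[of "int i0 - int j"] j i0 c by (simp add: x'_def y_def dst_pow)
      show "dst y' y \<le> \<rho>" using mx[of "- int j"] j c by (simp add: y'_def y_def dst_pow)
      have "dst y' x = L (c [^] (int i0 + int j))" using mem by (simp add: x_def dst_commute[of y'] dst_one) (simp add: y'_def)
      also have "\<dots> \<le> max (L (c [^] int i0)) (L (c [^] int j)) + 3 * \<delta> + 1" by (rule ultra)
      finally show "dst y' x \<le> \<rho> + 3 * \<delta> + 1" using mx[of "int j"] j by (simp add: \<rho>_def max_def split: if_splits)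
    qed
    have "dst m x' + dst x y \<le> max (dst m x + dst x' y) (dst m y + dst x' x) + 2 * \<delta>"
      using mem m by (intro four_point) auto
    then have e1: "dst m x' \<le> \<rho> / 2 + 2 + 5 * \<delta>" using dmx d1 dxy \<delta>_nonneg by (auto simp: max_def split: if_splits)
    have "dst m y' + dst x y \<le> max (dst m x + dst y' y) (dst m y + dst y' x) + 2 * \<delta>"
      using mem m by (intro four_point) auto
    then have e2: "dst m y' \<le> \<rho> / 2 + 2 + 5 * \<delta>" using dmx d1 dxy \<delta>_nonneg by (auto simp: max_def split: if_splits)
    have "dst m m' + dst x' y' \<le> max (dst m x' + dst m' y') (dst m y' + dst m' x') + 2 * \<delta>"
      using mem m by (intro four_point) auto
    then have "dst m m' \<le> r" using e1 e2 dm'x' dx'y' by (auto simp: max_def r_def split: if_splits)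
    then show ?thesis by (simp add: dst_def m'_def)
  qed
  have "\<exists>i\<in>{0..B}. \<exists>j\<in>{0..B}. i < j \<and> inv m \<otimes> (c [^] int i \<otimes> m) = inv m \<otimes> (c [^] int j \<otimes> m)"
    using disp c m by (intro ball_repeat[where r = r]) (auto simp: B_def[symmetric])
  then obtain i j where "i < j" "inv m \<otimes> (c [^] int i \<otimes> m) = inv m \<otimes> (c [^] int j \<otimes> m)" by blast
  then have "c [^] int i = c [^] int j" using c m by simp
  then show False using pow_inj[OF c] \<open>i < j\<close> by fastforce
qed

text \<open>For a good pair \<open>f = c^i\<close>, \<open>h = c^j\<close> the alternating word f h
  f h ... satisfies \<open>chain\<close>. As \<open>f\<close> and \<open>h\<close> commute, both
  junctions cancel the same amount \<open>a\<close>, and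
  \<open>2a + 3\<delta> + 1 \<le> L f, L h\<close> is the defining inequality of the pair
  rewritten.\<close>

lemma exists_linear_power:
  assumes c: "c \<in> carrier G" "c \<noteq> \<one>"
  shows "\<exists>s::int. s > 0 \<and> (\<forall>n::nat. real n \<le> L (c [^] (s * int n)))"
proof -
  obtain i j :: int where ij: "max (L (c [^] i)) (L (c [^] j)) + 3 * \<delta> + 1 \<le> L (c [^] (i + j))"
    using exists_good_pair[OF c] by blast
  define f h where "f = c [^] i" and "h = c [^] j"
  have fh: "f \<in> carrier G" "h \<in> carrier G" using c by (auto simp: f_def h_def)
  have prod: "f \<otimes> h = c [^] (i + j)" "h \<otimes> f = c [^] (i + j)"
    using c by (auto simp: f_def h_def int_pow_mult[symmetric] add.commute)
  define a where "a = gprod \<one> (inv f) h"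
  have a: "a = (L f + L h - L (c [^] (i + j))) / 2"
    using fh by (simp add: a_def gprod_def dst_one L_inv dst_def prod)
  have a': "gprod \<one> (inv h) f = a"
    using fh by (simp add: a gprod_def dst_one L_inv dst_def prod)
  have a0: "0 \<le> a" using fh by (simp add: a_def gprod_nonneg)
  have big: "2 * a + 3 * \<delta> + 1 \<le> L f" "2 * a + 3 * \<delta> + 1 \<le> L h"
    using ij unfolding a f_def[symmetric] h_def[symmetric] by (auto simp: field_simps max_def split: if_splits)
  have lin: "real n \<le> L (c [^] ((i + j) * int n))" for n :: nat
  proof (cases n)
    case (Suc k)
    define al where "al = (\<lambda>n. concat (replicate n [f, h]))"
    have "list_prod G (al n) = c [^] ((i + j) * int n)" for n
    proof (induction n)
      case (Suc n)
      have "list_prod G (al (Suc n)) = (f \<otimes> h) \<otimes> list_prod G (al n)"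
        using fh list_prod_in[of "al n"] by (simp add: al_def m_assoc)
      then show ?case using Suc c prod by (simp add: int_pow_mult[symmetric] algebra_simps)
    qed (simp add: al_def)
    moreover have "successively (\<lambda>s t. gprod \<one> (inv s) t \<le> a) (al n)" for n
    proof (induction n)
      case (Suc n)
      then show ?case using a' by (cases n) (auto simp: al_def a_def)
    qed (simp add: al_def)
    moreover have al: "set (al n) \<subseteq> {f, h}" "length (al n) = 2 * n" for n
      by (induction n) (auto simp: al_def)
    moreover have "al n \<noteq> []" using al(2)[of n] Suc by auto
    moreover have "2 * a + 3 * \<delta> + 1 \<le> L s" if "s \<in> set (al n)" for s
      using al(1)[of n] big that by blast
    ultimately have "real (2 * n) \<le> L (c [^] ((i + j) * int n))"
      using chain[of "al n" a] fh a0 by fastforce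
    then show ?thesis by simp
  qed (simp add: L_nonneg c)
  have ne: "i + j \<noteq> 0" using lin[of 1] by (auto simp: L_one)
  have "real n \<le> L (c [^] (\<bar>i + j\<bar> * int n))" for n :: nat
    using lin[of n] L_pow_abs[of c "(i + j) * int n"] c by (simp add: abs_mult)
  then show ?thesis using ne by (intro exI[of _ "\<bar>i + j\<bar>"]) auto
qed

text \<open>If every doubling of the exponent gained less than \<open>3\<delta> + 1\<close>, the
  length of \<open>c\<close> to the power \<open>s 2^k\<close> would be linear in k, against the
  exponential lower bound. The inequality obtained is the hypothesis of \<open>chain\<close> for a
  word repeating the single letter \<open>c^m\<close>.\<close>

lemma exists_good_power:
  assumes c: "c \<in> carrier G" "c \<noteq> \<one>"
  shows "\<exists>m::int. m > 0 \<and> L (c [^] m) + 3 * \<delta> + 1 \<le> L (c [^] (2 * m))"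
proof (rule ccontr)
  assume "\<not> ?thesis"
  then have neg: "L (c [^] (2 * m)) \<le> L (c [^] m) + (3 * \<delta> + 1)" if "m > 0" for m :: int
    using that by force
  obtain s :: int where s: "s > 0" "\<And>n::nat. real n \<le> L (c [^] (s * int n))"
    using exists_linear_power[OF c] by blast
  have up: "L (c [^] (s * 2 ^ k)) \<le> L (c [^] s) + real k * (3 * \<delta> + 1)" for k :: nat
  proof (induction k)
    case (Suc k)
    then show ?case using neg[of "s * 2 ^ k"] s(1) by (simp add: algebra_simps)
  qed simp
  define A B where "A = L (c [^] s)" and "B = 3 * \<delta> + 1"
  have le: "2 ^ k \<le> A + real k * B" for k :: nat
    using up[of k] s(2)[of "2 ^ k"] by (simp add: A_def B_def)
  have B: "B \<ge> 0" and A: "A \<ge> 0" using \<delta>_nonneg c by (auto simp: B_def A_def L_nonneg)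
  obtain k :: nat where k: "A + 2 * B + 2 < real k" using reals_Archimedean2 by blast
  have sq: "real k ^ 2 \<le> 2 ^ (2 * k)" for k :: nat
  proof -
    have "real k \<le> 2 ^ k" by (simp add: less_imp_le)
    then have "real k ^ 2 \<le> (2 ^ k) ^ 2" by (intro power_mono) auto
    then show ?thesis by (simp add: power_mult mult.commute)
  qed
  have "real k * real k \<le> A + 2 * real k * B" using sq[of k] le[of "2 * k"] by (simp add: power2_eq_square)
  moreover have "real k * (A + 2 * B + 2) \<le> real k * real k" using k by (intro mult_left_mono) auto
  moreover have "A \<le> real k * A" using k A B mult_right_mono[of 1 "real k" A] by simp
  ultimately show False using k A B by (simp add: algebra_simps)
qed

end

section \<open>The powers of an element form a quasi-axis\<close>

context hyp_group
begin

text \<open>Powers of a good power \<open>h = c^m\<close> form a local quasi-geodesic, so both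
  claims hold for them; the other powers of \<open>c\<close> stay within bounded distance of powers
  of \<open>h\<close>.\<close>

lemma axis:
  assumes c: "c \<in> carrier G" "c \<noteq> \<one>"
  obtains a \<epsilon> \<kappa> where "0 \<le> a" "0 < \<epsilon>" "\<And>n::int. \<epsilon> * real_of_int \<bar>n\<bar> - \<kappa> \<le> L (c [^] n)"
    "\<And>i j k::int. i \<le> j \<Longrightarrow> j \<le> k \<Longrightarrow> gprod (c [^] j) (c [^] i) (c [^] k) \<le> a"
proof -
  obtain m :: int where m: "m > 0" "L (c [^] m) + 3 * \<delta> + 1 \<le> L (c [^] (2 * m))"
    using exists_good_power[OF c] by blast
  define h where "h = c [^] m"
  have h: "h \<in> carrier G" using c by (simp add: h_def)
  have hpow: "h [^] (n::int) = c [^] (m * n)" for n using c by (simp add: h_def int_pow_pow)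
  have hh: "h \<otimes> h = c [^] (2 * m)" using c by (simp add: h_def int_pow_mult[symmetric])
  define a where "a = gprod \<one> (inv h) h"
  have a: "a = (2 * L h - L (c [^] (2 * m))) / 2"
    using h by (simp add: a_def gprod_def dst_one L_inv dst_def hh)
  have a0: "0 \<le> a" using h by (simp add: a_def gprod_nonneg)
  have big: "2 * a + 3 * \<delta> + 1 \<le> L h" using m unfolding a h_def by (simp add: field_simps)
  have rep: "list_prod G (replicate n x) = x [^] int n" if "x \<in> carrier G" for n x
  proof (induction n)
    case (Suc n)
    then show ?case using int_pow_mult[of x 1 "int n"] that by simp
  qed simp
  have succ: "successively P (replicate n x)" if "P x x" for P n and x :: 'a
  proof (induction n)
    case (Suc n)
    then show ?case using that by (cases n) auto
  qed simp
  have ch: "real n \<le> L (x [^] int n)" "n \<ge> 2 \<Longrightarrow> gprod \<one> (inv x) (x [^] (int n - 1)) \<le> a + \<delta>"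
    if n: "n \<ge> 1" and x: "x \<in> {h, inv h}" for n x
  proof -
    have xm: "x \<in> carrier G" "L x = L h" "gprod \<one> (inv x) x \<le> a"
      using x h by (auto simp: L_inv a_def gprod_commute)
    have "real (length (replicate n x)) \<le> L (list_prod G (replicate n x)) \<and>
      (tl (replicate n x) \<noteq> [] \<longrightarrow>
       gprod \<one> (inv (hd (replicate n x))) (list_prod G (tl (replicate n x))) \<le> a + \<delta>)"
      using n xm big a0 by (intro chain succ) auto
    then show "real n \<le> L (x [^] int n)" "n \<ge> 2 \<Longrightarrow> gprod \<one> (inv x) (x [^] (int n - 1)) \<le> a + \<delta>"
      using n xm by (auto simp: rep of_nat_diff)
  qed
  have linh: "real n \<le> L (h [^] int n)" for n using ch(1)[of n h] by (cases n) (auto simp: L_one)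
  have gpos: "gprod \<one> (inv x) (x [^] int k) \<le> a + \<delta>" if "k \<ge> 1" "x \<in> {h, inv h}" for k x
    using ch(2)[of "Suc k" x] that by simp
  have invpow: "inv h [^] int n = inv (h [^] int n)" for n using h by (simp add: int_pow_inv)
  \<comment> \<open>\<open>chain\<close> bounds only the product of \<open>inv h\<close> with a
    positive power. The path towards a negative power follows \<open>inv h\<close> for at least
    \<open>a + 2\<delta> + 1\<close>, so one hyperbolicity inequality gives the two-sided
    bound.\<close>
  have two: "gprod \<one> (inv (h [^] int n)) (h [^] int k) \<le> a + 2 * \<delta>" for n k
  proof (cases "n = 0 \<or> k = 0")
    case True
    then have "gprod \<one> (inv (h [^] int n)) (h [^] int k) = 0"
      using h by (auto simp: gprod_def dst_refl dst_commute)
    then show ?thesis using a0 \<delta>_nonneg by simp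
  next
    case False
    have "L h - (a + \<delta>) \<le> gprod \<one> (inv h) (inv (h [^] int n))"
    proof (cases "n = 1")
      case True
      then show ?thesis using h a0 \<delta>_nonneg by (simp add: gprod_refl dst_one L_inv)
    next
      case n1: False
      have split: "inv h [^] int n = inv h \<otimes> inv h [^] (int n - 1)"
        using int_pow_mult[of "inv h" 1 "int n - 1"] h by simp
      have "gprod (inv h) \<one> (inv h [^] int n) = gprod \<one> h (inv h [^] (int n - 1))"
        using gprod_left[of "inv h" \<one> h "inv h [^] (int n - 1)"] h split by simp
      also have "\<dots> \<le> a + \<delta>" using ch(2)[of n "inv h"] False n1 h by simp
      finally have "gprod (inv h) \<one> (inv h [^] int n) \<le> a + \<delta>" .
      moreover have "gprod (inv h) \<one> (inv h [^] int n) = L h - gprod \<one> (inv h) (inv h [^] int n)"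
        using gprod_flip[of \<one> "inv h" "inv h [^] int n"] h by (simp add: dst_one L_inv)
      ultimately show ?thesis using invpow by simp
    qed
    moreover have "min (gprod \<one> (inv h) (inv (h [^] int n))) (gprod \<one> (inv (h [^] int n)) (h [^] int k)) - \<delta>
        \<le> gprod \<one> (inv h) (h [^] int k)" using h by (intro hyp) auto
    moreover have "gprod \<one> (inv h) (h [^] int k) \<le> a + \<delta>" using gpos[of k h] False by simp
    ultimately show ?thesis using big \<delta>_nonneg by (auto simp: min_def split: if_splits)
  qed
  \<comment> \<open>Two errors of size \<open>m * L c\<close>, one for each exponent rounded down to
    a multiple of \<open>m\<close>.\<close>
  define b where "b = a + 2 * \<delta> + 2 * (real_of_int m * L c)"
  have Lc: "0 \<le> L c" using c L_nonneg by simp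
  have rem: "L (c [^] (p mod m)) \<le> real_of_int m * L c" for p :: int
  proof -
    have "0 \<le> p mod m" "p mod m \<le> m" using m by (auto simp: pos_mod_bound less_imp_le)
    then have "real_of_int \<bar>p mod m\<bar> * L c \<le> real_of_int m * L c" using Lc by (intro mult_right_mono) auto
    then show ?thesis using L_pow_le[of c "p mod m"] c by linarith
  qed
  have near: "dst (c [^] p) (h [^] (p div m)) \<le> real_of_int m * L c" for p :: int
  proof -
    have "m * (p div m) - p = - (p mod m)" by (simp add: minus_mod_eq_mult_div[symmetric])
    then have "dst (c [^] p) (h [^] (p div m)) = L (c [^] (- (p mod m)))"
      using dst_pow[of c p "m * (p div m)"] c by (simp add: hpow)
    then show ?thesis using rem[of p] L_inv[of "c [^] (p mod m)"] c by (simp add: int_pow_neg)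
  qed
  have both: "gprod \<one> (inv (c [^] p)) (c [^] q) \<le> b" if pq: "p \<ge> 0" "q \<ge> 0" for p q :: int
  proof -
    define hp hq where "hp = h [^] (p div m)" and "hq = h [^] (q div m)"
    have mem: "hp \<in> carrier G" "hq \<in> carrier G" "c [^] p \<in> carrier G" "c [^] q \<in> carrier G"
      using c h by (auto simp: hp_def hq_def)
    have hp': "hp = h [^] int (nat (p div m))" "hq = h [^] int (nat (q div m))"
      using pq m by (auto simp: hp_def hq_def pos_imp_zdiv_nonneg_iff)
    have "gprod \<one> (inv (c [^] p)) (c [^] q) \<le> gprod \<one> (inv (c [^] p)) hq + dst (c [^] q) hq"
      using mem by (intro gprod_change) auto
    also have "gprod \<one> (inv (c [^] p)) hq = gprod \<one> hq (inv (c [^] p))" using mem by (simp add: gprod_commute)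
    also have "\<dots> \<le> gprod \<one> hq (inv hp) + dst (inv (c [^] p)) (inv hp)"
      using mem by (intro gprod_change) auto
    also have "dst (inv (c [^] p)) (inv hp) = dst (c [^] p) hp"
    proof -
      have "c [^] p \<otimes> inv hp = inv hp \<otimes> c [^] p"
        using c by (simp add: hp_def hpow int_pow_neg[symmetric] int_pow_mult[symmetric] add.commute)
      then have "dst (inv (c [^] p)) (inv hp) = dst hp (c [^] p)" using mem by (simp add: dst_def)
      then show ?thesis using mem by (simp add: dst_commute)
    qed
    also have "gprod \<one> hq (inv hp) \<le> a + 2 * \<delta>"
      using two[of "nat (p div m)" "nat (q div m)"] mem by (simp add: hp' gprod_commute del: of_nat_nat int_nat_eq)
    finally show ?thesis using near[of p] near[of q] by (simp add: b_def hp_def hq_def)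
  qed
  have "gprod (c [^] j) (c [^] i) (c [^] k) \<le> b" if "i \<le> j" "j \<le> k" for i j k :: int
  proof -
    have 1: "c [^] j \<otimes> inv (c [^] (j - i)) = c [^] i" "c [^] j \<otimes> c [^] (k - j) = c [^] k"
      using c by (simp_all add: int_pow_neg[symmetric] int_pow_mult[symmetric])
    have "gprod (c [^] j) (c [^] i) (c [^] k) = gprod \<one> (inv (c [^] (j - i))) (c [^] (k - j))"
      using gprod_left[of "c [^] j" \<one> "inv (c [^] (j - i))" "c [^] (k - j)"] c 1 by simp
    then show ?thesis using both[of "j - i" "k - j"] that by simp
  qed
  moreover have "1 / real_of_int m * real_of_int \<bar>n\<bar> - (1 + real_of_int m * L c) \<le> L (c [^] n)" for n :: int
  proof -
    define p where "p = \<bar>n\<bar>"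
    define k where "k = p div m"
    have k: "k \<ge> 0" "real_of_int p < real_of_int m * (real_of_int k + 1)"
    proof -
      show "k \<ge> 0" using m by (simp add: k_def p_def pos_imp_zdiv_nonneg_iff)
      have "p < m * (k + 1)" using mult_div_mod_eq[of m p] pos_mod_bound[OF m(1), of p] unfolding k_def distrib_left mult_1_right by linarith
      then show "real_of_int p < real_of_int m * (real_of_int k + 1)"
        by (metis of_int_1 of_int_add of_int_less_iff of_int_mult)
    qed
    have "real_of_int k \<le> L (h [^] k)" using linh[of "nat k"] k by simp
    also have "\<dots> = dst \<one> (h [^] k)" using h by (simp add: dst_one)
    also have "\<dots> \<le> dst \<one> (c [^] p) + dst (c [^] p) (h [^] k)" using c h by (intro dst_triangle) auto
    also have "\<dots> \<le> L (c [^] p) + real_of_int m * L c" using near[of p] c by (simp add: dst_one k_def)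
    finally have "real_of_int k - real_of_int m * L c \<le> L (c [^] n)" using L_pow_abs[of c n] c by (simp add: p_def)
    moreover have "1 / real_of_int m * real_of_int p \<le> real_of_int k + 1" using k m by (simp add: field_simps)
    ultimately show ?thesis by (simp add: p_def)
  qed
  moreover have "0 \<le> b" using a0 \<delta>_nonneg Lc m by (simp add: b_def)
  moreover have "0 < 1 / real_of_int m" using m by simp
  ultimately show ?thesis using that by blast
qed

end

section \<open>Projection to the axis and overlap of its translates\<close>

locale hyp_axis = hyp_group G L \<delta> for G (structure) and L and \<delta> +
  fixes c :: "'a" and a \<epsilon> \<kappa> :: real
  assumes c: "c \<in> carrier G" "c \<noteq> \<one>" and a0: "0 \<le> a" and e0: "0 < \<epsilon>"
    and growth: "\<epsilon> * real_of_int \<bar>n\<bar> - \<kappa> \<le> L (c [^] (n::int))"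
    and axis_bound: "i \<le> j \<Longrightarrow> j \<le> k \<Longrightarrow> gprod (c [^] (j::int)) (c [^] (i::int)) (c [^] (k::int)) \<le> a"
begin

text \<open>A discrete intermediate value argument. Let \<open>i\<close> be the last index before
  the product of \<open>c^i\<close> and \<open>c^\<beta>\<close> at \<open>p\<close> exceeds
  \<open>a' + \<delta>\<close>; the product with \<open>c^\<alpha>\<close> is then small too, up to
  one step of length \<open>L c\<close>. Seen from \<open>c^i\<close>, the point \<open>p\<close>
  therefore lies almost fully in both directions of the axis, which the axis bound \<open>a\<close>
  permits only if \<open>p\<close> is near \<open>c^i\<close>.\<close>

lemma project:
  assumes p: "p \<in> carrier G" and ab: "\<alpha> \<le> \<beta>" and le: "gprod p (c [^] (\<alpha>::int)) (c [^] (\<beta>::int)) \<le> a'"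
  shows "\<exists>j::int. dst p (c [^] j) \<le> a + a' + 2 * \<delta> + L c"
proof (cases "gprod p (c [^] \<beta>) (c [^] \<beta>) \<le> a' + \<delta>")
  case True
  then show ?thesis using p c a0 \<delta>_nonneg L_nonneg[of c] by (intro exI[of _ \<beta>]) (simp add: gprod_refl)
next
  case False
  have "\<exists>i. \<alpha> \<le> i \<and> i < \<beta> \<and> gprod p (c [^] i) (c [^] \<beta>) \<le> a' + \<delta> \<and> \<not> gprod p (c [^] (i + 1)) (c [^] \<beta>) \<le> a' + \<delta>"
  proof (rule ccontr)
    assume no: "\<not> ?thesis"
    have "j \<le> \<beta> \<longrightarrow> gprod p (c [^] j) (c [^] \<beta>) \<le> a' + \<delta>" if "\<alpha> \<le> j" for j
      using that
    proof (induction j rule: int_ge_induct)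
      case base
      then show ?case using le \<delta>_nonneg by simp
    next
      case (step i)
      then show ?case using no by force
    qed
    then show False using False ab by blast
  qed
  then obtain i where i: "\<alpha> \<le> i" "i < \<beta>" "gprod p (c [^] i) (c [^] \<beta>) \<le> a' + \<delta>"
    "\<not> gprod p (c [^] (i + 1)) (c [^] \<beta>) \<le> a' + \<delta>" by blast
  have "min (gprod p (c [^] \<alpha>) (c [^] (i + 1))) (gprod p (c [^] (i + 1)) (c [^] \<beta>)) - \<delta>
      \<le> gprod p (c [^] \<alpha>) (c [^] \<beta>)" using p c by (intro hyp) auto
  then have 1: "gprod p (c [^] \<alpha>) (c [^] (i + 1)) \<le> a' + \<delta>" using i le by (auto simp: min_def split: if_splits)
  have "gprod p (c [^] \<alpha>) (c [^] i) \<le> gprod p (c [^] \<alpha>) (c [^] (i + 1)) + dst (c [^] i) (c [^] (i + 1))"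
    using p c by (intro gprod_change) auto
  then have 2: "gprod p (c [^] \<alpha>) (c [^] i) \<le> a' + \<delta> + L c" using 1 c by (simp add: dst_pow)
  have 3: "gprod (c [^] i) p (c [^] \<alpha>) \<ge> dst p (c [^] i) - (a' + \<delta> + L c)"
    using 2 gprod_flip[of p "c [^] i" "c [^] \<alpha>"] p c by (simp add: gprod_commute)
  have 4: "gprod (c [^] i) p (c [^] \<beta>) \<ge> dst p (c [^] i) - (a' + \<delta>)"
    using i gprod_flip[of p "c [^] i" "c [^] \<beta>"] p c by simp
  have "min (gprod (c [^] i) (c [^] \<alpha>) p) (gprod (c [^] i) p (c [^] \<beta>)) - \<delta>
      \<le> gprod (c [^] i) (c [^] \<alpha>) (c [^] \<beta>)" using p c by (intro hyp) auto
  moreover have "\<dots> \<le> a" using i by (intro axis_bound) auto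
  ultimately have "dst p (c [^] i) \<le> a + a' + 2 * \<delta> + L c"
    using 3 4 p c L_nonneg[of c] by (auto simp: min_def gprod_commute split: if_splits)
  then show ?thesis by blast
qed

lemma project':
  assumes p: "p \<in> carrier G" and le: "gprod p (c [^] (\<alpha>::int)) (c [^] (\<beta>::int)) \<le> a'"
  shows "\<exists>j::int. dst p (c [^] j) \<le> a + a' + 2 * \<delta> + L c"
proof (cases "\<alpha> \<le> \<beta>")
  case False
  then show ?thesis using project[of p \<beta> \<alpha> a'] p le c by (simp add: gprod_commute)
qed (use assms project in blast)

text \<open>The radius of \<open>project'\<close> for \<open>a' = a + 2\<delta>\<close>, the bound
  that two hyperbolicity inequalities produce from the axis bound \<open>a\<close>.\<close>

definition D where "D = a + (a + 2 * \<delta>) + 2 * \<delta> + L c"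

definition commensurates :: "'a \<Rightarrow> bool" where
  "commensurates g \<longleftrightarrow> (\<exists>(r::int) (s::int). r \<noteq> 0 \<and> g \<otimes> c [^] r = c [^] s \<otimes> g)"

text \<open>A long overlap keeps a window of b + 1 consecutive points of the axis within
  \<open>D\<close> of the axis translated by \<open>g\<close>. Two of them have the same
  displacement in the ball of b elements, and comparing them yields a relation between a conjugate
  of a power of \<open>c\<close> and a power of \<open>c\<close>. The start of the window is what
  costs a multiple of \<open>L g\<close>.\<close>

lemma overlap:
  obtains B where "\<And>g N M. g \<in> carrier G \<Longrightarrow> \<not> commensurates g \<Longrightarrow>
    gprod \<one> (c [^] (N::int)) (g \<otimes> c [^] (M::int)) \<le> B * (L g + 1)"
proof -
  define b where "b = card {g \<in> carrier G. L g \<le> D}"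
  define B where "B = (1 / \<epsilon> + \<bar>a + 2 * \<delta> + \<kappa>\<bar> / \<epsilon> + 2 + real b) * L c + a + \<delta>"
  have Lc: "0 \<le> L c" using c L_nonneg by simp
  have "gprod \<one> (c [^] N) (g \<otimes> c [^] M) \<le> B * (L g + 1)"
    if g: "g \<in> carrier G" and nc: "\<not> commensurates g" for g and N M :: int
  proof (rule ccontr)
    assume neg: "\<not> ?thesis"
    define Z where "Z = gprod \<one> (c [^] N) (g \<otimes> c [^] M)"
    have Lg: "0 \<le> L g" using g L_nonneg by simp
    \<comment> \<open>For \<open>k \<ge> k0\<close> the growth of powers puts \<open>c^k\<close> and
      its inverse at distance more than \<open>L g + a + 2\<delta>\<close> from \<one>, beyond the
      reach of the path from \<one> to \<open>g\<close>.\<close>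
    define k0 where "k0 = nat \<lceil>(L g + \<bar>a + 2 * \<delta> + \<kappa>\<bar>) / \<epsilon>\<rceil> + 1"
    have q0: "0 \<le> (L g + \<bar>a + 2 * \<delta> + \<kappa>\<bar>) / \<epsilon>" using Lg e0 by simp
    have k0: "(L g + \<bar>a + 2 * \<delta> + \<kappa>\<bar>) / \<epsilon> < real k0" "real k0 \<le> (L g + \<bar>a + 2 * \<delta> + \<kappa>\<bar>) / \<epsilon> + 2"
      unfolding k0_def using q0 by linarith+
    have k0': "L g + \<bar>a + 2 * \<delta> + \<kappa>\<bar> < \<epsilon> * real k0" using k0(1) e0 by (simp add: field_simps)
    have Zbig: "(real k0 + real b) * L c + a + \<delta> < Z"
    proof -
      have "real k0 + real b \<le> (1 / \<epsilon> + \<bar>a + 2 * \<delta> + \<kappa>\<bar> / \<epsilon> + 2 + real b) * (L g + 1)"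
      proof -
        have "(L g + \<bar>a + 2 * \<delta> + \<kappa>\<bar>) / \<epsilon> = (1 / \<epsilon>) * L g + \<bar>a + 2 * \<delta> + \<kappa>\<bar> / \<epsilon>"
          by (simp add: add_divide_distrib)
        moreover have "0 \<le> \<bar>a + 2 * \<delta> + \<kappa>\<bar> / \<epsilon> * L g" "0 \<le> real b * L g" "0 \<le> 1 / \<epsilon>" using e0 Lg by auto
        ultimately show ?thesis using k0(2) Lg by (simp only: distrib_left distrib_right mult_1_left mult_1_right)
      qed
      then have "(real k0 + real b) * L c \<le> (1 / \<epsilon> + \<bar>a + 2 * \<delta> + \<kappa>\<bar> / \<epsilon> + 2 + real b) * (L g + 1) * L c"
        using Lc by (intro mult_right_mono) auto
      moreover have "a + \<delta> \<le> (a + \<delta>) * (L g + 1)"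
        using mult_left_mono[of 1 "L g + 1" "a + \<delta>"] Lg a0 \<delta>_nonneg by simp
      moreover have "B * (L g + 1) = (1 / \<epsilon> + \<bar>a + 2 * \<delta> + \<kappa>\<bar> / \<epsilon> + 2 + real b) * (L g + 1) * L c + (a + \<delta>) * (L g + 1)"
        unfolding B_def by (simp only: distrib_left distrib_right mult_ac add_ac)
      ultimately show ?thesis using neg unfolding Z_def by linarith
    qed
    define \<sigma> :: int where "\<sigma> = sgn N"
    have N: "k0 + b \<le> nat \<bar>N\<bar>"
    proof -
      have "Z \<le> dst \<one> (c [^] N)" unfolding Z_def using c g by (intro gprod_le) auto
      then have "Z \<le> real_of_int \<bar>N\<bar> * L c" using L_pow_le[of c N] c by (simp add: dst_one)
      then have "(real k0 + real b) * L c < real_of_int \<bar>N\<bar> * L c" using Zbig a0 \<delta>_nonneg by linarith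
      then have "real k0 + real b < real_of_int \<bar>N\<bar>" using Lc by (simp add: mult_less_cancel_right)
      then show ?thesis by linarith
    qed
    \<comment> \<open>Both detours are excluded in turn: the branch towards \<open>c^N\<close> by
      the length of the overlap, the branch from \<one> to \<open>g\<close> by the choice of
      \<open>k0\<close>. What remains is that \<open>p\<close> is close to the segment from
      \<open>g\<close> to \<open>g c^M\<close>.\<close>
    have "\<exists>j::int. dst (inv g \<otimes> c [^] (\<sigma> * int k)) (c [^] j) \<le> D" if k: "k \<in> {k0..k0 + b}" for k
    proof -
      define p where "p = c [^] (\<sigma> * int k)"
      have p: "p \<in> carrier G" using c by (simp add: p_def)
      have kN: "int k \<le> \<bar>N\<bar>" using k N by auto
      have s: "N = \<sigma> * \<bar>N\<bar>" by (simp add: \<sigma>_def mult_sgn_abs)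
      have b1: "gprod p \<one> (c [^] N) \<le> a"
      proof (cases "N \<ge> 0")
        case True
        then show ?thesis using axis_bound[of 0 "\<sigma> * int k" N] kN by (cases "N = 0") (auto simp: p_def \<sigma>_def)
      next
        case False
        then show ?thesis using axis_bound[of N "\<sigma> * int k" 0] kN c by (auto simp: p_def \<sigma>_def gprod_commute)
      qed
      have s1: "\<bar>\<sigma>\<bar> = 1" using N k0_def by (auto simp: \<sigma>_def sgn_if)
      then have abs: "\<bar>\<sigma> * int k\<bar> = int k" by (simp add: abs_mult)
      have Lp: "L p \<le> (real k0 + real b) * L c" "L g + a + 2 * \<delta> < L p"
      proof -
        have "L p \<le> real k * L c" using L_pow_le[of c "\<sigma> * int k"] c abs by (simp add: p_def)
        also have "\<dots> \<le> (real k0 + real b) * L c" using k Lc by (intro mult_right_mono) auto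
        finally show "L p \<le> (real k0 + real b) * L c" .
        have "\<epsilon> * real k - \<kappa> \<le> L p" using growth[of "\<sigma> * int k"] abs by (simp add: p_def)
        moreover have "\<epsilon> * real k0 \<le> \<epsilon> * real k" using k e0 by simp
        ultimately show "L g + a + 2 * \<delta> < L p" using k0' by linarith
      qed
      have "Z \<le> gprod p (c [^] N) (g \<otimes> c [^] M) + dst \<one> p"
        unfolding Z_def using c g p by (intro gprod_change_base) auto
      then have b2: "a + \<delta> < gprod p (c [^] N) (g \<otimes> c [^] M)" using Zbig Lp p by (simp add: dst_one)
      have "min (gprod p \<one> (g \<otimes> c [^] M)) (gprod p (g \<otimes> c [^] M) (c [^] N)) - \<delta> \<le> gprod p \<one> (c [^] N)"
        using c g p by (intro hyp) auto
      then have b3: "gprod p \<one> (g \<otimes> c [^] M) \<le> a + \<delta>"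
        using b1 b2 gprod_commute[of "c [^] N" "g \<otimes> c [^] M" p] c g by (auto simp: min_def split: if_splits)
      have "dst p \<one> - dst \<one> g \<le> gprod p \<one> g" using p g by (intro gprod_ge_dst) auto
      then have b4: "a + 2 * \<delta> < gprod p \<one> g" using Lp p g dst_commute[of p \<one>] by (simp add: dst_one)
      have "min (gprod p \<one> g) (gprod p g (g \<otimes> c [^] M)) - \<delta> \<le> gprod p \<one> (g \<otimes> c [^] M)"
        using c g p by (intro hyp) auto
      then have "gprod p g (g \<otimes> c [^] M) \<le> a + 2 * \<delta>" using b3 b4 by (auto simp: min_def split: if_splits)
      then have "gprod (inv g \<otimes> p) (c [^] (0::int)) (c [^] M) \<le> a + 2 * \<delta>"
        using gprod_left_inv[of p g \<one> "c [^] M"] c g p by simp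
      then show ?thesis using project'[of "inv g \<otimes> p" 0 M "a + 2 * \<delta>"] g p by (simp add: D_def p_def)
    qed
    then have "\<forall>k\<in>{k0..k0 + b}. \<exists>j::int. dst (inv g \<otimes> c [^] (\<sigma> * int k)) (c [^] j) \<le> D" by blast
    then obtain j :: "nat \<Rightarrow> int" where j: "\<And>k. k \<in> {k0..k0 + b} \<Longrightarrow> dst (inv g \<otimes> c [^] (\<sigma> * int k)) (c [^] j k) \<le> D"
      by metis
    \<comment> \<open>These are the displacements from the window points, moved by
      \<open>inv g\<close>, to their projections.\<close>
    have "\<exists>i\<in>{k0..k0 + b}. \<exists>i'\<in>{k0..k0 + b}. i < i' \<and>
        inv (inv g \<otimes> c [^] (\<sigma> * int i)) \<otimes> c [^] j i = inv (inv g \<otimes> c [^] (\<sigma> * int i')) \<otimes> c [^] j i'"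
      using j c g by (intro ball_repeat[where r = D]) (auto simp: b_def[symmetric] dst_def)
    then obtain i i' where ii: "i < i'"
      "inv (inv g \<otimes> c [^] (\<sigma> * int i)) \<otimes> c [^] j i = inv (inv g \<otimes> c [^] (\<sigma> * int i')) \<otimes> c [^] j i'" by blast
    define p q where "p = c [^] (\<sigma> * int i)" and "q = c [^] (\<sigma> * int i')"
    have pq: "p \<in> carrier G" "q \<in> carrier G" using c by (auto simp: p_def q_def)
    have "inv p \<otimes> (g \<otimes> c [^] j i) = inv q \<otimes> (g \<otimes> c [^] j i')"
      using ii(2) g c pq by (simp add: p_def[symmetric] q_def[symmetric] inv_mult_group m_assoc)
    then have "q \<otimes> (inv p \<otimes> (g \<otimes> c [^] j i)) \<otimes> inv (c [^] j i) = q \<otimes> (inv q \<otimes> (g \<otimes> c [^] j i')) \<otimes> inv (c [^] j i)" by simp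
    then have "q \<otimes> inv p \<otimes> g = g \<otimes> (c [^] j i' \<otimes> inv (c [^] j i))" using g c pq by (simp add: m_assoc)
    moreover have "c [^] j i' \<otimes> inv (c [^] j i) = c [^] (j i' - j i)" using c by (simp add: int_pow_diff)
    moreover have "q \<otimes> inv p = c [^] (\<sigma> * int i' - \<sigma> * int i)" using c by (simp add: q_def p_def int_pow_diff)
    ultimately have rel: "g \<otimes> c [^] (j i' - j i) = c [^] (\<sigma> * int i' - \<sigma> * int i) \<otimes> g" by simp
    have "j i' \<noteq> j i"
    proof
      assume "j i' = j i"
      then have "g = c [^] (\<sigma> * int i' - \<sigma> * int i) \<otimes> g" using rel g by simp
      then have "c [^] (\<sigma> * int i' - \<sigma> * int i) = \<one>" using g c by (metis int_pow_closed r_cancel_one' )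
      then have "\<sigma> * int i' - \<sigma> * int i = 0" by (rule pow_eq_one[OF c])
      moreover have "\<sigma> \<noteq> 0" using N k0_def by (auto simp: \<sigma>_def sgn_if)
      ultimately show False using ii(1) by simp
    qed
    then show False using rel nc unfolding commensurates_def by (metis eq_iff_diff_eq_0)
  qed
  then show ?thesis using that by blast
qed

text \<open>\<open>D\<close> does not depend on \<open>g\<close>. Far out, at exponents
  \<open>r k\<close> and \<open>- r k\<close>, the axis translated by \<open>g\<close> stays at
  distance \<open>L g\<close> from the axis of \<open>c\<close>; by hyperbolicity the middle point
  \<open>g\<close> between two such far points is then uniformly close to the axis.\<close>

lemma near_axis:
  assumes g: "g \<in> carrier G" and "commensurates g"
  shows "\<exists>i::int. dst g (c [^] i) \<le> D"
proof -
  obtain r s :: int where rs: "r \<noteq> 0" "g \<otimes> c [^] r = c [^] s \<otimes> g" using assms unfolding commensurates_def by blast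
  have relk: "g \<otimes> c [^] (r * k) = c [^] (s * k) \<otimes> g" for k :: int
    using conj_rel_pow[OF g c(1) rs(2)] .
  have "\<exists>k::int. k > 0 \<and> L g + a + 2 * \<delta> < L (c [^] (r * k)) \<and> L g + a + 2 * \<delta> < L (c [^] (r * (- k)))"
  proof -
    define k where "k = nat \<lceil>(L g + a + 2 * \<delta> + \<bar>\<kappa>\<bar>) / \<epsilon>\<rceil> + 1"
    have "(L g + a + 2 * \<delta> + \<bar>\<kappa>\<bar>) / \<epsilon> < real k" unfolding k_def by linarith
    then have 1: "L g + a + 2 * \<delta> + \<bar>\<kappa>\<bar> < \<epsilon> * real k" using e0 by (simp add: field_simps)
    have "int k \<le> \<bar>r\<bar> * int k" using rs(1) mult_right_mono[of 1 "\<bar>r\<bar>" "int k"] by simp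
    then have 2: "int k \<le> \<bar>r * int k\<bar>" "int k \<le> \<bar>r * (- int k)\<bar>" by (auto simp: abs_mult)
    have "L g + a + 2 * \<delta> < L (c [^] n)" if "int k \<le> \<bar>n\<bar>" for n :: int
    proof -
      have "\<epsilon> * real k \<le> \<epsilon> * real_of_int \<bar>n\<bar>" using that e0 by (intro mult_left_mono) linarith+
      then show ?thesis using growth[of n] 1 by linarith
    qed
    moreover have "k > 0" unfolding k_def by simp
    ultimately show ?thesis using 2 by (intro exI[of _ "int k"]) auto
  qed
  then obtain k :: int where k: "k > 0" "L g + a + 2 * \<delta> < L (c [^] (r * k))" "L g + a + 2 * \<delta> < L (c [^] (r * (- k)))" by blast
  have far: "a + 2 * \<delta> < gprod g (g \<otimes> c [^] (r * k)) (c [^] (s * k))"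
    if "L g + a + 2 * \<delta> < L (c [^] (r * k))" for k :: int
  proof -
    have "dst g (g \<otimes> c [^] (r * k)) - dst (g \<otimes> c [^] (r * k)) (c [^] (s * k)) \<le> gprod g (g \<otimes> c [^] (r * k)) (c [^] (s * k))"
      using g c by (intro gprod_ge_dst) auto
    moreover have "dst g (g \<otimes> c [^] (r * k)) = L (c [^] (r * k))" using g c by (simp add: dst_def)
    moreover have "dst (g \<otimes> c [^] (r * k)) (c [^] (s * k)) = L g"
      using g c by (simp add: relk dst_def inv_mult_group m_assoc L_inv)
    ultimately show ?thesis using that by simp
  qed
  define x y x' y' where "x = g \<otimes> c [^] (r * (- k))" and "y = g \<otimes> c [^] (r * k)"
    and "x' = c [^] (s * (- k))" and "y' = c [^] (s * k)"
  have mem: "x \<in> carrier G" "y \<in> carrier G" "x' \<in> carrier G" "y' \<in> carrier G"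
    using g c by (auto simp: x_def y_def x'_def y'_def)
  have gxy: "gprod g x y \<le> a"
  proof -
    have "gprod g x y = gprod (c [^] (0::int)) (c [^] (r * (- k))) (c [^] (r * k))"
      using gprod_left[of g \<one> "c [^] (r * (- k))" "c [^] (r * k)"] g c by (simp add: x_def y_def)
    also have "\<dots> \<le> a"
    proof (cases "r > 0")
      case True
      then have "r * - k \<le> 0" "0 \<le> r * k" using k by (auto simp: mult_le_0_iff)
      then show ?thesis by (intro axis_bound)
    next
      case False
      then have "r * k \<le> 0" "0 \<le> r * - k" using k by (auto simp: mult_le_0_iff)
      then have "gprod (c [^] (0::int)) (c [^] (r * k)) (c [^] (r * (- k))) \<le> a" by (intro axis_bound)
      then show ?thesis using c by (simp add: gprod_commute)
    qed
    finally show ?thesis .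
  qed
  have fx: "a + 2 * \<delta> < gprod g x x'" using far[of "- k"] k(3) by (simp add: x_def x'_def)
  have fy: "a + 2 * \<delta> < gprod g y' y" using far[of k] k(2) mem gprod_commute[of y y' g] by (simp add: y_def y'_def)
  have "min (gprod g x x') (gprod g x' y) - \<delta> \<le> gprod g x y" using mem g by (intro hyp) auto
  then have 1: "gprod g x' y \<le> a + \<delta>" using fx gxy \<delta>_nonneg by (auto simp: min_def split: if_splits)
  have "min (gprod g x' y') (gprod g y' y) - \<delta> \<le> gprod g x' y" using mem g by (intro hyp) auto
  then have "gprod g x' y' \<le> a + 2 * \<delta>" using fy 1 \<delta>_nonneg by (auto simp: min_def split: if_splits)
  then show ?thesis using project'[of g "s * (- k)" "s * k" "a + 2 * \<delta>"] g by (simp add: D_def x'_def y'_def)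
qed

end

section \<open>Commensurators, centralizers and the CSA property\<close>

definition csa :: "('a, 'm) monoid_scheme \<Rightarrow> 'a set \<Rightarrow> bool" where
  "csa M S \<longleftrightarrow>
     (\<forall>x\<in>S. \<forall>y\<in>S. \<forall>z\<in>S. y \<noteq> \<one>\<^bsub>M\<^esub> \<longrightarrow> x \<otimes>\<^bsub>M\<^esub> y = y \<otimes>\<^bsub>M\<^esub> x \<longrightarrow> y \<otimes>\<^bsub>M\<^esub> z = z \<otimes>\<^bsub>M\<^esub> y \<longrightarrow>
        x \<otimes>\<^bsub>M\<^esub> z = z \<otimes>\<^bsub>M\<^esub> x) \<and>
     (\<forall>x\<in>S. \<forall>g\<in>S. x \<noteq> \<one>\<^bsub>M\<^esub> \<longrightarrow>
        (g \<otimes>\<^bsub>M\<^esub> x \<otimes>\<^bsub>M\<^esub> inv\<^bsub>M\<^esub> g) \<otimes>\<^bsub>M\<^esub> x = x \<otimes>\<^bsub>M\<^esub> (g \<otimes>\<^bsub>M\<^esub> x \<otimes>\<^bsub>M\<^esub> inv\<^bsub>M\<^esub> g) \<longrightarrow>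
        g \<otimes>\<^bsub>M\<^esub> x = x \<otimes>\<^bsub>M\<^esub> g)"

context hyp_axis
begin

text \<open>All powers of \<open>g\<close> commensurate \<open>c\<close>, with exponents
  \<open>r^q\<close> and \<open>s^q\<close>, so all of them lie within the same \<open>D\<close> of
  the axis. Two have equal displacement, and their quotient is a power of \<open>c\<close>.\<close>

lemma power_in_axis:
  assumes g: "g \<in> carrier G" and "commensurates g"
  shows "\<exists>(m::nat) k::int. m > 0 \<and> g [^] m = c [^] k"
proof -
  obtain r s :: int where rs: "r \<noteq> 0" "g \<otimes> c [^] r = c [^] s \<otimes> g" using assms unfolding commensurates_def by blast
  have rel: "g [^] (q::nat) \<otimes> c [^] (r ^ q) = c [^] (s ^ q) \<otimes> g [^] q" for q
  proof (induction q)
    case 0 then show ?case using c by simp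
  next
    case (Suc q)
    have "g [^] Suc q \<otimes> c [^] (r ^ Suc q) = g [^] q \<otimes> (g \<otimes> c [^] (r * r ^ q))" using g c by (simp add: m_assoc)
    also have "\<dots> = g [^] q \<otimes> (c [^] (s * r ^ q) \<otimes> g)" using conj_rel_pow[OF g c(1) rs(2)] by simp
    also have "\<dots> = (g [^] q \<otimes> c [^] (r ^ q * s)) \<otimes> g" using g c by (simp add: m_assoc mult.commute)
    also have "\<dots> = (c [^] (s ^ q * s) \<otimes> g [^] q) \<otimes> g" using conj_rel_pow[OF _ c(1) Suc] g by simp
    finally show ?case using g c by (simp add: m_assoc mult.commute)
  qed
  have "commensurates (g [^] (q::nat))" for q
    unfolding commensurates_def using rel[of q] rs(1) by (intro exI[of _ "r ^ q"] exI[of _ "s ^ q"]) auto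
  then have "\<forall>q::nat. \<exists>i::int. dst (g [^] q) (c [^] i) \<le> D" using near_axis g by blast
  then obtain i :: "nat \<Rightarrow> int" where i: "\<And>q::nat. dst (g [^] q) (c [^] i q) \<le> D" by metis
  define b where "b = card {g \<in> carrier G. L g \<le> D}"
  have "\<exists>p\<in>{0..b}. \<exists>q\<in>{0..b}. p < q \<and> inv (g [^] p) \<otimes> c [^] i p = inv (g [^] q) \<otimes> c [^] i q"
    using i c g by (intro ball_repeat[where r = D]) (auto simp: b_def[symmetric] dst_def)
  then obtain p q where pq: "p < q" "inv (g [^] p) \<otimes> c [^] i p = inv (g [^] q) \<otimes> c [^] i q" by blast
  have "g [^] q = g [^] (q - p) \<otimes> g [^] p" using pq g by (simp add: nat_pow_mult)
  then have "g [^] q \<otimes> (inv (g [^] p) \<otimes> c [^] i p) = g [^] (q - p) \<otimes> c [^] i p" using g c by (simp add: m_assoc)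
  then have "c [^] i q = g [^] (q - p) \<otimes> c [^] i p" using pq(2) g c by simp
  then have "g [^] (q - p) = c [^] i q \<otimes> inv (c [^] i p)" using g c by (simp add: m_assoc)
  then have "g [^] (q - p) = c [^] (i q - i p)" using c by (simp add: int_pow_diff)
  then show ?thesis using pq(1) by (intro exI[of _ "q - p"] exI[of _ "i q - i p"]) auto
qed

end

context hyp_group
begin

lemma hyp_axisE:
  assumes "c \<in> carrier G" "c \<noteq> \<one>"
  obtains a \<epsilon> \<kappa> where "hyp_axis G L \<delta> c a \<epsilon> \<kappa>"
proof -
  obtain a \<epsilon> \<kappa> where "0 \<le> a" "0 < \<epsilon>" "\<And>n::int. \<epsilon> * real_of_int \<bar>n\<bar> - \<kappa> \<le> L (c [^] n)"
    "\<And>i j k::int. i \<le> j \<Longrightarrow> j \<le> k \<Longrightarrow> gprod (c [^] j) (c [^] i) (c [^] k) \<le> a"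
    using axis[OF assms] by blast
  then have "hyp_axis G L \<delta> c a \<epsilon> \<kappa>" using assms by unfold_locales auto
  then show ?thesis using that by blast
qed

text \<open>\<open>\<langle>z\<rangle>\<close> has finite index in its centralizer \<open>E\<close>, so the transfer \<open>V : E \<rightarrow> \<langle>z\<rangle>\<close> is a homomorphism
  with \<open>V(z) = z\<^bsup>[E:\<langle>z\<rangle>]\<^esup>\<close>; it kills commutators, and every element has a power in \<open>\<langle>z\<rangle>\<close>.\<close>

lemma centralizer_abelian:
  assumes z: "z \<in> carrier G" "z \<noteq> \<one>" and x: "x \<in> carrier G" "x \<otimes> z = z \<otimes> x"
    and y: "y \<in> carrier G" "y \<otimes> z = z \<otimes> y"
  shows "x \<otimes> y = y \<otimes> x"
proof -
  obtain a \<epsilon> \<kappa> where ax: "hyp_axis G L \<delta> z a \<epsilon> \<kappa>" using hyp_axisE[OF z] by blast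
  interpret ax: hyp_axis G L \<delta> z a \<epsilon> \<kappa> by (rule ax)
  define E where "E = centralizer G z"
  have E: "e \<in> E \<longleftrightarrow> e \<in> carrier G \<and> e \<otimes> z = z \<otimes> e" for e by (auto simp: E_def centralizer_def)
  have Ec: "e \<in> carrier G" if "e \<in> E" for e using that E by blast
  have Em: "e \<otimes> f \<in> E" if "e \<in> E" "f \<in> E" for e f
    using that z unfolding E by (metis m_assoc m_closed)
  have Ei: "inv e \<in> E" if "e \<in> E" for e
    using that z commute_inv[of e z] unfolding E by auto
  have zE: "z \<in> E" using z by (simp add: E)
  have Ep: "e [^] (n::nat) \<in> E" if "e \<in> E" for e n
  proof (induction n)
    case 0 show ?case using z by (simp add: E)
  next
    case (Suc n) then show ?case using Em[OF Suc that] by simp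
  qed
  have zpE: "z [^] (k::int) \<in> E" for k
    unfolding int_pow_def2[of G z k] using Ep[OF zE] Ei[OF Ep[OF zE]] by (simp only: split: if_split) blast
  have comm: "e \<otimes> z [^] (k::int) = z [^] k \<otimes> e" if "e \<in> E" for e k
    using conj_rel_pow[of e z 1 1 k] that z unfolding E by simp
  have cms: "ax.commensurates e" if "e \<in> E" for e
    unfolding ax.commensurates_def using that z by (intro exI[of _ "1::int"] exI[of _ "1::int"]) (simp add: E)
  \<comment> \<open>By \<open>near_axis\<close> every coset of the cyclic group of \<open>z\<close>
    in \<open>E\<close> meets this finite set.\<close>
  define F0 where "F0 = {e \<in> E. L e \<le> ax.D}"
  have finF0: "finite F0" unfolding F0_def by (rule finite_subset[OF _ finite_ball[of ax.D]]) (auto simp: E)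
  define P where "P = (\<lambda>e f. f \<in> F0 \<and> (\<exists>k::int. e = z [^] k \<otimes> f))"
  have ex: "\<exists>f. P e f" if e: "e \<in> E" for e
  proof -
    obtain i :: int where i: "dst e (z [^] i) \<le> ax.D" using ax.near_axis[OF Ec[OF e] cms[OF e]] by blast
    define f where "f = inv (z [^] i) \<otimes> e"
    have "f \<in> E" unfolding f_def using e zpE by (intro Em Ei)
    moreover have "L f \<le> ax.D" using i e z Ec dst_commute[of e "z [^] i"] by (simp add: f_def dst_def)
    moreover have "e = z [^] i \<otimes> f" using e z Ec by (simp add: f_def)
    ultimately show ?thesis unfolding P_def F0_def by blast
  qed
  \<comment> \<open>The choice depends only on the predicate \<open>P e\<close>, which is shared by
    the whole coset of \<open>e\<close>; hence \<open>rep\<close> is constant on cosets.\<close>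
  define rep where "rep = (\<lambda>e. SOME f. P e f)"
  have rep: "P e (rep e)" if "e \<in> E" for e unfolding rep_def using ex[OF that] by (rule someI_ex)
  have repE: "rep e \<in> E" if "e \<in> E" for e using rep[OF that] by (simp add: P_def F0_def)
  have rep_shift: "rep (z [^] (k::int) \<otimes> e) = rep e" if e: "e \<in> E" for k e
  proof -
    have "P (z [^] k \<otimes> e) f \<longleftrightarrow> P e f" for f
    proof -
      have "(\<exists>m::int. z [^] k \<otimes> e = z [^] m \<otimes> f) \<longleftrightarrow> (\<exists>m::int. e = z [^] m \<otimes> f)" if f: "f \<in> E"
      proof
        assume "\<exists>m::int. z [^] k \<otimes> e = z [^] m \<otimes> f"
        then obtain m :: int where "z [^] k \<otimes> e = z [^] m \<otimes> f" by blast
        then have "inv (z [^] k) \<otimes> (z [^] k \<otimes> e) = inv (z [^] k) \<otimes> (z [^] m \<otimes> f)" by simp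
        then have "e = z [^] (m - k) \<otimes> f" using e f z Ec inv_pow_mult_pow[of z k m] by (simp add: m_assoc[symmetric])
        then show "\<exists>m::int. e = z [^] m \<otimes> f" by blast
      next
        assume "\<exists>m::int. e = z [^] m \<otimes> f"
        then obtain m :: int where "e = z [^] m \<otimes> f" by blast
        then have "z [^] k \<otimes> e = z [^] (k + m) \<otimes> f" using f z Ec by (simp add: int_pow_mult m_assoc)
        then show "\<exists>m::int. z [^] k \<otimes> e = z [^] m \<otimes> f" by blast
      qed
      then show ?thesis unfolding P_def F0_def by auto
    qed
    then have "P (z [^] k \<otimes> e) = P e" by (intro ext)
    then show ?thesis unfolding rep_def by simp
  qed
  define kap where "kap = (\<lambda>e. THE k::int. e = z [^] k \<otimes> rep e)"
  have kap_eq: "kap e = k" if e: "e \<in> E" and k: "e = z [^] k \<otimes> rep e" for e k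
    unfolding kap_def
  proof (rule the_equality)
    fix k' :: int assume k': "e = z [^] k' \<otimes> rep e"
    then have "z [^] k' \<otimes> rep e = z [^] k \<otimes> rep e" using k by simp
    then have "z [^] k' = z [^] k" using repE[OF e] Ec z by simp
    then show "k' = k" by (rule pow_inj[OF z])
  qed (rule k)
  have kap: "e = z [^] kap e \<otimes> rep e" if e: "e \<in> E" for e
    using rep[OF e] kap_eq[OF e] unfolding P_def by blast
  have kap_shift: "kap (z [^] (k::int) \<otimes> e) = k + kap e" if e: "e \<in> E" for k e
  proof (rule kap_eq)
    show "z [^] k \<otimes> e \<in> E" using e zpE by (intro Em)
    show "z [^] k \<otimes> e = z [^] (k + kap e) \<otimes> rep (z [^] k \<otimes> e)"
      using kap[OF e] rep_shift[OF e] z repE[OF e] Ec by (metis int_pow_closed int_pow_mult m_assoc)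
  qed
  have rep_rep: "rep (rep e) = rep e" if e: "e \<in> E" for e
    using rep_shift[OF repE[OF e], of "kap e"] kap[OF e] by simp
  define F where "F = rep ` E"
  have "F \<subseteq> F0" using rep unfolding F_def P_def by blast
  then have finF: "finite F" using finF0 by (rule finite_subset)
  have F: "f \<in> E" "rep f = f" "kap f = 0" if "f \<in> F" for f
  proof -
    show 1: "f \<in> E" "rep f = f" using that repE rep_rep by (auto simp: F_def)
    show "kap f = 0" using 1 Ec z by (intro kap_eq) auto
  qed
  have cF: "card F > 0" using finF zE by (auto simp: F_def card_gt_0_iff)
  have assoc3: "p \<otimes> r = q \<otimes> (s \<otimes> r)" if "p = q \<otimes> s" "q \<in> carrier G" "s \<in> carrier G" "r \<in> carrier G" for p q r s
    using that by (simp add: m_assoc)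
  \<comment> \<open>The transfer, written additively: \<open>kap (f \<otimes> e)\<close> is the
    exponent of \<open>z\<close> that remains when \<open>f \<otimes> e\<close> is replaced by its
    representative.\<close>
  define V where "V = (\<lambda>e. \<Sum>f\<in>F. kap (f \<otimes> e))"
  have V_mult: "V (e \<otimes> e') = V e + V e'" if e: "e \<in> E" "e' \<in> E" for e e'
  proof -
    have one: "kap (f \<otimes> (e \<otimes> e')) = kap (f \<otimes> e) + kap (rep (f \<otimes> e) \<otimes> e')" if f: "f \<in> F" for f
    proof -
      have fe: "f \<otimes> e \<in> E" using F(1)[OF f] e by (intro Em)
      have "f \<otimes> (e \<otimes> e') = z [^] kap (f \<otimes> e) \<otimes> (rep (f \<otimes> e) \<otimes> e')"
        using assoc3[OF kap[OF fe]] repE[OF fe] e F(1)[OF f] Ec z by (simp add: m_assoc)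
      then show ?thesis using kap_shift[OF Em[OF repE[OF fe] e(2)], of "kap (f \<otimes> e)"] by simp
    qed
    have inv_rep: "rep (rep (f \<otimes> e) \<otimes> inv e) = f" if f: "f \<in> F" and e: "e \<in> E" for f e
    proof -
      have fe: "f \<otimes> e \<in> E" using F(1)[OF f] e by (intro Em)
      have "f = f \<otimes> e \<otimes> inv e" using F(1)[OF f] e Ec by (simp add: m_assoc)
      also have "\<dots> = z [^] kap (f \<otimes> e) \<otimes> (rep (f \<otimes> e) \<otimes> inv e)"
        using assoc3[OF kap[OF fe]] repE[OF fe] e Ec z by simp
      finally have "rep f = rep (rep (f \<otimes> e) \<otimes> inv e)"
        using rep_shift[OF Em[OF repE[OF fe] Ei[OF e]], of "kap (f \<otimes> e)"] by simp
      then show ?thesis using F(2)[OF f] by simp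
    qed
    \<comment> \<open>Right multiplication by \<open>e\<close> permutes the cosets, with inverse
      given by \<open>inv e\<close>.\<close>
    have "(\<Sum>f\<in>F. kap (rep (f \<otimes> e) \<otimes> e')) = (\<Sum>f\<in>F. kap (f \<otimes> e'))"
    proof (rule sum.reindex_bij_witness[of _ "\<lambda>f. rep (f \<otimes> inv e)" "\<lambda>f. rep (f \<otimes> e)"])
      fix f assume f: "f \<in> F"
      show "rep (rep (f \<otimes> e) \<otimes> inv e) = f" using inv_rep[OF f e(1)] .
      show "rep (f \<otimes> e) \<in> F" using F(1)[OF f] e Em by (auto simp: F_def)
      show "rep (rep (f \<otimes> inv e) \<otimes> e) = f" using inv_rep[OF f Ei[OF e(1)]] e Ec by simp
      show "rep (f \<otimes> inv e) \<in> F" using F(1)[OF f] e Em Ei by (auto simp: F_def)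
    qed simp
    then show ?thesis by (simp add: V_def one sum.distrib)
  qed
  have oneE: "\<one> \<in> E" using z by (simp add: E)
  have V_one: "V \<one> = 0" using V_mult[OF oneE oneE] by simp
  have V_inv: "V (inv e) = - V e" if "e \<in> E" for e
    using V_mult[OF that Ei[OF that]] V_one that Ec by simp
  have V_pow: "V (e [^] (n::nat)) = int n * V e" if e: "e \<in> E" for e n
  proof (induction n)
    case (Suc n)
    then show ?case using V_mult[OF Ep[OF e] e] by (simp add: algebra_simps)
  qed (simp add: V_one)
  have V_z: "V (z [^] (k::int)) = k * int (card F)" for k
  proof -
    have "kap (f \<otimes> z [^] k) = k" if f: "f \<in> F" for f
      using comm[OF F(1)[OF f]] kap_shift[OF F(1)[OF f]] F(3)[OF f] by simp
    then show ?thesis by (simp add: V_def)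
  qed
  define w where "w = x \<otimes> y \<otimes> (inv x \<otimes> inv y)"
  have xy: "x \<in> E" "y \<in> E" using x y by (auto simp: E)
  have wE: "w \<in> E" unfolding w_def by (intro Em Ei xy)
  have "V w = 0" unfolding w_def using xy V_mult Em Ei V_inv by simp
  obtain m :: nat and k :: int where mk: "m > 0" "w [^] m = z [^] k"
    using ax.power_in_axis[OF Ec[OF wE] cms[OF wE]] by blast
  have "k * int (card F) = 0" using V_pow[OF wE, of m] \<open>V w = 0\<close> V_z[of k] mk by simp
  then have "w [^] m = \<one>" using cF mk by simp
  then have "w = \<one>" using tf mk wE Ec unfolding torsion_free_def by blast
  then have "x \<otimes> y \<otimes> (inv x \<otimes> inv y) \<otimes> (y \<otimes> x) = y \<otimes> x" using x y by (simp add: w_def)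
  then show ?thesis using x y by (simp add: m_assoc)
qed

text \<open>Some power of \<open>g\<close> is a power \<open>z\<close> of \<open>c\<close>,
  nontrivial since there is no torsion; \<open>g\<close> and \<open>c\<close> both lie in the
  Abelian centralizer of \<open>z\<close>.\<close>

lemma commensurate_commute:
  assumes c: "c \<in> carrier G" "c \<noteq> \<one>" and g: "g \<in> carrier G"
    and r: "r \<noteq> 0" and rel: "g \<otimes> c [^] (r::int) = c [^] (s::int) \<otimes> g"
  shows "g \<otimes> c = c \<otimes> g"
proof (cases "g = \<one>")
  case True
  then show ?thesis using c by simp
next
  case False
  obtain a \<epsilon> \<kappa> where ax: "hyp_axis G L \<delta> c a \<epsilon> \<kappa>" using hyp_axisE[OF c] by blast
  interpret ax: hyp_axis G L \<delta> c a \<epsilon> \<kappa> by (rule ax)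
  have "ax.commensurates g" unfolding ax.commensurates_def using r rel by blast
  then obtain m :: nat and k :: int where mk: "m > 0" "g [^] m = c [^] k"
    using ax.power_in_axis g by blast
  define z where "z = c [^] k"
  have z: "z \<in> carrier G" "z \<noteq> \<one>" using tf mk g False c unfolding torsion_free_def z_def by auto
  have "g \<otimes> z = z \<otimes> g" using mk(2) g unfolding z_def by (metis nat_pow_Suc nat_pow_Suc2)
  moreover have "c \<otimes> z = z \<otimes> c"
    using c int_pow_mult[of c 1 k] int_pow_mult[of c k 1] by (simp add: z_def add.commute)
  ultimately show ?thesis using centralizer_abelian[OF z] g c by blast
qed

text \<open>A conjugate of \<open>x\<close> commuting with \<open>x\<close> has a power in the
  cyclic group of \<open>x\<close>, so the conjugating element commensurates
  \<open>x\<close>.\<close>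

lemma csa_carrier: "csa G (carrier G)"
  unfolding csa_def
proof (intro conjI ballI impI)
  fix x y z assume "x \<in> carrier G" "y \<in> carrier G" "z \<in> carrier G" "y \<noteq> \<one>" "x \<otimes> y = y \<otimes> x" "y \<otimes> z = z \<otimes> y"
  then show "x \<otimes> z = z \<otimes> x" using centralizer_abelian[of y x z] by simp
next
  fix x g assume x: "x \<in> carrier G" "x \<noteq> \<one>" and g: "g \<in> carrier G"
    and rel: "(g \<otimes> x \<otimes> inv g) \<otimes> x = x \<otimes> (g \<otimes> x \<otimes> inv g)"
  obtain a \<epsilon> \<kappa> where ax: "hyp_axis G L \<delta> x a \<epsilon> \<kappa>" using hyp_axisE[OF x] by blast
  interpret ax: hyp_axis G L \<delta> x a \<epsilon> \<kappa> by (rule ax)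
  have "ax.commensurates (g \<otimes> x \<otimes> inv g)" unfolding ax.commensurates_def
    using rel x g by (intro exI[of _ "1::int"] exI[of _ "1::int"]) simp
  then obtain m :: nat and k :: int where mk: "m > 0" "(g \<otimes> x \<otimes> inv g) [^] m = x [^] k"
    using ax.power_in_axis[of "g \<otimes> x \<otimes> inv g"] g x by auto
  have "g \<otimes> x [^] int m \<otimes> inv g = x [^] k"
    using conj_int_pow[OF g x(1), of "int m"] mk by (simp add: int_pow_int)
  then have "g \<otimes> x [^] int m = x [^] k \<otimes> g" using g x by (metis int_pow_closed inv_solve_right m_closed)
  then show "g \<otimes> x = x \<otimes> g" using commensurate_commute[OF x g, of "int m" k] mk by simp
qed

lemma big_powers_carrier:
  assumes c: "c \<in> carrier G" "c \<noteq> \<one>" and l: "\<And>g. g \<in> carrier G \<Longrightarrow> L g \<le> real (l g)"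
  shows "big_powers G (carrier G) l c"
proof -
  obtain a \<epsilon> \<kappa> where ax: "hyp_axis G L \<delta> c a \<epsilon> \<kappa>" using hyp_axisE[OF c] by blast
  interpret ax: hyp_axis G L \<delta> c a \<epsilon> \<kappa> by (rule ax)
  obtain B where B: "\<And>g N M. g \<in> carrier G \<Longrightarrow> \<not> ax.commensurates g \<Longrightarrow>
    gprod \<one> (c [^] (N::int)) (g \<otimes> c [^] (M::int)) \<le> B * (L g + 1)" using ax.overlap by blast
  have "\<not> ax.commensurates g" if "g \<in> carrier G" "g \<otimes> c \<noteq> c \<otimes> g" for g
    using that commensurate_commute[OF c] unfolding ax.commensurates_def by blast
  then show ?thesis using B ax.growth ax.e0 l c(1) by (intro big_powers_from_overlap[where B = B]) auto
qed

end

section \<open>Word lengths\<close>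

context group
begin

lemma eval_word_Nil [simp]: "eval_word G [] = \<one>"
  by (simp add: eval_word_def)

lemma eval_word_Cons: "eval_word G ((x, b) # w) = (if b then x else inv x) \<otimes> eval_word G w"
  by (simp add: eval_word_def)

lemma eval_word_closed: "fst ` set w \<subseteq> carrier G \<Longrightarrow> eval_word G w \<in> carrier G"
proof (induction w)
  case (Cons p w)
  then show ?case by (cases p) (auto simp: eval_word_Cons)
qed simp

lemma eval_word_append:
  "fst ` set w \<subseteq> carrier G \<Longrightarrow> fst ` set w' \<subseteq> carrier G \<Longrightarrow>
    eval_word G (w @ w') = eval_word G w \<otimes> eval_word G w'"
proof (induction w)
  case (Cons p w)
  then show ?case by (cases p) (auto simp: eval_word_Cons eval_word_closed m_assoc)
qed (simp add: eval_word_closed)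

lemma eval_word_inv:
  "fst ` set w \<subseteq> carrier G \<Longrightarrow>
    eval_word G (rev (map (\<lambda>(x, b). (x, \<not> b)) w)) = inv (eval_word G w)"
proof (induction w)
  case (Cons p w)
  obtain x b where p: "p = (x, b)" by fastforce
  have x: "x \<in> carrier G" using Cons.prems p by simp
  have w: "fst ` set w \<subseteq> carrier G" using Cons.prems by simp
  have "fst ` set (rev (map (\<lambda>(x, b). (x, \<not> b)) w)) \<subseteq> carrier G" using w by force
  then have "eval_word G (rev (map (\<lambda>(x, b). (x, \<not> b)) (p # w)))
      = inv (eval_word G w) \<otimes> eval_word G [(x, \<not> b)]"
    using eval_word_append[of "rev (map (\<lambda>(x, b). (x, \<not> b)) w)" "[(x, \<not> b)]"] Cons.IH[OF w] x p by simp
  then show ?case using x w p by (simp add: eval_word_Cons eval_word_closed inv_mult_group)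
qed simp

end

locale fg_group = group G for G (structure) +
  fixes T :: "'a set"
  assumes fg: "fin_gen_set G T"
begin

lemma T_carrier: "T \<subseteq> carrier G" and T_finite: "finite T" and T_gen: "generate G T = carrier G"
  using fg by (auto simp: fin_gen_set_def)

lemma word_carrier: "fst ` set w \<subseteq> T \<Longrightarrow> fst ` set w \<subseteq> carrier G"
  using T_carrier by blast

lemma exists_word: "g \<in> carrier G \<Longrightarrow> \<exists>w. fst ` set w \<subseteq> T \<and> eval_word G w = g"
  unfolding T_gen[symmetric]
proof (induction rule: generate.induct)
  case one
  show ?case by (intro exI[of _ "[]"]) simp
next
  case (incl h)
  then show ?case using T_carrier by (intro exI[of _ "[(h, True)]"]) (auto simp: eval_word_Cons)
next
  case (inv h)
  then show ?case using T_carrier by (intro exI[of _ "[(h, False)]"]) (auto simp: eval_word_Cons)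
next
  case (eng h1 h2)
  then obtain w1 w2 where "fst ` set w1 \<subseteq> T" "eval_word G w1 = h1" "fst ` set w2 \<subseteq> T" "eval_word G w2 = h2" by blast
  then show ?case using T_carrier by (intro exI[of _ "w1 @ w2"]) (simp add: eval_word_append image_Un word_carrier)
qed

lemma word_len_le: "fst ` set w \<subseteq> T \<Longrightarrow> word_len G T (eval_word G w) \<le> length w"
  unfolding word_len_def by (rule Least_le) auto

lemma word_len_word:
  assumes "g \<in> carrier G"
  obtains w where "fst ` set w \<subseteq> T" "length w = word_len G T g" "eval_word G w = g"
proof -
  have "\<exists>n w. (\<forall>p\<in>set w. fst p \<in> T) \<and> length w = n \<and> eval_word G w = g"
    using exists_word[OF assms] by (auto simp: image_subset_iff)
  then have "\<exists>w. (\<forall>p\<in>set w. fst p \<in> T) \<and> length w = word_len G T g \<and> eval_word G w = g"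
    unfolding word_len_def by (rule LeastI_ex)
  then show ?thesis using that by auto
qed

lemma word_len_one [simp]: "word_len G T \<one> = 0"
  using word_len_le[of "[]"] by simp

lemma word_len_mult:
  assumes "x \<in> carrier G" "y \<in> carrier G"
  shows "word_len G T (x \<otimes> y) \<le> word_len G T x + word_len G T y"
proof -
  obtain v where v: "fst ` set v \<subseteq> T" "length v = word_len G T x" "eval_word G v = x"
    using word_len_word[OF assms(1)] by blast
  obtain w where w: "fst ` set w \<subseteq> T" "length w = word_len G T y" "eval_word G w = y"
    using word_len_word[OF assms(2)] by blast
  have "word_len G T (eval_word G (v @ w)) \<le> length (v @ w)" using v w by (intro word_len_le) auto
  then show ?thesis using v w by (simp add: eval_word_append word_carrier)
qed

lemma word_len_inv:
  assumes "x \<in> carrier G"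
  shows "word_len G T (inv x) = word_len G T x"
proof -
  have le: "word_len G T (inv x) \<le> word_len G T x" if x: "x \<in> carrier G" for x
  proof -
    obtain v where v: "fst ` set v \<subseteq> T" "length v = word_len G T x" "eval_word G v = x"
      using word_len_word[OF x] by blast
    have "word_len G T (eval_word G (rev (map (\<lambda>(x, b). (x, \<not> b)) v))) \<le> length (rev (map (\<lambda>(x, b). (x, \<not> b)) v))"
      using v by (intro word_len_le) force
    then show ?thesis using v by (simp add: eval_word_inv word_carrier)
  qed
  show ?thesis using le[of x] le[of "inv x"] assms by simp
qed

lemma word_len_pow:
  assumes "x \<in> carrier G"
  shows "word_len G T (x [^] (k::int)) \<le> nat \<bar>k\<bar> * word_len G T x"
proof -
  interpret length_group G "carrier G" "\<lambda>g. real (word_len G T g)"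
    using word_len_mult by unfold_locales (auto simp: subgroup_self word_len_inv simp flip: of_nat_add)
  have "real (word_len G T (x [^] k)) \<le> real (nat \<bar>k\<bar>) * real (word_len G T x)"
    using L_pow_le[of x k] assms by simp
  then show ?thesis by (simp only: flip: of_nat_mult)
qed

lemma finite_word_ball: "finite {g \<in> carrier G. word_len G T g \<le> n}"
proof (rule finite_subset)
  show "{g \<in> carrier G. word_len G T g \<le> n} \<subseteq> eval_word G ` {w. set w \<subseteq> T \<times> UNIV \<and> length w \<le> n}"
  proof
    fix g assume g: "g \<in> {g \<in> carrier G. word_len G T g \<le> n}"
    then obtain w where w: "fst ` set w \<subseteq> T" "length w = word_len G T g" "eval_word G w = g"
      using word_len_word[of g] by blast
    then have "set w \<subseteq> T \<times> UNIV" by (auto simp: image_subset_iff mem_Times_iff)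
    then show "g \<in> eval_word G ` {w. set w \<subseteq> T \<times> UNIV \<and> length w \<le> n}" using w g by auto
  qed
  show "finite (eval_word G ` {w. set w \<subseteq> T \<times> UNIV \<and> length w \<le> n})"
    using T_finite by (intro finite_imageI finite_lists_length_le finite_cartesian_product) auto
qed

text \<open>Allows the group to be copied into any infinite type.\<close>

lemma countable_carrier: "countable (carrier G)"
proof -
  have "countable (eval_word G ` lists (T \<times> UNIV))"
    using T_finite by (intro countable_image countable_lists countable_SIGMA) (auto intro: countable_finite)
  moreover have "carrier G \<subseteq> eval_word G ` lists (T \<times> UNIV)"
  proof
    fix g assume "g \<in> carrier G"
    then obtain w where "fst ` set w \<subseteq> T" "eval_word G w = g" using exists_word by blast
    then show "g \<in> eval_word G ` lists (T \<times> UNIV)"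
      by (intro image_eqI[of _ _ w]) (auto simp: image_subset_iff mem_Times_iff in_lists_conv_set)
  qed
  ultimately show ?thesis by (rule countable_subset[rotated])
qed

lemma word_midpoint:
  assumes "g \<in> carrier G"
  shows "\<exists>m\<in>carrier G. real (word_len G T m) \<le> real (word_len G T g) / 2 + 1 \<and>
    real (word_len G T (inv m \<otimes> g)) \<le> real (word_len G T g) / 2 + 1"
proof -
  obtain w where w: "fst ` set w \<subseteq> T" "length w = word_len G T g" "eval_word G w = g"
    using word_len_word[OF assms] by blast
  define k where "k = length w div 2"
  define u v where "u = take k w" and "v = drop k w"
  have uv: "fst ` set u \<subseteq> T" "fst ` set v \<subseteq> T"
    using w(1) by (auto simp: u_def v_def dest: in_set_takeD in_set_dropD)
  have "eval_word G w = eval_word G u \<otimes> eval_word G v"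
    using eval_word_append[of u v, OF word_carrier[OF uv(1)] word_carrier[OF uv(2)]] by (simp add: u_def v_def)
  then have "inv (eval_word G u) \<otimes> g = eval_word G v"
    using w uv by (simp add: eval_word_closed word_carrier)
  moreover have "word_len G T (eval_word G u) \<le> k" using word_len_le[OF uv(1)] by (simp add: u_def)
  moreover have "word_len G T (eval_word G v) \<le> length w - k" using word_len_le[OF uv(2)] by (simp add: v_def)
  moreover have "real k \<le> real (length w) / 2" "real (length w - k) \<le> real (length w) / 2 + 1"
    unfolding k_def by linarith+
  ultimately show ?thesis using w uv
    by (intro bexI[of _ "eval_word G u"]) (auto simp: eval_word_closed word_carrier)
qed

end

lemma hyperbolic_group_hyp_group:
  assumes "hyperbolic_group G" "torsion_free G"
  obtains T \<delta> where "hyp_group G (\<lambda>g. real (word_len G T g)) \<delta>"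
proof -
  obtain T \<delta> where G: "group G" and T: "fin_gen_set G T" and hyp: "\<forall>x\<in>carrier G. \<forall>y\<in>carrier G. \<forall>z\<in>carrier G. \<forall>w\<in>carrier G.
       gromov_prod G T x y w \<ge> min (gromov_prod G T x z w) (gromov_prod G T y z w) - \<delta>"
    using assms(1) unfolding hyperbolic_group_def by blast
  interpret fg_group G T using G T by (simp add: fg_group_def fg_group_axioms_def)
  interpret lg: length_group G "carrier G" "\<lambda>g. real (word_len G T g)"
    using word_len_mult by unfold_locales (auto simp: subgroup_self word_len_inv simp flip: of_nat_add)
  have gp: "lg.gprod \<one>\<^bsub>G\<^esub> x y = gromov_prod G T x y \<one>\<^bsub>G\<^esub>" if "x \<in> carrier G" "y \<in> carrier G" for x y
    using that by (simp add: lg.gprod_def gromov_prod_def lg.dst_def word_dist_def word_len_inv)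
  \<comment> \<open>The definition of a hyperbolic group admits a negative constant, the locale does
    not.\<close>
  have "hyp_group G (\<lambda>g. real (word_len G T g)) (max \<delta> 0)"
  proof (unfold_locales)
    fix x y z assume xyz: "x \<in> carrier G" "y \<in> carrier G" "z \<in> carrier G"
    have "min (gromov_prod G T x y \<one>\<^bsub>G\<^esub>) (gromov_prod G T z y \<one>\<^bsub>G\<^esub>) - \<delta> \<le> gromov_prod G T x z \<one>\<^bsub>G\<^esub>"
      using hyp xyz by blast
    then have "min (lg.gprod \<one>\<^bsub>G\<^esub> x y) (lg.gprod \<one>\<^bsub>G\<^esub> y z) - \<delta> \<le> lg.gprod \<one>\<^bsub>G\<^esub> x z"
      using xyz lg.gprod_commute[of y z] by (simp add: gp[symmetric])
    then show "min (lg.gprod \<one>\<^bsub>G\<^esub> x y) (lg.gprod \<one>\<^bsub>G\<^esub> y z) - max \<delta> 0 \<le> lg.gprod \<one>\<^bsub>G\<^esub> x z" by linarith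
  next
    fix r :: real
    have "{g \<in> carrier G. real (word_len G T g) \<le> r} \<subseteq> {g \<in> carrier G. word_len G T g \<le> nat \<lfloor>r\<rfloor>}"
      by (auto simp: le_nat_floor)
    then show "finite {g \<in> carrier G. real (word_len G T g) \<le> r}" using finite_word_ball finite_subset by blast
  next
    fix g assume "g \<in> carrier G"
    then show "\<exists>m\<in>carrier G. real (word_len G T m) \<le> real (word_len G T g) / 2 + 1 \<and>
      real (word_len G T (inv\<^bsub>G\<^esub> m \<otimes>\<^bsub>G\<^esub> g)) \<le> real (word_len G T g) / 2 + 1" by (rule word_midpoint)
  qed (use assms(2) in auto)
  then show ?thesis using that by blast
qed

section \<open>Reduced words\<close>

text \<open>A word \<open>w\<^sub>0 t\<^sub>1 w\<^sub>1 \<dots> t\<^sub>k w\<^sub>k\<close> is represented by \<open>w\<^sub>0\<close> and the list of the pairs \<open>(t\<^sub>i, w\<^sub>i)\<close>.\<close>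

fun syl_prod :: "('a, 'm) monoid_scheme \<Rightarrow> ('a \<times> 'a) list \<Rightarrow> 'a" where
  "syl_prod M [] = \<one>\<^bsub>M\<^esub>"
| "syl_prod M ((t, w) # ws) = t \<otimes>\<^bsub>M\<^esub> (w \<otimes>\<^bsub>M\<^esub> syl_prod M ws)"

text \<open>The factor C x Z^m is represented by its complement \<open>T\<close> alone: since
  \<open>C\<close> commutes with \<open>T\<close>, the \<open>C\<close>-part of a letter moves into
  the neighbouring letters of \<open>G\<close>.\<close>

fun red_word :: "('a, 'm) monoid_scheme \<Rightarrow> 'a set \<Rightarrow> 'a set \<Rightarrow> 'a set \<Rightarrow> ('a \<times> 'a) list \<Rightarrow> bool" where
  "red_word M G T C [] \<longleftrightarrow> True"
| "red_word M G T C ((t, w) # ws) \<longleftrightarrow>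
     t \<in> T \<and> t \<noteq> \<one>\<^bsub>M\<^esub> \<and> w \<in> G \<and> (ws \<noteq> [] \<longrightarrow> w \<notin> C) \<and> red_word M G T C ws"

text \<open>Freeness of the product is added only in \<open>amalgam\<close>: reduced words must be
  at hand before the normal form theorem is known.\<close>

locale splitting = group M for M (structure) +
  fixes G T C :: "'a set"
  assumes G_sub: "subgroup G M" and T_sub: "subgroup T M" and C_sub: "subgroup C M" and C_G: "C \<subseteq> G"
    and CT: "c \<in> C \<Longrightarrow> t \<in> T \<Longrightarrow> c \<otimes> t = t \<otimes> c"
begin

abbreviation "sp \<equiv> syl_prod M"
abbreviation "red \<equiv> red_word M G T C"

definition H where "H = generate M (G \<union> T)"

lemma G_simps [simp]: "x \<in> G \<Longrightarrow> x \<in> carrier M" "\<one> \<in> G" "x \<in> G \<Longrightarrow> y \<in> G \<Longrightarrow> x \<otimes> y \<in> G" "x \<in> G \<Longrightarrow> inv x \<in> G"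
  using G_sub by (auto intro: subgroup.mem_carrier subgroup.one_closed subgroup.m_closed subgroup.m_inv_closed)

lemma T_simps [simp]: "x \<in> T \<Longrightarrow> x \<in> carrier M" "\<one> \<in> T" "x \<in> T \<Longrightarrow> y \<in> T \<Longrightarrow> x \<otimes> y \<in> T" "x \<in> T \<Longrightarrow> inv x \<in> T"
  using T_sub by (auto intro: subgroup.mem_carrier subgroup.one_closed subgroup.m_closed subgroup.m_inv_closed)

lemma C_simps [simp]: "x \<in> C \<Longrightarrow> x \<in> G" "\<one> \<in> C" "x \<in> C \<Longrightarrow> y \<in> C \<Longrightarrow> x \<otimes> y \<in> C" "x \<in> C \<Longrightarrow> inv x \<in> C"
  using C_sub C_G by (auto intro: subgroup.mem_carrier subgroup.one_closed subgroup.m_closed subgroup.m_inv_closed)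

lemma C_cancel:
  assumes "x \<in> C" "y \<in> G"
  shows "x \<otimes> y \<in> C \<longleftrightarrow> y \<in> C"
proof
  assume "x \<otimes> y \<in> C"
  then have "inv x \<otimes> (x \<otimes> y) \<in> C" by (rule C_simps(3)[OF C_simps(4)[OF assms(1)]])
  moreover have "inv x \<otimes> (x \<otimes> y) = y" using assms by (intro cancel_left) auto
  ultimately show "y \<in> C" by (simp only:)
qed (use assms in simp)

lemma C_inv_iff: "x \<in> G \<Longrightarrow> inv x \<in> C \<longleftrightarrow> x \<in> C"
  using C_simps(4)[of "inv x"] C_simps(4)[of x] by (auto simp del: C_simps)

lemma GT_carrier: "G \<union> T \<subseteq> carrier M" by auto

lemma H_sub: "subgroup H M"
  unfolding H_def by (rule generate_is_subgroup[OF GT_carrier])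

lemma H_simps [simp]: "x \<in> H \<Longrightarrow> x \<in> carrier M" "\<one> \<in> H" "x \<in> H \<Longrightarrow> y \<in> H \<Longrightarrow> x \<otimes> y \<in> H" "x \<in> H \<Longrightarrow> inv x \<in> H"
  using H_sub by (auto intro: subgroup.mem_carrier subgroup.one_closed subgroup.m_closed subgroup.m_inv_closed)

lemma G_H: "x \<in> G \<Longrightarrow> x \<in> H" and T_H: "x \<in> T \<Longrightarrow> x \<in> H"
  by (auto simp: H_def intro: generate.incl)

lemma red_H: "red ws \<Longrightarrow> sp ws \<in> H"
proof (induction ws)
  case (Cons p ws)
  then show ?case by (cases p) (auto simp: G_H T_H)
qed simp

lemma red_carrier [simp]: "red ws \<Longrightarrow> sp ws \<in> carrier M"
  using red_H by auto

text \<open>Letters are multiplied on from the left. The only obstruction to reducedness is a letter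
  of \<open>T\<close> meeting a head \<open>w0\<close> in \<open>C\<close>; it commutes past
  \<open>w0\<close> and merges with the first letter of \<open>T\<close>. Merging is subadditive, so
  the total weight does not increase.\<close>

lemma reduce:
  assumes nG: "group_norm M G lG" and nT: "group_norm M T lT"
  shows "set xs \<subseteq> G \<union> T \<Longrightarrow> \<exists>w0 ws. w0 \<in> G \<and> red ws \<and> w0 \<otimes> sp ws = list_prod M xs \<and>
    lG w0 + sum_list (map (\<lambda>(t, w). lT t + lG w) ws) \<le> sum_list (map (\<lambda>x. if x \<in> G then lG x else lT x) xs)"
proof (induction xs)
  case Nil
  then show ?case using nG by (intro exI[of _ \<one>] exI[of _ "[]"]) (simp add: group_norm_def)
next
  case (Cons x xs)
  have subG: "lG (a \<otimes> b) \<le> lG a + lG b" if "a \<in> G" "b \<in> G" for a b using nG that by (simp add: group_norm_def)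
  have subT: "lT (a \<otimes> b) \<le> lT a + lT b" if "a \<in> T" "b \<in> T" for a b using nT that by (simp add: group_norm_def)
  have lG1: "lG \<one> = 0" using nG by (simp add: group_norm_def)
  let ?wt = "\<lambda>x. if x \<in> G then lG x else lT x"
  let ?sl = "\<lambda>ws. sum_list (map (\<lambda>(t, w). lT t + lG w) ws)"
  obtain w0 ws where IH: "w0 \<in> G" "red ws" "w0 \<otimes> sp ws = list_prod M xs"
    "lG w0 + ?sl ws \<le> sum_list (map ?wt xs)" using Cons by auto
  have lc: "list_prod M xs \<in> carrier M" using IH(1,2) by (simp flip: IH(3))
  show ?case
  proof (cases "x \<in> G")
    case True
    then show ?thesis
      using IH subG[of x w0] by (intro exI[of _ "x \<otimes> w0"] exI[of _ ws]) (auto simp: m_assoc)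
  next
    case False
    then have xT: "x \<in> T" "x \<noteq> \<one>" using Cons.prems by auto
    show ?thesis
    proof (cases "ws \<noteq> [] \<and> w0 \<in> C")
      case False
      then show ?thesis using IH xT lG1 lc \<open>x \<notin> G\<close>
        by (intro exI[of _ \<one>] exI[of _ "(x, w0) # ws"]) (auto simp: m_assoc)
    next
      case True
      then obtain t w ws' where ws: "ws = (t, w) # ws'" by (cases ws) auto
      have t: "t \<in> T" "w \<in> G" "red ws'" "ws' \<noteq> [] \<longrightarrow> w \<notin> C" using IH ws by auto
      have eq: "x \<otimes> (w0 \<otimes> (t \<otimes> (w \<otimes> sp ws'))) = w0 \<otimes> ((x \<otimes> t) \<otimes> (w \<otimes> sp ws'))"
      proof -
        have "x \<otimes> (w0 \<otimes> (t \<otimes> (w \<otimes> sp ws'))) = (x \<otimes> w0) \<otimes> (t \<otimes> (w \<otimes> sp ws'))"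
          using t xT IH by (simp add: m_assoc)
        also have "x \<otimes> w0 = w0 \<otimes> x" using CT[of w0 x] True xT by simp
        finally show ?thesis using t xT IH by (simp add: m_assoc)
      qed
      show ?thesis
      proof (cases "x \<otimes> t = \<one>")
        case True
        then show ?thesis using IH ws t eq subG[of w0 w] \<open>x \<notin> G\<close>
          by (intro exI[of _ "w0 \<otimes> w"] exI[of _ ws']) (auto simp: m_assoc)
      next
        case False
        then show ?thesis using IH ws t eq subT[of x t] xT \<open>x \<notin> G\<close>
          by (intro exI[of _ w0] exI[of _ "(x \<otimes> t, w) # ws'"]) auto
      qed
    qed
  qed
qed

lemma exists_letters:
  assumes "h \<in> H"
  shows "\<exists>xs. set xs \<subseteq> G \<union> T \<and> list_prod M xs = h"
  using assms unfolding H_def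
proof (induction rule: generate.induct)
  case one
  show ?case by (intro exI[of _ "[]"]) simp
next
  case (incl h)
  then show ?case by (intro exI[of _ "[h]"]) auto
next
  case (inv h)
  then show ?case by (intro exI[of _ "[inv h]"]) auto
next
  case (eng h1 h2)
  then obtain xs ys where "set xs \<subseteq> G \<union> T" "list_prod M xs = h1" "set ys \<subseteq> G \<union> T" "list_prod M ys = h2" by blast
  moreover have "list_prod M (xs @ ys) = list_prod M xs \<otimes> list_prod M ys" if "set xs \<subseteq> G \<union> T" "set ys \<subseteq> G \<union> T" for xs ys
  proof -
    have cl: "list_prod M zs \<in> carrier M" if "set zs \<subseteq> G \<union> T" for zs
      using that by (induction zs) auto
    show ?thesis using that cl by (induction xs) (auto simp: m_assoc)
  qed
  ultimately show ?case by (intro exI[of _ "xs @ ys"]) auto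
qed

lemma exists_red:
  assumes "h \<in> H"
  shows "\<exists>w0 ws. w0 \<in> G \<and> red ws \<and> h = w0 \<otimes> sp ws"
proof -
  obtain xs where "set xs \<subseteq> G \<union> T" "list_prod M xs = h" using exists_letters[OF assms] by blast
  then show ?thesis using reduce[of "\<lambda>_. 0" "\<lambda>_. 0" xs] by (fastforce simp: group_norm_def)
qed

text \<open>The cost of the cheapest spelling, where letters of \<open>T\<close> are free. By
  \<open>reduce\<close> the letters from \<open>G\<close> in some reduced form are bounded by this
  norm, which is the form needed for elliptic elements.\<close>

lemma exists_norm:
  assumes nG: "group_norm M G lG"
  obtains lH where "group_norm M H lH"
    "\<And>h. h \<in> H \<Longrightarrow> \<exists>w0 ws. w0 \<in> G \<and> red ws \<and> h = w0 \<otimes> sp ws \<and> lG w0 + sum_list (map (\<lambda>(t, w). lG w) ws) \<le> lH h"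
proof -
  let ?wt = "\<lambda>x. if x \<in> G then lG x else 0"
  let ?P = "\<lambda>h n. \<exists>xs. set xs \<subseteq> G \<union> T \<and> list_prod M xs = h \<and> sum_list (map ?wt xs) = n"
  define lH where "lH = (\<lambda>h. LEAST n. ?P h n)"
  have ex: "?P h (lH h)" if h: "h \<in> H" for h
  proof -
    have "\<exists>n. ?P h n" using exists_letters[OF h] by blast
    then show ?thesis unfolding lH_def by (rule LeastI_ex)
  qed
  have le: "lH (list_prod M xs) \<le> sum_list (map ?wt xs)" if "set xs \<subseteq> G \<union> T" for xs
    unfolding lH_def using that by (intro Least_le) blast
  have cl: "list_prod M zs \<in> carrier M" if "set zs \<subseteq> G \<union> T" for zs
    using that by (induction zs) auto
  have app: "list_prod M (xs @ ys) = list_prod M xs \<otimes> list_prod M ys" if "set xs \<subseteq> G \<union> T" "set ys \<subseteq> G \<union> T" for xs ys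
    using that cl by (induction xs) (auto simp: m_assoc)
  have linv: "list_prod M (rev (map (\<lambda>x. inv x) xs)) = inv (list_prod M xs)"
    "set (rev (map (\<lambda>x. inv x) xs)) \<subseteq> G \<union> T"
    "sum_list (map ?wt (rev (map (\<lambda>x. inv x) xs))) = sum_list (map ?wt xs)" if "set xs \<subseteq> G \<union> T" for xs
  proof -
    have "list_prod M (rev (map (\<lambda>x. inv x) xs)) = inv (list_prod M xs) \<and> set (rev (map (\<lambda>x. inv x) xs)) \<subseteq> G \<union> T \<and>
      sum_list (map ?wt (rev (map (\<lambda>x. inv x) xs))) = sum_list (map ?wt xs)" using that
    proof (induction xs)
      case (Cons x xs)
      have x: "x \<in> G \<union> T" "x \<in> carrier M" using Cons.prems by auto
      have ix: "inv x \<in> G \<union> T" "inv x \<in> carrier M" using x by auto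
      have "inv x \<in> G \<longleftrightarrow> x \<in> G" using G_simps(4)[of "inv x"] G_simps(4)[of x] x by auto
      then have wt: "?wt (inv x) = ?wt x" using nG by (auto simp: group_norm_def)
      show ?case using Cons app[of "rev (map (\<lambda>x. inv x) xs)" "[inv x]"] x ix wt cl[of xs]
        by (auto simp: inv_mult_group)
    qed simp
    then show "list_prod M (rev (map (\<lambda>x. inv x) xs)) = inv (list_prod M xs)"
      "set (rev (map (\<lambda>x. inv x) xs)) \<subseteq> G \<union> T"
      "sum_list (map ?wt (rev (map (\<lambda>x. inv x) xs))) = sum_list (map ?wt xs)" by blast+
  qed
  have inv_le: "lH (inv h) \<le> lH h" if h: "h \<in> H" for h
  proof -
    obtain xs where xs: "set xs \<subseteq> G \<union> T" "list_prod M xs = h" "sum_list (map ?wt xs) = lH h" using ex[OF h] by blast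
    show ?thesis using le[OF linv(2)[OF xs(1)]] linv(1)[OF xs(1)] linv(3)[OF xs(1)] xs by simp
  qed
  have "group_norm M H lH"
    unfolding group_norm_def
  proof (intro conjI ballI)
    show "lH \<one> = 0" using le[of "[]"] by simp
    show "lH (inv x) = lH x" if "x \<in> H" for x using inv_le[of x] inv_le[of "inv x"] that by simp
    show "lH (x \<otimes> y) \<le> lH x + lH y" if xy: "x \<in> H" "y \<in> H" for x y
    proof -
      obtain xs where xs: "set xs \<subseteq> G \<union> T" "list_prod M xs = x" "sum_list (map ?wt xs) = lH x" using ex xy by blast
      obtain ys where ys: "set ys \<subseteq> G \<union> T" "list_prod M ys = y" "sum_list (map ?wt ys) = lH y" using ex xy by blast
      show ?thesis using le[of "xs @ ys"] app[OF xs(1) ys(1)] xs ys by simp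
    qed
  qed
  moreover have "\<exists>w0 ws. w0 \<in> G \<and> red ws \<and> h = w0 \<otimes> sp ws \<and> lG w0 + sum_list (map (\<lambda>(t, w). lG w) ws) \<le> lH h"
    if h: "h \<in> H" for h
  proof -
    obtain xs where xs: "set xs \<subseteq> G \<union> T" "list_prod M xs = h" "sum_list (map ?wt xs) = lH h" using ex[OF h] by blast
    obtain w0 ws where "w0 \<in> G" "red ws" "w0 \<otimes> sp ws = h" "lG w0 + sum_list (map (\<lambda>(t, w). lG w) ws) \<le> lH h"
      using reduce[OF nG, of "\<lambda>_. 0" xs] xs by (auto simp: group_norm_def)
    then show ?thesis by blast
  qed
  ultimately show ?thesis using that by blast
qed

end

section \<open>The Bass--Serre tree of an amalgam\<close>

fun lcp :: "'a list \<Rightarrow> 'a list \<Rightarrow> nat" where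
  "lcp (x # xs) (y # ys) = (if x = y then Suc (lcp xs ys) else 0)"
| "lcp [] ys = 0"
| "lcp xs [] = 0"

text \<open>The source of hyperbolicity of the tree: common prefixes are Gromov products.\<close>

lemma lcp_ultra: "min (lcp xs ys) (lcp ys zs) \<le> lcp xs zs"
proof (induction xs ys arbitrary: zs rule: lcp.induct)
  case (1 x xs y ys)
  show ?case
  proof (cases zs)
    case (Cons z zs')
    then show ?thesis using 1[of zs'] by auto
  qed simp
qed auto

lemma lcp_full: "length xs + length ys = 2 * lcp xs ys \<Longrightarrow> xs = ys"
proof (induction xs ys rule: lcp.induct)
  case (1 x xs y ys)
  then show ?case by (auto split: if_splits)
qed auto

text \<open>The edges of the Bass--Serre tree on the geodesic from \<open>G\<close> to \<open>x t\<^sub>1 w\<^sub>1 \<dots> t\<^sub>k w\<^sub>k G\<close>.\<close>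

fun edges :: "('a, 'm) monoid_scheme \<Rightarrow> 'a set \<Rightarrow> 'a \<Rightarrow> ('a \<times> 'a) list \<Rightarrow> 'a set list" where
  "edges M C x [] = []"
| "edges M C x ((t, w) # ws) = (\<lambda>c. x \<otimes>\<^bsub>M\<^esub> c) ` C # (\<lambda>c. x \<otimes>\<^bsub>M\<^esub> t \<otimes>\<^bsub>M\<^esub> c) ` C # edges M C (x \<otimes>\<^bsub>M\<^esub> t \<otimes>\<^bsub>M\<^esub> w) ws"

lemma length_edges: "length (edges M C x ws) = 2 * length ws"
  by (induction M C x ws rule: edges.induct) auto

text \<open>\<open>normal_form\<close> will come from discrimination of words.
  \<open>malnormal\<close> makes stabilizers of long paths in the tree trivial.\<close>

locale amalgam = splitting M G T C for M (structure) and G T C +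
  assumes normal_form: "w0 \<in> G \<Longrightarrow> red_word M G T C ws \<Longrightarrow> ws \<noteq> [] \<Longrightarrow> w0 \<otimes> syl_prod M ws \<noteq> \<one>"
    and malnormal: "w \<in> G \<Longrightarrow> w \<notin> C \<Longrightarrow> c \<in> C \<Longrightarrow> inv w \<otimes> (c \<otimes> w) \<in> C \<Longrightarrow> c = \<one>"
begin

lemma T_Int_G: "t \<in> T \<Longrightarrow> t \<in> G \<Longrightarrow> t = \<one>"
  using normal_form[of \<one> "[(t, inv t)]"] by auto

lemma red_not_G: "w0 \<in> G \<Longrightarrow> red ws \<Longrightarrow> ws \<noteq> [] \<Longrightarrow> w0 \<otimes> sp ws \<notin> G"
proof
  assume a: "w0 \<in> G" "red ws" "ws \<noteq> []" "w0 \<otimes> sp ws \<in> G"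
  then have "inv (w0 \<otimes> sp ws) \<otimes> w0 \<otimes> sp ws = \<one>" by (simp add: m_assoc)
  moreover have "inv (w0 \<otimes> sp ws) \<otimes> w0 \<in> G" using G_simps(4)[OF a(4)] a(1) by (rule G_simps(3))
  ultimately show False using normal_form[of "inv (w0 \<otimes> sp ws) \<otimes> w0" ws] a by blast
qed

lemma coset_eq:
  assumes "x \<in> carrier M" "y \<in> carrier M"
  shows "(\<lambda>c. x \<otimes> c) ` C = (\<lambda>c. y \<otimes> c) ` C \<longleftrightarrow> inv x \<otimes> y \<in> C"
proof
  assume "(\<lambda>c. x \<otimes> c) ` C = (\<lambda>c. y \<otimes> c) ` C"
  moreover have "y \<in> (\<lambda>c. y \<otimes> c) ` C" using assms by (intro image_eqI[of _ _ \<one>]) auto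
  ultimately obtain c where "c \<in> C" "y = x \<otimes> c" by auto
  then show "inv x \<otimes> y \<in> C" using assms by simp
next
  assume z: "inv x \<otimes> y \<in> C"
  have "x \<otimes> c \<in> (\<lambda>c. y \<otimes> c) ` C" if "c \<in> C" for c
  proof (rule image_eqI)
    show "inv (inv x \<otimes> y) \<otimes> c \<in> C" using C_simps(3)[OF C_simps(4)[OF z] that] .
    show "x \<otimes> c = y \<otimes> (inv (inv x \<otimes> y) \<otimes> c)" using assms that by (simp add: inv_mult_group m_assoc)
  qed
  moreover have "y \<otimes> c \<in> (\<lambda>c. x \<otimes> c) ` C" if "c \<in> C" for c
  proof (rule image_eqI)
    show "inv x \<otimes> y \<otimes> c \<in> C" using C_simps(3)[OF z that] .
    show "y \<otimes> c = x \<otimes> (inv x \<otimes> y \<otimes> c)" using assms that by (simp add: m_assoc)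
  qed
  ultimately show "(\<lambda>c. x \<otimes> c) ` C = (\<lambda>c. y \<otimes> c) ` C" by blast
qed

text \<open>Without cancellation at the junction \<open>z\<close>, inverting the left word and
  appending the right one is already reduced; the induction moves one inverted syllable at a time
  across the junction.\<close>

lemma glue:
  assumes "red ws" "red ws'" "z \<in> G" "ws \<noteq> [] \<and> ws' \<noteq> [] \<longrightarrow> z \<notin> C"
  shows "\<exists>z0 zs. z0 \<in> G \<and> red zs \<and> inv (sp ws) \<otimes> (z \<otimes> sp ws') = z0 \<otimes> sp zs \<and> length zs = length ws + length ws'"
  using assms
proof (induction ws arbitrary: z ws')
  case Nil
  then show ?case by (intro exI[of _ z] exI[of _ ws']) auto
next
  case (Cons p ws)
  obtain t w where p: "p = (t, w)" by fastforce
  have tw: "t \<in> T" "t \<noteq> \<one>" "w \<in> G" "red ws" "ws \<noteq> [] \<longrightarrow> w \<notin> C" using Cons.prems p by auto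
  have "red ((inv t, z) # ws')" using Cons.prems tw by (auto simp: inv_eq_1_iff)
  moreover have "ws \<noteq> [] \<and> (inv t, z) # ws' \<noteq> [] \<longrightarrow> inv w \<notin> C" using tw by (simp add: C_inv_iff)
  ultimately obtain z0 zs where zs: "z0 \<in> G" "red zs" "length zs = length ws + length ((inv t, z) # ws')"
    "inv (sp ws) \<otimes> (inv w \<otimes> sp ((inv t, z) # ws')) = z0 \<otimes> sp zs"
    using Cons.IH[of "(inv t, z) # ws'" "inv w"] tw by auto
  have "inv (sp (p # ws)) \<otimes> (z \<otimes> sp ws') = inv (sp ws) \<otimes> (inv w \<otimes> sp ((inv t, z) # ws'))"
    using tw Cons.prems p by (simp add: inv_mult_group m_assoc)
  then show ?case using zs by (intro exI[of _ z0] exI[of _ zs]) auto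
qed

text \<open>A syllable is a path of two edges, from a coset of \<open>G\<close> to a coset of the
  other factor and back. Every shared edge costs one syllable of the difference: two shared edges
  cancel a letter of \<open>T\<close> on each side, a single shared edge merges two letters of
  \<open>T\<close> into one.\<close>

lemma difference_word:
  assumes "red ws" "red ws'" "x \<in> carrier M" "y \<in> carrier M" "inv x \<otimes> y \<in> G"
  shows "\<exists>z0 zs. z0 \<in> G \<and> red zs \<and> inv (x \<otimes> sp ws) \<otimes> (y \<otimes> sp ws') = z0 \<otimes> sp zs \<and>
    length zs + lcp (edges M C x ws) (edges M C y ws') = length ws + length ws'"
  using assms
proof (induction ws arbitrary: x y ws')
  case Nil
  then show ?case by (intro exI[of _ "inv x \<otimes> y"] exI[of _ ws']) (auto simp: m_assoc)
next
  case (Cons p ws)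
  obtain t w where p: "p = (t, w)" by fastforce
  have tw: "t \<in> T" "t \<noteq> \<one>" "w \<in> G" "red ws" "ws \<noteq> [] \<longrightarrow> w \<notin> C" using Cons.prems p by auto
  define z where "z = inv x \<otimes> y"
  have z: "z \<in> G" "y = x \<otimes> z" using Cons.prems by (auto simp: z_def)
  have eq: "inv (x \<otimes> sp (p # ws)) \<otimes> (y \<otimes> sp ws') = inv (sp (p # ws)) \<otimes> (z \<otimes> sp ws')"
    unfolding z(2) using Cons.prems z(1) by (simp add: inv_mult_group m_assoc)
  show ?case
  proof (cases "ws' = [] \<or> z \<notin> C")
    case True
    then have "lcp (edges M C x (p # ws)) (edges M C y ws') = 0"
    proof (cases ws')
      case Nil
      then show ?thesis by (cases "edges M C x (p # ws)") auto
    next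
      case (Cons q us)
      then have "(\<lambda>c. x \<otimes> c) ` C \<noteq> (\<lambda>c. y \<otimes> c) ` C"
        using True Cons.prems coset_eq[of x y] by (simp add: z_def)
      then show ?thesis using Cons p by (cases q) simp
    qed
    moreover have "\<exists>z0 zs. z0 \<in> G \<and> red zs \<and> inv (sp (p # ws)) \<otimes> (z \<otimes> sp ws') = z0 \<otimes> sp zs \<and> length zs = length (p # ws) + length ws'"
      using True Cons.prems z by (intro glue) auto
    ultimately show ?thesis unfolding eq by auto
  next
    case False
    then obtain t' w' vs where ws': "ws' = (t', w') # vs" and zC: "z \<in> C" by (cases ws') auto
    have tw': "t' \<in> T" "t' \<noteq> \<one>" "w' \<in> G" "red vs" "vs \<noteq> [] \<longrightarrow> w' \<notin> C" using Cons.prems ws' by auto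
    have c1: "(\<lambda>c. x \<otimes> c) ` C = (\<lambda>c. y \<otimes> c) ` C" using coset_eq[of x y] Cons.prems zC by (simp add: z_def)
    have ztw: "z \<otimes> (t' \<otimes> r) = t' \<otimes> (z \<otimes> r)" if "r \<in> carrier M" for r
      using CT[OF zC tw'(1)] that tw' z by (simp add: m_assoc[symmetric])
    have yt: "inv (x \<otimes> t) \<otimes> (y \<otimes> t') = inv t \<otimes> t' \<otimes> z"
      using CT[OF zC tw'(1)] tw tw' z Cons.prems by (simp add: z(2) inv_mult_group m_assoc)
    show ?thesis
    proof (cases "t = t'")
      case True
      have c2: "(\<lambda>c. x \<otimes> t \<otimes> c) ` C = (\<lambda>c. y \<otimes> t' \<otimes> c) ` C"
        using coset_eq[of "x \<otimes> t" "y \<otimes> t'"] Cons.prems tw tw' yt zC True by simp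
      have base: "inv (x \<otimes> t \<otimes> w) \<otimes> (y \<otimes> t' \<otimes> w') = inv w \<otimes> (z \<otimes> w')"
        using yt True tw tw' z Cons.prems ztw[of w'] by (simp add: z(2) inv_mult_group m_assoc)
      have "inv w \<otimes> (z \<otimes> w') \<in> G" using tw tw' z by simp
      then obtain z0 zs where zs: "z0 \<in> G" "red zs"
        "inv (x \<otimes> t \<otimes> w \<otimes> sp ws) \<otimes> (y \<otimes> t' \<otimes> w' \<otimes> sp vs) = z0 \<otimes> sp zs"
        "length zs + lcp (edges M C (x \<otimes> t \<otimes> w) ws) (edges M C (y \<otimes> t' \<otimes> w') vs) = length ws + length vs"
        using Cons.IH[of vs "x \<otimes> t \<otimes> w" "y \<otimes> t' \<otimes> w'"] tw tw' Cons.prems base by auto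
      have "inv (x \<otimes> sp (p # ws)) \<otimes> (y \<otimes> sp ws') = z0 \<otimes> sp zs"
        using zs(3) tw tw' Cons.prems p ws' by (simp add: m_assoc)
      then show ?thesis using zs c1 c2 p ws' by (intro exI[of _ z0] exI[of _ zs]) auto
    next
      case False
      have itt: "inv t \<otimes> t' \<in> T" "inv t \<otimes> t' \<noteq> \<one>"
      proof -
        show "inv t \<otimes> t' \<noteq> \<one>"
        proof
          assume "inv t \<otimes> t' = \<one>"
          then have "t \<otimes> (inv t \<otimes> t') = t \<otimes> \<one>" by simp
          then show False using tw tw' False by simp
        qed
      qed (use tw tw' in simp)
      \<comment> \<open>Here only the first edge of the syllable is shared: the merged letter is
        nontrivial, and \<open>T\<close> meets \<open>C\<close> trivially.\<close>
      have "inv t \<otimes> t' \<otimes> z \<notin> C"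
      proof
        assume "inv t \<otimes> t' \<otimes> z \<in> C"
        then have "inv t \<otimes> t' \<otimes> z \<otimes> inv z \<in> C" using zC by (intro C_simps(3)[OF _ C_simps(4)])
        moreover have "inv t \<otimes> t' \<otimes> z \<otimes> inv z = inv t \<otimes> t'" using tw tw' z by (simp add: m_assoc)
        ultimately have "inv t \<otimes> t' \<in> C" by (simp only:)
        then show False using T_Int_G[OF itt(1)] itt(2) by simp
      qed
      then have c2: "(\<lambda>c. x \<otimes> t \<otimes> c) ` C \<noteq> (\<lambda>c. y \<otimes> t' \<otimes> c) ` C"
        using coset_eq[of "x \<otimes> t" "y \<otimes> t'"] Cons.prems tw tw' yt by simp
      have "\<exists>z0 zs. z0 \<in> G \<and> red zs \<and> inv (sp ws) \<otimes> (inv w \<otimes> sp ((inv t \<otimes> t', z \<otimes> w') # vs)) = z0 \<otimes> sp zs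
          \<and> length zs = length ws + length ((inv t \<otimes> t', z \<otimes> w') # vs)"
        using tw tw' itt z zC by (intro glue) (auto simp: C_inv_iff C_cancel)
      moreover have "inv (sp (p # ws)) \<otimes> (z \<otimes> sp ws') = inv (sp ws) \<otimes> (inv w \<otimes> sp ((inv t \<otimes> t', z \<otimes> w') # vs))"
        using tw tw' z p ws' ztw[of "w' \<otimes> sp vs"] by (simp add: inv_mult_group m_assoc)
      ultimately show ?thesis unfolding eq using c1 c2 p ws' by auto
    qed
  qed
qed

text \<open>The difference of two spellings of one element has no syllables, so the common prefix
  uses up both paths.\<close>

lemma edges_unique:
  assumes "w0 \<in> G" "red ws" "w0' \<in> G" "red ws'" "w0 \<otimes> sp ws = w0' \<otimes> sp ws'"
  shows "edges M C w0 ws = edges M C w0' ws'"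
proof -
  obtain z0 zs where zs: "z0 \<in> G" "red zs" "inv (w0 \<otimes> sp ws) \<otimes> (w0' \<otimes> sp ws') = z0 \<otimes> sp zs"
    "length zs + lcp (edges M C w0 ws) (edges M C w0' ws') = length ws + length ws'"
    using difference_word[of ws ws' w0 w0'] assms by auto
  have "z0 \<otimes> sp zs = \<one>" using zs(3) assms by (metis G_simps(1) l_inv m_closed red_carrier)
  then have "zs = []" using normal_form zs by blast
  then show ?thesis using zs(4) by (intro lcp_full) (simp add: length_edges)
qed

definition geod :: "'a \<Rightarrow> 'a set list" where
  "geod h = (SOME es. \<exists>w0 ws. w0 \<in> G \<and> red ws \<and> h = w0 \<otimes> sp ws \<and> es = edges M C w0 ws)"

lemma geod_eq:
  assumes "w0 \<in> G" "red ws"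
  shows "geod (w0 \<otimes> sp ws) = edges M C w0 ws"
proof -
  have "\<exists>es u0 us. u0 \<in> G \<and> red us \<and> w0 \<otimes> sp ws = u0 \<otimes> sp us \<and> es = edges M C u0 us"
    using assms by blast
  from someI_ex[OF this, folded geod_def] obtain u0 us where
    "u0 \<in> G" "red us" "w0 \<otimes> sp ws = u0 \<otimes> sp us" "geod (w0 \<otimes> sp ws) = edges M C u0 us" by blast
  then show ?thesis using edges_unique[of w0 ws u0 us] assms by simp
qed

text \<open>The distance in the tree between the base vertex \<open>G\<close> and its translate by
  \<open>h\<close>.\<close>

definition tlen :: "'a \<Rightarrow> nat" where "tlen h = length (geod h)"

lemma tlen_eq: "w0 \<in> G \<Longrightarrow> red ws \<Longrightarrow> tlen (w0 \<otimes> sp ws) = 2 * length ws"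
  by (simp add: tlen_def geod_eq length_edges)

lemma tlen_diff:
  assumes "x \<in> H" "y \<in> H"
  shows "tlen (inv x \<otimes> y) + 2 * lcp (geod x) (geod y) = tlen x + tlen y"
proof -
  obtain w0 ws where x: "w0 \<in> G" "red ws" "x = w0 \<otimes> sp ws" using exists_red assms by blast
  obtain v0 vs where y: "v0 \<in> G" "red vs" "y = v0 \<otimes> sp vs" using exists_red assms by blast
  obtain z0 zs where zs: "z0 \<in> G" "red zs" "inv (w0 \<otimes> sp ws) \<otimes> (v0 \<otimes> sp vs) = z0 \<otimes> sp zs"
    "length zs + lcp (edges M C w0 ws) (edges M C v0 vs) = length ws + length vs"
    using difference_word[of ws vs w0 v0] x y by auto
  show ?thesis using zs x y by (simp add: geod_eq tlen_eq)
qed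

lemma tlen_one: "tlen \<one> = 0"
  using tlen_eq[of \<one> "[]"] by simp

lemma geod_one: "geod \<one> = []"
  using tlen_one by (simp add: tlen_def)

lemma tlen_zero_iff: assumes "h \<in> H" shows "tlen h = 0 \<longleftrightarrow> h \<in> G"
proof -
  obtain w0 ws where x: "w0 \<in> G" "red ws" "h = w0 \<otimes> sp ws" using exists_red assms by blast
  show ?thesis
  proof (cases ws)
    case Nil then show ?thesis using x tlen_eq[of w0 "[]"] by simp
  next
    case (Cons p us)
    then show ?thesis using x tlen_eq[of w0 ws] red_not_G[of w0 ws] by auto
  qed
qed

text \<open>By \<open>tlen_diff\<close> the Gromov product at \<one> is the length of the common
  initial path, which is ultrametric; so the constant is 0.\<close>

sublocale tree: hyp_length M H "\<lambda>h. real (tlen h)" 0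
proof -
  have inv_eq: "tlen (inv x) = tlen x" if "x \<in> H" for x
    using tlen_diff[of x \<one>] that by (cases "geod x") (auto simp: geod_one tlen_one)
  have "tlen (x \<otimes> y) \<le> tlen x + tlen y" if "x \<in> H" "y \<in> H" for x y
    using tlen_diff[of "inv x" y] inv_eq[of x] that by simp
  then interpret lg: length_group M H "\<lambda>h. real (tlen h)"
    using inv_eq H_sub tlen_one by unfold_locales (auto simp flip: of_nat_add)
  have gp: "lg.gprod \<one> x y = real (lcp (geod x) (geod y))" if "x \<in> H" "y \<in> H" for x y
  proof -
    have "real (tlen (inv x \<otimes> y)) + 2 * real (lcp (geod x) (geod y)) = real (tlen x) + real (tlen y)"
      using tlen_diff[OF that] by linarith
    then show ?thesis using that by (simp add: lg.gprod_def lg.dst_def)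
  qed
  show "hyp_length M H (\<lambda>h. real (tlen h)) 0"
  proof unfold_locales
    fix x y z assume "x \<in> H" "y \<in> H" "z \<in> H"
    then show "min (lg.gprod \<one> x y) (lg.gprod \<one> y z) - 0 \<le> lg.gprod \<one> x z"
      using lcp_ultra[of "geod x" "geod y" "geod z"] by (simp add: gp)
  qed simp
qed

end

section \<open>Cyclically reduced elements as translations of the tree\<close>

context splitting
begin

lemma sp_append: "red ws \<Longrightarrow> red ws' \<Longrightarrow> sp (ws @ ws') = sp ws \<otimes> sp ws'"
proof (induction ws)
  case (Cons p ws)
  then show ?case by (cases p) (auto simp: m_assoc)
qed simp

lemma red_append:
  "red ws \<Longrightarrow> red ws' \<Longrightarrow> ws \<noteq> [] \<and> ws' \<noteq> [] \<longrightarrow> snd (last ws) \<notin> C \<Longrightarrow> red (ws @ ws')"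
proof (induction ws)
  case (Cons p ws)
  then show ?case by (cases p; cases "ws = []") auto
qed simp

lemma red_appendD: "red (ws @ ws') \<Longrightarrow> red ws \<and> red ws'"
proof (induction ws)
  case (Cons p ws)
  then show ?case by (cases p) auto
qed simp

end

locale amalgam_csa = amalgam M G T C for M (structure) and G T C +
  assumes csa_H: "csa M (splitting.H M G T)"
begin

lemma malnormal_H:
  assumes "g \<in> H" "x \<in> H" "x \<noteq> \<one>" "(g \<otimes> x \<otimes> inv g) \<otimes> x = x \<otimes> (g \<otimes> x \<otimes> inv g)"
  shows "g \<otimes> x = x \<otimes> g"
  using csa_H assms unfolding csa_def by blast

text \<open>An element fixing both ends of the path fixes its edges: the first syllable puts
  \<open>h\<close> into \<open>C\<close>, the second one puts
  \<open>inv w \<otimes> h \<otimes> w\<close> into \<open>C\<close>, and malnormality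
  applies.\<close>

lemma fix_two_syllables:
  assumes "red vs" "length vs \<ge> 2" "h \<in> G" "inv (sp vs) \<otimes> (h \<otimes> sp vs) \<in> G"
  shows "h = \<one>"
proof -
  obtain t w r where vs: "vs = (t, w) # r" "r \<noteq> []" using assms(2) by (cases vs; cases "tl vs") auto
  have tw: "t \<in> T" "w \<in> G" "w \<notin> C" "red r" using assms(1) vs by auto
  have not_G: False if us: "red us" "us \<noteq> []" "z \<in> G" "z \<notin> C" "inv (sp us) \<otimes> (z \<otimes> sp us) \<in> G" for us z
  proof -
    obtain z0 zs where zs: "z0 \<in> G" "red zs" "inv (sp us) \<otimes> (z \<otimes> sp us) = z0 \<otimes> sp zs" "length zs = length us + length us"
      using glue[of us us z] us by blast
    then have "zs \<noteq> []" using that by auto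
    then show False using red_not_G[of z0 zs] zs that by simp
  qed
  have hC: "h \<in> C" using not_G[of vs h] assms vs by auto
  have "inv (sp vs) \<otimes> (h \<otimes> sp vs) = inv (sp r) \<otimes> ((inv w \<otimes> (h \<otimes> w)) \<otimes> sp r)"
  proof -
    have "h \<otimes> (t \<otimes> (w \<otimes> sp r)) = t \<otimes> (h \<otimes> (w \<otimes> sp r))"
      using CT[OF hC tw(1)] tw assms(3) by (simp add: m_assoc[symmetric])
    then show ?thesis using tw vs assms(3) by (simp add: inv_mult_group m_assoc)
  qed
  then have "inv w \<otimes> (h \<otimes> w) \<in> C" using not_G[of r "inv w \<otimes> (h \<otimes> w)"] assms(3,4) tw vs by auto
  then show ?thesis using malnormal[of w h] tw hC by blast
qed

lemma norm_tlen: "group_norm M H tlen"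
  using tree.L_one tree.L_inv tree.L_mult unfolding group_norm_def by (auto simp flip: of_nat_add)

text \<open>\<open>ws\<close> begins with a letter of \<open>T\<close> and ends outside
  \<open>C\<close>, so its repetitions stay reduced: the axis of \<open>c\<close> passes through the
  base vertex, and \<open>l\<close> is the translation length.\<close>

context
  fixes ws c and l :: real
  assumes ws: "red ws" "ws \<noteq> []" "snd (last ws) \<notin> C" and c_def: "c = sp ws"
    and l_def: "l = 2 * real (length ws)"
begin

lemma c_H: "c \<in> H" using ws c_def red_H by simp

lemma l_pos: "0 < l" using ws by (simp add: l_def)

lemma cyc_pow: "red (concat (replicate n ws)) \<and> c [^] n = sp (concat (replicate n ws)) \<and>
    length (concat (replicate n ws)) = n * length ws"
proof (induction n)
  case (Suc n)
  have "c [^] Suc n = c \<otimes> c [^] n" using c_H by (intro nat_pow_Suc2) simp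
  then show ?case using Suc ws red_append[of ws "concat (replicate n ws)"] sp_append[of ws "concat (replicate n ws)"]
    by (auto simp: c_def)
qed simp

lemma tlen_pow: "real (tlen (c [^] (n::int))) = l * real_of_int \<bar>n\<bar>"
proof -
  have "tlen (c [^] (k::nat)) = 2 * (k * length ws)" for k
    using cyc_pow[of k] tlen_eq[of \<one> "concat (replicate k ws)"] by simp
  from this[of "nat \<bar>n\<bar>"] have "real (tlen (c [^] \<bar>n\<bar>)) = l * real_of_int \<bar>n\<bar>"
    using int_pow_int[of M c "nat \<bar>n\<bar>"] by (simp add: l_def)
  then show ?thesis using tree.L_pow_abs[of c n] c_H by simp
qed

text \<open>The square is taken because \<open>ws\<close> may be a single syllable, while
  \<open>fix_two_syllables\<close> needs two.\<close>

lemma fix_axis: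
  assumes "h \<in> H" "tlen h = 0" "tlen (inv (c [^] (2::int)) \<otimes> (h \<otimes> c [^] (2::int))) = 0"
  shows "h = \<one>"
proof -
  have c2: "c [^] (2::int) = sp (concat (replicate 2 ws))" "red (concat (replicate 2 ws))"
    "length (concat (replicate 2 ws)) = 2 * length ws"
    using cyc_pow[of 2] int_pow_int[of M c 2] by auto
  show ?thesis
  proof (rule fix_two_syllables)
    show "red (concat (replicate 2 ws))" by (rule c2)
    show "2 \<le> length (concat (replicate 2 ws))" using c2(3) ws(2) by (cases ws) auto
    show "h \<in> G" using tlen_zero_iff assms by blast
    show "inv (sp (concat (replicate 2 ws))) \<otimes> (h \<otimes> sp (concat (replicate 2 ws))) \<in> G"
      unfolding c2(1)[symmetric]
      using tlen_zero_iff[of "inv (c [^] (2::int)) \<otimes> (h \<otimes> c [^] (2::int))"] assms c_H by auto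
  qed
qed

text \<open>If the overlap were long, then \<open>g c\<^sup>\<plusminus>\<^sup>1 g\<inverse>\<close> and \<open>c\<^sup>\<plusminus>\<^sup>1\<close> would agree on a long segment of the axis of \<open>c\<close>,
  and segment stabilizers are trivial.\<close>

lemma tree_overlap:
  assumes g: "g \<in> H" "g \<otimes> c \<noteq> c \<otimes> g"
  shows "tree.gprod \<one> (c [^] (N::int)) (g \<otimes> c [^] (M'::int)) \<le> real (tlen g) + 4 * l"
proof (rule ccontr)
  assume neg: "\<not> ?thesis"
  define Z where "Z = tree.gprod \<one> (c [^] N) (g \<otimes> c [^] M')"
  define f where "f = g \<otimes> c [^] M'"
  define Lg where "Lg = real (tlen g)"
  have fH: "f \<in> H" using g c_H by (simp add: f_def)
  have Z: "Z > Lg + 4 * l" using neg by (simp add: Z_def Lg_def)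
  have Lg0: "0 \<le> Lg" by (simp add: Lg_def)
  have N: "Z \<le> l * real_of_int \<bar>N\<bar>"
    using tree.gprod_le[of \<one> "c [^] N" f] fH c_H tlen_pow[of N] by (simp add: Z_def f_def tree.dst_one)
  have "M' \<noteq> 0"
  proof
    assume "M' = 0"
    then have "Z \<le> Lg"
      using tree.gprod_le[of \<one> g "c [^] N"] tree.gprod_commute[of g "c [^] N" \<one>] g c_H
      by (simp add: Z_def Lg_def tree.dst_one)
    then show False using Z l_pos by simp
  qed
  define \<sigma> \<eta> :: int where "\<sigma> = sgn N" and "\<eta> = sgn M'"
  have "N \<noteq> 0" using N Z l_pos Lg0 by auto
  then have \<sigma>: "\<sigma> = 1 \<or> \<sigma> = - 1" "N = \<sigma> * \<bar>N\<bar>" by (auto simp: \<sigma>_def sgn_if)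
  have \<eta>: "\<eta> = 1 \<or> \<eta> = - 1" "\<bar>M' + \<eta>\<bar> = \<bar>M'\<bar> + 1" "\<bar>\<eta>\<bar> = 1" using \<open>M' \<noteq> 0\<close> by (auto simp: \<eta>_def sgn_if)
  \<comment> \<open>The first period of the axis that lies farther from the base vertex than the
    vertex of \<open>g\<close>.\<close>
  define i where "i = nat \<lfloor>Lg / l\<rfloor> + 1"
  have i: "Lg < l * real i" "l * real i \<le> Lg + l"
  proof -
    have "0 \<le> Lg / l" using Lg0 l_pos by simp
    then have "Lg / l < real i" "real i \<le> Lg / l + 1" unfolding i_def by linarith+
    then show "Lg < l * real i" "l * real i \<le> Lg + l" using l_pos by (simp_all add: field_simps)
  qed
  define P where "P = (\<lambda>j::nat. c [^] (\<sigma> * int j))"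
  have PH: "P j \<in> H" for j using c_H by (simp add: P_def)
  have dPP: "tree.dst (P j) (P k) = l * \<bar>real k - real j\<bar>" for j k
  proof -
    have "tree.dst (P j) (P k) = l * real_of_int \<bar>\<sigma> * int k - \<sigma> * int j\<bar>"
      using tree.dst_pow[of c "\<sigma> * int j" "\<sigma> * int k"] c_H tlen_pow by (simp add: P_def)
    also have "\<bar>\<sigma> * int k - \<sigma> * int j\<bar> = \<bar>int k - int j\<bar>" using \<sigma>(1) by auto
    finally show ?thesis by simp
  qed
  have P0: "P 0 = \<one>" by (simp add: P_def)
  have PN: "P (nat \<bar>N\<bar>) = c [^] N" using \<sigma>(2) by (simp add: P_def)
  have LP: "tree.dst \<one> (P j) = l * real j" "tree.dst (P j) \<one> = l * real j" for j
    using dPP[of 0 j] dPP[of j 0] by (simp_all add: P0)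
  \<comment> \<open>Four points, \<open>i\<close> to \<open>i + 3\<close>, fit into the overlap
    since \<open>l * i \<le> Lg + l\<close>; this is the origin of \<open>4 * l\<close>.\<close>
  have j_lt: "l * real j < Z" "real j < real_of_int \<bar>N\<bar>" if "j \<le> i + 3" for j
  proof -
    have "real j \<le> real i + 3" using that by simp
    then have "l * real j \<le> l * (real i + 3)" using l_pos by (intro mult_left_mono) auto
    then show "l * real j < Z" using i(2) Z by (simp add: algebra_simps)
    then have "l * real j < l * real_of_int \<bar>N\<bar>" using N by simp
    then show "real j < real_of_int \<bar>N\<bar>" using l_pos by simp
  qed
  have C1: "tree.gprod (P j) \<one> g > 0" if "j \<ge> i" for j
  proof -
    have "tree.dst (P j) \<one> - tree.dst \<one> g \<le> tree.gprod (P j) \<one> g"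
      using PH g by (intro tree.gprod_ge_dst) auto
    moreover have "l * real i \<le> l * real j" using that l_pos by simp
    ultimately show ?thesis using i(1) LP g by (simp add: tree.dst_one Lg_def)
  qed
  \<comment> \<open>\<open>P j\<close> lies on the path from \<one> to \<open>c^N\<close> and before
    the branching towards \<open>f\<close>, but after the branching towards \<open>g\<close>; so it
    lies on the path from \<open>g\<close> to \<open>f\<close>.\<close>
  have on_gf: "tree.dst g (P j) + tree.dst (P j) f = l * real_of_int \<bar>M'\<bar>" if j: "i \<le> j" "j \<le> i + 3" for j
  proof -
    have "tree.dst (P j) (c [^] N) = l * (real_of_int \<bar>N\<bar> - real j)"
      using dPP[of j "nat \<bar>N\<bar>"] PN j_lt[OF j(2)] by simp
    moreover have "tree.dst \<one> (c [^] N) = l * real_of_int \<bar>N\<bar>" using tlen_pow c_H by (simp add: tree.dst_one)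
    ultimately have A: "tree.gprod (P j) \<one> (c [^] N) = 0"
      using LP[of j] by (simp add: tree.gprod_def algebra_simps)
    have "Z \<le> tree.gprod (P j) (c [^] N) f + tree.dst \<one> (P j)"
      unfolding Z_def f_def[symmetric] using PH fH c_H by (intro tree.gprod_change_base) auto
    then have B: "0 < tree.gprod (P j) f (c [^] N)"
      using j_lt[OF j(2)] LP[of j] tree.gprod_commute[of "c [^] N" f "P j"] c_H fH by simp
    have "min (tree.gprod (P j) \<one> f) (tree.gprod (P j) f (c [^] N)) - 0 \<le> tree.gprod (P j) \<one> (c [^] N)"
      using PH fH c_H by (intro tree.hyp) auto
    then have B': "tree.gprod (P j) \<one> f \<le> 0" using A B by (auto simp: min_def split: if_splits)
    have "min (tree.gprod (P j) \<one> g) (tree.gprod (P j) g f) - 0 \<le> tree.gprod (P j) \<one> f"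
      using PH fH g by (intro tree.hyp) auto
    then have "tree.gprod (P j) g f \<le> 0" using B' C1[OF j(1)] by (auto simp: min_def split: if_splits)
    then have "tree.dst (P j) g + tree.dst (P j) f \<le> tree.dst g f" by (simp add: tree.gprod_def)
    moreover have "tree.dst g f \<le> tree.dst g (P j) + tree.dst (P j) f" using g fH PH by (intro tree.dst_triangle) auto
    moreover have "tree.dst g f = l * real_of_int \<bar>M'\<bar>" using g c_H tlen_pow by (simp add: f_def tree.dst_def)
    ultimately show ?thesis using tree.dst_commute[of g "P j"] g PH by simp
  qed
  have step: "tree.dst g (P (Suc j)) = tree.dst g (P j) + l" if j: "i \<le> j" for j
  proof -
    have "tree.gprod (P j) \<one> (P (Suc j)) = 0"
      using LP dPP[of j "Suc j"] by (simp add: tree.gprod_def algebra_simps)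
    moreover have "min (tree.gprod (P j) \<one> g) (tree.gprod (P j) g (P (Suc j))) - 0 \<le> tree.gprod (P j) \<one> (P (Suc j))"
      using PH g by (intro tree.hyp) auto
    ultimately have "tree.gprod (P j) g (P (Suc j)) \<le> 0" using C1[OF j] by (auto simp: min_def split: if_splits)
    then have "tree.dst (P j) g + l \<le> tree.dst g (P (Suc j))" using dPP[of j "Suc j"] by (simp add: tree.gprod_def)
    moreover have "tree.dst g (P (Suc j)) \<le> tree.dst g (P j) + tree.dst (P j) (P (Suc j))"
      using g PH by (intro tree.dst_triangle) auto
    ultimately show ?thesis using dPP[of j "Suc j"] tree.dst_commute[of g "P j"] g PH by simp
  qed
  \<comment> \<open>\<open>\<gamma>\<close> translates along the axis of the conjugate by one period
    from \<open>g\<close> towards \<open>f\<close>. On the overlap it should act like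
    \<open>c^\<sigma>\<close>, so \<open>h\<close> should fix the points there.\<close>
  define \<gamma> where "\<gamma> = g \<otimes> c [^] \<eta> \<otimes> inv g"
  define h where "h = inv (c [^] \<sigma>) \<otimes> \<gamma>"
  have \<gamma>H: "\<gamma> \<in> H" and hH: "h \<in> H" using g c_H by (auto simp: \<gamma>_def h_def)
  have fixes_P: "tlen (inv (P j) \<otimes> (h \<otimes> P j)) = 0" if j: "i \<le> j" "j \<le> i + 2" for j
  proof -
    \<comment> \<open>\<open>f'\<close> is \<open>f\<close> moved one period further. The two
      candidates for the image of \<open>P j\<close> both lie on the path from \<open>g\<close> to
      \<open>f'\<close> at the same distance from \<open>g\<close>, hence coincide in a
      tree.\<close>
    define q1 q2 f' where "q1 = \<gamma> \<otimes> P j" and "q2 = P (Suc j)" and "f' = \<gamma> \<otimes> f"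
    have qH: "q1 \<in> H" "q2 \<in> H" "f' \<in> H" using PH \<gamma>H fH by (auto simp: q1_def q2_def f'_def)
    have \<gamma>g: "\<gamma> \<otimes> g = g \<otimes> c [^] \<eta>" using g c_H by (simp add: \<gamma>_def m_assoc)
    have f': "f' = g \<otimes> c [^] (M' + \<eta>)"
      using g c_H by (simp add: f'_def f_def \<gamma>_def m_assoc int_pow_mult[symmetric] add.commute)
    have dgf': "tree.dst g f' = l * (real_of_int \<bar>M'\<bar> + 1)"
      using g c_H tlen_pow[of "M' + \<eta>"] \<eta>(2) by (simp add: f' tree.dst_def)
    have dff': "tree.dst f f' = l"
    proof -
      have "inv f \<otimes> f' = c [^] \<eta>"
        using g c_H by (simp add: f' f_def inv_mult_group m_assoc int_pow_mult)
      then show ?thesis using tlen_pow[of \<eta>] \<eta>(3) by (simp add: tree.dst_def)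
    qed
    have d1: "tree.dst (\<gamma> \<otimes> g) q1 = tree.dst g (P j)" "tree.dst q1 f' = tree.dst (P j) f"
      using tree.dst_left[of \<gamma>] \<gamma>H g PH fH by (auto simp: q1_def f'_def)
    have d2: "tree.dst g (\<gamma> \<otimes> g) = l" using g c_H tlen_pow[of \<eta>] \<eta>(3) by (simp add: \<gamma>g tree.dst_def)
    have t1: "tree.dst g q1 \<le> tree.dst g (\<gamma> \<otimes> g) + tree.dst (\<gamma> \<otimes> g) q1" using g qH \<gamma>H by (intro tree.dst_triangle) auto
    have t2: "tree.dst g f' \<le> tree.dst g q1 + tree.dst q1 f'" using g qH by (intro tree.dst_triangle) auto
    have t3: "tree.dst g f' \<le> tree.dst g q2 + tree.dst q2 f'" using g qH by (intro tree.dst_triangle) auto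
    have t4: "tree.dst q2 f' \<le> tree.dst q2 f + tree.dst f f'" using fH qH by (intro tree.dst_triangle) auto
    have gf: "tree.dst g (P j) + tree.dst (P j) f = l * real_of_int \<bar>M'\<bar>" using on_gf[of j] j by simp
    have gf2: "tree.dst g q2 + tree.dst q2 f = l * real_of_int \<bar>M'\<bar>" using on_gf[of "Suc j"] j by (simp add: q2_def)
    have st: "tree.dst g q2 = tree.dst g (P j) + l" using step[of j] j by (simp add: q2_def)
    have e1: "tree.dst g q1 = tree.dst g q2" "tree.dst g q1 + tree.dst q1 f' = tree.dst g f'"
      using t1 t2 d1 d2 gf st dgf' by (auto simp: algebra_simps)
    have e2: "tree.dst g q2 + tree.dst q2 f' = tree.dst g f'"
      using t3 t4 dff' gf2 dgf' by (auto simp: algebra_simps)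
    have "tree.gprod g q1 f' = tree.dst g q1" "tree.gprod g f' q2 = tree.dst g q2"
      using e1(2) e2 tree.dst_commute[of f' q2] qH by (auto simp: tree.gprod_def)
    moreover have "min (tree.gprod g q1 f') (tree.gprod g f' q2) - 0 \<le> tree.gprod g q1 q2"
      using qH g by (intro tree.hyp) auto
    ultimately have "tree.dst g q1 \<le> tree.gprod g q1 q2" using e1(1) by simp
    then have "tree.dst q1 q2 \<le> 0" using e1(1) by (simp add: tree.gprod_def)
    then have "tree.dst q2 q1 \<le> 0" using tree.dst_commute qH by simp
    moreover have "inv q2 \<otimes> q1 = inv (P j) \<otimes> (h \<otimes> P j)"
    proof -
      have "q2 = c [^] \<sigma> \<otimes> P j"
        using c_H by (simp add: q2_def P_def int_pow_mult[symmetric] algebra_simps)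
      then show ?thesis using PH \<gamma>H c_H by (simp add: q1_def h_def inv_mult_group m_assoc)
    qed
    ultimately show ?thesis by (simp add: tree.dst_def)
  qed
  define a where "a = inv (P i) \<otimes> (h \<otimes> P i)"
  define b where "b = inv (P (i + 2)) \<otimes> (h \<otimes> P (i + 2))"
  have ab: "tlen a = 0" "tlen b = 0" using fixes_P[of i] fixes_P[of "i + 2"] by (auto simp: a_def b_def)
  have abH: "a \<in> H" "b \<in> H" using PH hH by (auto simp: a_def b_def)
  define s where "s = c [^] (2::int)"
  have sH: "s \<in> H" using c_H by (simp add: s_def)
  have "h = \<one>"
  \<comment> \<open>\<open>fix_axis\<close> reads the segment in the direction of positive powers of
    \<open>c\<close>; the sign decides from which end to start.\<close>
  proof (cases "\<sigma> = 1")
    case True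
    have "P (i + 2) = P i \<otimes> s" using c_H True by (simp add: P_def s_def int_pow_mult[symmetric] add.commute)
    then have "b = inv s \<otimes> (a \<otimes> s)" using PH hH sH by (simp add: a_def b_def inv_mult_group m_assoc)
    then have "a = \<one>" using fix_axis[of a] ab abH by (simp add: s_def)
    then have "P i \<otimes> (inv (P i) \<otimes> (h \<otimes> P i)) = P i" using PH hH by (simp add: a_def)
    then show ?thesis using PH[of i] hH by simp
  next
    case False
    then have "\<sigma> = -1" using \<sigma> by simp
    then have "P i = P (i + 2) \<otimes> s" using c_H by (simp add: P_def s_def int_pow_mult[symmetric])
    then have "a = inv s \<otimes> (b \<otimes> s)" using PH hH sH by (simp add: a_def b_def inv_mult_group m_assoc)
    then have "b = \<one>" using fix_axis[of b] ab abH by (simp add: s_def)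
    then have "P (i + 2) \<otimes> (inv (P (i + 2)) \<otimes> (h \<otimes> P (i + 2))) = P (i + 2)" using PH hH by (simp add: b_def)
    then show ?thesis using PH[of "i + 2"] hH by simp
  qed
  then have "c [^] \<sigma> \<otimes> (inv (c [^] \<sigma>) \<otimes> \<gamma>) = c [^] \<sigma>" using c_H by (simp add: h_def)
  then have "\<gamma> = c [^] \<sigma>" using c_H \<gamma>H by simp
  then have "(g \<otimes> c [^] \<eta> \<otimes> inv g) [^] \<eta> = c [^] (\<sigma> * \<eta>)" using c_H by (simp add: \<gamma>_def int_pow_pow)
  moreover have "(g \<otimes> c [^] \<eta> \<otimes> inv g) [^] \<eta> = g \<otimes> c \<otimes> inv g"
    using conj_int_pow[of g "c [^] \<eta>" \<eta>] g c_H \<eta>(1) by (auto simp: int_pow_pow)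
  ultimately have gcg: "g \<otimes> c \<otimes> inv g = c [^] (\<sigma> * \<eta>)" by simp
  have "(g \<otimes> c \<otimes> inv g) \<otimes> c = c \<otimes> (g \<otimes> c \<otimes> inv g)"
    unfolding gcg using int_pow_mult[of c "\<sigma> * \<eta>" 1] int_pow_mult[of c 1 "\<sigma> * \<eta>"] c_H by (simp add: add.commute)
  moreover have "c \<noteq> \<one>" using tlen_pow[of 1] l_pos c_H tlen_one by auto
  ultimately show False using malnormal_H[of g c] g c_H by blast
qed

lemma big_powers_cyc_reduced: "big_powers M H tlen c"
proof (rule tree.big_powers_from_overlap[where \<epsilon> = l and \<kappa> = 0 and B = "4 * l + 1"])
  show "l * real_of_int \<bar>n\<bar> - 0 \<le> real (tlen (c [^] n))" for n :: int using tlen_pow[of n] by simp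
  fix g and N M' :: int assume g: "g \<in> H" "g \<otimes> c \<noteq> c \<otimes> g"
  have "0 \<le> 4 * l * real (tlen g)" using l_pos by simp
  then show "tree.gprod \<one> (c [^] N) (g \<otimes> c [^] M') \<le> (4 * l + 1) * (real (tlen g) + 1)"
    using tree_overlap[OF g, of N M'] by (simp add: algebra_simps)
qed (use c_H l_pos in auto)

end

end

section \<open>Big powers of elliptic elements\<close>

context group
begin

lemma power_word_closed:
  "subgroup S G \<Longrightarrow> c \<in> S \<Longrightarrow> \<forall>(n, g)\<in>set ws. g \<in> S \<Longrightarrow> power_word G c ws \<in> S"
proof (induction ws)
  case Nil
  then show ?case by (simp add: subgroup.one_closed)
next
  case (Cons p ws)
  obtain n g where p: "p = (n, g)" by fastforce
  have "c [^] n \<otimes> g \<in> S" using Cons.prems p subgroup_int_pow_closed[of S c n] by (auto intro: subgroup.m_closed)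
  then show ?case using Cons p by (auto intro: subgroup.m_closed)
qed

lemma power_word_carrier: "c \<in> carrier G \<Longrightarrow> \<forall>(n, g)\<in>set ws. g \<in> carrier G \<Longrightarrow> power_word G c ws \<in> carrier G"
  by (rule power_word_closed[OF subgroup_self])

lemma power_word_append:
  "c \<in> carrier G \<Longrightarrow> \<forall>(n, g)\<in>set (ws @ ws'). g \<in> carrier G \<Longrightarrow>
    power_word G c (ws @ ws') = power_word G c ws \<otimes> power_word G c ws'"
proof (induction ws)
  case Nil
  then show ?case by (simp add: power_word_carrier)
next
  case (Cons p ws)
  obtain n g where p: "p = (n, g)" by fastforce
  have "power_word G c ws \<in> carrier G" "power_word G c ws' \<in> carrier G" "g \<in> carrier G"
    using Cons.prems p by (auto intro!: power_word_carrier)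
  then show ?case using Cons p by (simp add: m_assoc)
qed

lemma commute_conj_iff:
  assumes "x \<in> carrier G" "g \<in> carrier G" "c \<in> carrier G"
  shows "(inv x \<otimes> g \<otimes> x) \<otimes> c = c \<otimes> (inv x \<otimes> g \<otimes> x) \<longleftrightarrow> g \<otimes> (x \<otimes> c \<otimes> inv x) = (x \<otimes> c \<otimes> inv x) \<otimes> g"
proof -
  have "g \<otimes> (x \<otimes> c \<otimes> inv x) = x \<otimes> ((inv x \<otimes> g \<otimes> x) \<otimes> c) \<otimes> inv x"
    "(x \<otimes> c \<otimes> inv x) \<otimes> g = x \<otimes> (c \<otimes> (inv x \<otimes> g \<otimes> x)) \<otimes> inv x"
    using assms by (simp_all add: m_assoc)
  then show ?thesis using assms by simp
qed

text \<open>Conjugating the letters back changes their norm by at most \<open>2 * l x\<close>, which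
  the new constant \<open>K (2 l x + 1)\<close> absorbs.\<close>

lemma big_powers_conj:
  assumes S: "subgroup S G" and l: "group_norm G S l" and x: "x \<in> S" and c: "c \<in> S"
    and bp: "big_powers G S l c"
  shows "big_powers G S l (x \<otimes> c \<otimes> inv x)"
proof -
  have Scar: "y \<in> carrier G" if "y \<in> S" for y using subgroup.mem_carrier[OF S that] .
  have xc: "x \<in> carrier G" "c \<in> carrier G" using x c Scar by auto
  obtain K where K: "\<And>R ws. ws \<noteq> [] \<Longrightarrow> \<forall>(n, g)\<in>set ws. g \<in> S \<and> l g \<le> R \<and> int (K * (R + 1)) \<le> \<bar>n\<bar> \<Longrightarrow>
     \<forall>(n, g)\<in>set (butlast ws). g \<otimes> c \<noteq> c \<otimes> g \<Longrightarrow> power_word G c ws \<noteq> \<one>"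
    using bp unfolding big_powers_def by blast
  define K' where "K' = K * (2 * l x + 1)"
  have "power_word G (x \<otimes> c \<otimes> inv x) ws \<noteq> \<one>"
    if ws: "ws \<noteq> []" and all: "\<forall>(n, g)\<in>set ws. g \<in> S \<and> l g \<le> R \<and> int (K' * (R + 1)) \<le> \<bar>n\<bar>"
      and nc: "\<forall>(n, g)\<in>set (butlast ws). g \<otimes> (x \<otimes> c \<otimes> inv x) \<noteq> (x \<otimes> c \<otimes> inv x) \<otimes> g" for R ws
  proof -
    define cj where "cj = (\<lambda>(n::int, g). (n, inv x \<otimes> g \<otimes> x))"
    have cjS: "inv x \<otimes> g \<otimes> x \<in> S" if "g \<in> S" for g
      using that x S by (auto intro: subgroup.m_closed subgroup.m_inv_closed)
    have pw: "power_word G (x \<otimes> c \<otimes> inv x) us = x \<otimes> power_word G c (map cj us) \<otimes> inv x"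
      if "\<forall>(n, g)\<in>set us. g \<in> S" for us
      using that
    proof (induction us)
      case Nil
      then show ?case using xc by simp
    next
      case (Cons p us)
      obtain n g where p: "p = (n, g)" by fastforce
      have g: "g \<in> carrier G" using Cons.prems p Scar by auto
      have gs: "b \<in> carrier G" if "(a, b) \<in> set us" for a b using Cons.prems that Scar by auto
      have "\<forall>(n, g)\<in>set (map cj us). g \<in> carrier G"
        using gs xc by (auto simp: cj_def)
      then have P: "power_word G c (map cj us) \<in> carrier G" using xc by (intro power_word_carrier)
      have IH: "power_word G (x \<otimes> c \<otimes> inv x) us = x \<otimes> power_word G c (map cj us) \<otimes> inv x" using Cons by auto
      have "power_word G (x \<otimes> c \<otimes> inv x) (p # us) = (x \<otimes> c [^] n \<otimes> inv x \<otimes> g) \<otimes> (x \<otimes> power_word G c (map cj us) \<otimes> inv x)"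
        using IH p xc by (simp add: conj_int_pow)
      also have "\<dots> = x \<otimes> ((c [^] n \<otimes> (inv x \<otimes> g \<otimes> x)) \<otimes> power_word G c (map cj us)) \<otimes> inv x"
        using xc g P by (simp add: m_assoc)
      finally show ?case using p by (simp add: cj_def)
    qed
    have "power_word G c (map cj ws) \<noteq> \<one>"
    proof (rule K[of "map cj ws" "R + 2 * l x"])
      show "map cj ws \<noteq> []" using ws by simp
      have ln: "l (inv x \<otimes> g \<otimes> x) \<le> R + 2 * l x" if "g \<in> S" "l g \<le> R" for g
      proof -
        have "inv x \<in> S" "inv x \<otimes> g \<in> S" using x that S by (auto intro: subgroup.m_closed subgroup.m_inv_closed)
        then have "l (inv x \<otimes> g \<otimes> x) \<le> l (inv x \<otimes> g) + l x" "l (inv x \<otimes> g) \<le> l (inv x) + l g" "l (inv x) = l x"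
          using l x that unfolding group_norm_def by auto
        then show ?thesis using that by simp
      qed
      define B where "B = int (K * (R + 2 * l x + 1))"
      have "K * (R + 2 * l x + 1) \<le> K' * (R + 1)" by (simp add: K'_def algebra_simps)
      then have B: "B \<le> int (K' * (R + 1))" unfolding B_def by (simp only: of_nat_le_iff)
      have "inv x \<otimes> g \<otimes> x \<in> S \<and> l (inv x \<otimes> g \<otimes> x) \<le> R + 2 * l x \<and> B \<le> \<bar>n\<bar>" if "(n, g) \<in> set ws" for n g
      proof -
        have g: "g \<in> S" "l g \<le> R" "int (K' * (R + 1)) \<le> \<bar>n\<bar>" using all that by auto
        show ?thesis using cjS[OF g(1)] ln[OF g(1,2)] order_trans[OF B g(3)] by blast
      qed
      then show "\<forall>(n, g)\<in>set (map cj ws). g \<in> S \<and> l g \<le> R + 2 * l x \<and> int (K * (R + 2 * l x + 1)) \<le> \<bar>n\<bar>"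
        unfolding B_def[symmetric] by (auto simp: cj_def)
      have "(inv x \<otimes> g \<otimes> x) \<otimes> c \<noteq> c \<otimes> (inv x \<otimes> g \<otimes> x)" if "(n, g) \<in> set (butlast ws)" for n g
      proof -
        have "(n, g) \<in> set ws" using that by (rule in_set_butlastD)
        then have "g \<in> carrier G" using all Scar by auto
        then show ?thesis using commute_conj_iff[of x g c] nc that xc by auto
      qed
      then show "\<forall>(n, g)\<in>set (butlast (map cj ws)). g \<otimes> c \<noteq> c \<otimes> g"
        by (auto simp: map_butlast[symmetric] cj_def)
    qed
    moreover have "power_word G c (map cj ws) \<in> carrier G"
    proof (intro power_word_carrier)
      have "b \<in> carrier G" if "(a, b) \<in> set ws" for a b using all that Scar by auto
      then show "\<forall>(n, g)\<in>set (map cj ws). g \<in> carrier G" using xc by (auto simp: cj_def)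
    qed (rule xc)
    moreover have "x \<otimes> p \<otimes> inv x = \<one> \<Longrightarrow> p = \<one>" if "p \<in> carrier G" for p
    proof -
      assume "x \<otimes> p \<otimes> inv x = \<one>"
      then have "inv x \<otimes> (x \<otimes> p \<otimes> inv x) \<otimes> x = inv x \<otimes> \<one> \<otimes> x" by simp
      then show "p = \<one>" using xc that by (simp add: m_assoc)
    qed
    ultimately show ?thesis using pw[of ws] all by fastforce
  qed
  then show ?thesis unfolding big_powers_def by blast
qed

end

text \<open>The norm is left open because it varies along the tower and with the type of
  \<open>c\<close>. On a finitely generated group every norm is bounded by a multiple of the word
  length, so the bound stays linear in the radius.\<close>

definition has_big_powers :: "('a, 'm) monoid_scheme \<Rightarrow> 'a set \<Rightarrow> 'a \<Rightarrow> bool" where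
  "has_big_powers M S c \<longleftrightarrow> (\<exists>l. group_norm M S l \<and> big_powers M S l c)"

text \<open>Cyclicity of the centralizer recast as a pairwise condition, which restricts at once to
  the previous group of the tower and is invariant under conjugation.\<close>

definition rank_one :: "('a, 'm) monoid_scheme \<Rightarrow> 'a set \<Rightarrow> 'a \<Rightarrow> bool" where
  "rank_one M S c \<longleftrightarrow> (\<forall>x\<in>S. \<forall>y\<in>S. x \<noteq> \<one>\<^bsub>M\<^esub> \<longrightarrow> y \<noteq> \<one>\<^bsub>M\<^esub> \<longrightarrow> x \<otimes>\<^bsub>M\<^esub> c = c \<otimes>\<^bsub>M\<^esub> x \<longrightarrow> y \<otimes>\<^bsub>M\<^esub> c = c \<otimes>\<^bsub>M\<^esub> y \<longrightarrow>
     (\<exists>(a::int) (b::int). a \<noteq> 0 \<and> b \<noteq> 0 \<and> x [^]\<^bsub>M\<^esub> a = y [^]\<^bsub>M\<^esub> b))"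

context amalgam
begin

lemma append_to_last:
  assumes "red vs" "vs \<noteq> []" "y \<in> G" "red us" "us \<noteq> [] \<longrightarrow> snd (last vs) \<otimes> y \<notin> C"
  shows "\<exists>vs'. vs' \<noteq> [] \<and> red vs' \<and> sp vs' = sp vs \<otimes> (y \<otimes> sp us)"
  using assms
proof (induction vs)
  case (Cons p vs)
  obtain t w where p: "p = (t, w)" by fastforce
  have tw: "t \<in> T" "t \<noteq> \<one>" "w \<in> G" using Cons.prems p by auto
  show ?case
  proof (cases "vs = []")
    case True
    then show ?thesis using Cons.prems p tw
      by (intro exI[of _ "(t, w \<otimes> y) # us"]) (auto simp: m_assoc)
  next
    case False
    then obtain vs' where "vs' \<noteq> []" "red vs'" "sp vs' = sp vs \<otimes> (y \<otimes> sp us)" using Cons p by auto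
    then show ?thesis using Cons.prems p tw False
      by (intro exI[of _ "(t, w) # vs'"]) (auto simp: m_assoc)
  qed
qed simp

text \<open>Inverting shifts the pairing of powers with letters by one place. The leading
  \<open>inv (c^n)\<close> and the closing \<open>z\<close> supply the missing partners.\<close>

lemma inverse_power_word:
  assumes c: "c \<in> G"
    and bs: "\<forall>(k, g)\<in>set bs. g \<in> G \<and> l g \<le> R \<and> B \<le> \<bar>k\<bar> \<and> g \<otimes> c \<noteq> c \<otimes> g"
    and l: "\<And>g. g \<in> G \<Longrightarrow> l (inv g) = l g"
  shows "B \<le> \<bar>n\<bar> \<Longrightarrow> z \<in> G \<Longrightarrow> l z \<le> R \<Longrightarrow>
    \<exists>vs. vs \<noteq> [] \<and> power_word M c vs = inv (c [^] (n::int)) \<otimes> (inv (power_word M c bs) \<otimes> z) \<and>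
      (\<forall>(k, g)\<in>set vs. g \<in> G \<and> l g \<le> R \<and> B \<le> \<bar>k\<bar>) \<and> (\<forall>(k, g)\<in>set (butlast vs). g \<otimes> c \<noteq> c \<otimes> g) \<and> snd (last vs) = z"
  using bs
proof (induction bs arbitrary: z)
  case Nil
  then show ?case using c by (intro exI[of _ "[(- n, z)]"]) (auto simp: int_pow_neg)
next
  case (Cons p bs)
  obtain m g where p: "p = (m, g)" by fastforce
  have g: "g \<in> G" "l g \<le> R" "B \<le> \<bar>m\<bar>" "g \<otimes> c \<noteq> c \<otimes> g" using Cons.prems p by auto
  have ig: "inv g \<otimes> c \<noteq> c \<otimes> inv g" using commute_inv[of "inv g" c] g c by auto
  obtain vs where vs: "vs \<noteq> []" "power_word M c vs = inv (c [^] n) \<otimes> (inv (power_word M c bs) \<otimes> inv g)"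
    "\<forall>(k, g)\<in>set vs. g \<in> G \<and> l g \<le> R \<and> B \<le> \<bar>k\<bar>" "\<forall>(k, g)\<in>set (butlast vs). g \<otimes> c \<noteq> c \<otimes> g" "snd (last vs) = inv g"
    using Cons.IH[of "inv g"] Cons.prems l g by auto
  have pbs: "power_word M c bs \<in> carrier M" using Cons.prems c by (intro power_word_carrier) auto
  have "power_word M c (vs @ [(- m, z)]) = power_word M c vs \<otimes> power_word M c [(- m, z)]"
    using vs(3) Cons.prems c by (intro power_word_append) auto
  also have "\<dots> = inv (c [^] n) \<otimes> (inv (power_word M c (p # bs)) \<otimes> z)"
    using vs(2) pbs g c Cons.prems p by (simp add: inv_mult_group m_assoc int_pow_neg)
  finally have eq: "power_word M c (vs @ [(- m, z)]) = inv (c [^] n) \<otimes> (inv (power_word M c (p # bs)) \<otimes> z)" .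
  have "\<forall>(k, g)\<in>set vs. g \<otimes> c \<noteq> c \<otimes> g"
  proof -
    have "set vs = insert (last vs) (set (butlast vs))"
      using vs(1) append_butlast_last_id[of vs] by (metis list.simps(15) rotate1.simps(2) set_rotate1)
    then show ?thesis using vs(4,5) ig by (cases "last vs") auto
  qed
  then show ?case using eq vs g Cons.prems by (intro exI[of _ "vs @ [(- m, z)]"]) auto
qed

text \<open>The elliptic case: between two stable letters, a block \<open>y = h c\<^sup>n\<^sup>1 g\<^sub>1 \<dots> c\<^sup>n w\<close> of \<open>G\<close> does not lie in
  \<open>C = C\<^sub>G(u)\<close>, because \<open>y u y\<inverse> u\<inverse>\<close> is again a product of big powers of \<open>c\<close>.\<close>

lemma big_powers_elliptic:
  assumes c: "c \<in> G" and u: "u \<in> G" and C: "C = {g \<in> G. g \<otimes> u = u \<otimes> g}"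
    and no_conj: "\<And>w. w \<in> G \<Longrightarrow> (w \<otimes> u \<otimes> inv w) \<otimes> c \<noteq> c \<otimes> (w \<otimes> u \<otimes> inv w)"
    and nG: "group_norm M G lG" and bp: "big_powers M G lG c" and nH: "group_norm M H lH"
    and lH: "\<And>h. h \<in> H \<Longrightarrow> \<exists>w0 ws. w0 \<in> G \<and> red ws \<and> h = w0 \<otimes> sp ws \<and>
      lG w0 + sum_list (map (\<lambda>(t, w). lG w) ws) \<le> lH h"
  shows "big_powers M H lH c"
proof -
  obtain K where K: "\<And>R ws. ws \<noteq> [] \<Longrightarrow> \<forall>(n, g)\<in>set ws. g \<in> G \<and> lG g \<le> R \<and> int (K * (R + 1)) \<le> \<bar>n\<bar> \<Longrightarrow>
     \<forall>(n, g)\<in>set (butlast ws). g \<otimes> c \<noteq> c \<otimes> g \<Longrightarrow> power_word M c ws \<noteq> \<one>"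
    using bp unfolding big_powers_def by blast
  have lG_inv: "lG (inv g) = lG g" if "g \<in> G" for g using nG that by (simp add: group_norm_def)
  have lG_mult: "lG (g \<otimes> h) \<le> lG g + lG h" if "g \<in> G" "h \<in> G" for g h using nG that by (simp add: group_norm_def)
  have lG_H: "lG g \<le> lH g" if g: "g \<in> G" for g
  proof -
    obtain w0 ws where w: "w0 \<in> G" "red ws" "g = w0 \<otimes> sp ws" "lG w0 + sum_list (map (\<lambda>(t, w). lG w) ws) \<le> lH g"
      using lH[OF G_H[OF g]] by blast
    have "ws = []" using red_not_G[OF w(1,2)] w(3) g by blast
    then show ?thesis using w by simp
  qed
  have CD: "x \<otimes> u = u \<otimes> x" if "x \<in> C" for x using C that by blast
  \<comment> \<open>The letters that occur below are at worst conjugates of \<open>u\<close> or its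
    inverse by elements of norm at most \<open>R\<close>, of norm at most
    \<open>R1 = 2 R + lG u\<close>.\<close>
  define K' where "K' = K * (lG u + 2)"
  have "power_word M c ws \<noteq> \<one>"
    if ws: "ws \<noteq> []" and all: "\<forall>(n, g)\<in>set ws. g \<in> H \<and> lH g \<le> R \<and> int (K' * (R + 1)) \<le> \<bar>n\<bar>"
      and nc: "\<forall>(n, g)\<in>set (butlast ws). g \<otimes> c \<noteq> c \<otimes> g" for R ws
  proof -
    define R1 where "R1 = 2 * R + lG u"
    define B where "B = int (K * (R1 + 1))"
    have "K * (R1 + 1) \<le> K' * (R + 1)" by (simp add: K'_def R1_def algebra_simps)
    then have KB: "B \<le> int (K' * (R + 1))" unfolding B_def by (simp only: of_nat_le_iff)
    let ?good = "\<lambda>bs. \<forall>(k, g)\<in>set bs. g \<in> G \<and> lG g \<le> R1 \<and> B \<le> \<bar>k\<bar> \<and> g \<otimes> c \<noteq> c \<otimes> g"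
    have closing: "h \<otimes> (power_word M c bs \<otimes> (c [^] n \<otimes> w)) \<notin> C"
      if good: "?good bs" and n: "B \<le> \<bar>n\<bar>" and h: "h \<in> G" "lG h \<le> R" and w: "w \<in> G" "lG w \<le> R" for h bs w and n :: int
    proof
      define P where "P = power_word M c bs"
      assume "h \<otimes> (power_word M c bs \<otimes> (c [^] n \<otimes> w)) \<in> C"
      then have com: "(h \<otimes> (P \<otimes> (c [^] n \<otimes> w))) \<otimes> u = u \<otimes> (h \<otimes> (P \<otimes> (c [^] n \<otimes> w)))"
        unfolding P_def by (rule CD)
      have PG: "P \<in> G" unfolding P_def using good c by (intro power_word_closed[OF G_sub]) auto
      define z where "z = inv h \<otimes> inv u \<otimes> h"
      define v where "v = w \<otimes> u \<otimes> inv w"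
      have zG: "z \<in> G" "v \<in> G" using h u w by (auto simp: z_def v_def)
      have "lG z \<le> lG (inv h \<otimes> inv u) + lG h" "lG (inv h \<otimes> inv u) \<le> lG (inv h) + lG (inv u)"
        using h u unfolding z_def by (auto intro!: lG_mult)
      then have lz: "lG z \<le> R1" using h u lG_inv by (simp add: R1_def)
      have "lG v \<le> lG (w \<otimes> u) + lG (inv w)" "lG (w \<otimes> u) \<le> lG w + lG u"
        using w u unfolding v_def by (auto intro!: lG_mult)
      then have lv: "lG v \<le> R1" using w u lG_inv by (simp add: R1_def)
      obtain vs where vs: "vs \<noteq> []" "power_word M c vs = inv (c [^] n) \<otimes> (inv P \<otimes> z)"
        "\<forall>(k, g)\<in>set vs. g \<in> G \<and> lG g \<le> R1 \<and> B \<le> \<bar>k\<bar>" "\<forall>(k, g)\<in>set (butlast vs). g \<otimes> c \<noteq> c \<otimes> g"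
        using inverse_power_word[OF c good lG_inv n zG(1) lz] unfolding P_def by blast
      define us where "us = bs @ (n, v) # vs"
      have nv: "v \<otimes> c \<noteq> c \<otimes> v" unfolding v_def by (rule no_conj[OF w(1)])
      \<comment> \<open>With \<open>y = h P c^n w\<close>, the word \<open>us\<close> spells the
        commutator of \<open>y\<close> and \<open>u\<close> conjugated by \<open>h\<close>. Its
        middle letter is \<open>v = w u inv w\<close>, which does not commute with \<open>c\<close>;
        \<open>z\<close> comes last and is exempt.\<close>
      have "power_word M c us \<noteq> \<one>"
      proof (rule K[of us R1])
        show "us \<noteq> []" by (simp add: us_def)
        show "\<forall>(n, g)\<in>set us. g \<in> G \<and> lG g \<le> R1 \<and> int (K * (R1 + 1)) \<le> \<bar>n\<bar>"
          using good vs(3) zG lv n unfolding us_def B_def by auto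
        show "\<forall>(n, g)\<in>set (butlast us). g \<otimes> c \<noteq> c \<otimes> g"
          using good vs(1,4) nv by (auto simp: us_def butlast_append)
      qed
      moreover have "power_word M c us = \<one>"
      proof -
        have "power_word M c us = P \<otimes> ((c [^] n \<otimes> v) \<otimes> (inv (c [^] n) \<otimes> (inv P \<otimes> z)))"
          unfolding us_def using good vs zG c
          by (subst power_word_append) (auto simp: P_def)
        also have "\<dots> = inv h \<otimes> (((h \<otimes> (P \<otimes> (c [^] n \<otimes> w))) \<otimes> u) \<otimes> inv (P \<otimes> (c [^] n \<otimes> w)) \<otimes> (inv h \<otimes> inv u \<otimes> h))"
          using PG c h u w by (simp add: z_def v_def inv_mult_group m_assoc)
        also have "\<dots> = \<one>" unfolding com using PG c h u w by (simp add: inv_mult_group m_assoc)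
        finally show ?thesis .
      qed
      ultimately show False by simp
    qed
    have lastG: "lG (snd (last vs)) \<le> R" if "vs \<noteq> []" "sum_list (map (\<lambda>(t, w). lG w) vs) \<le> R" for vs :: "('a \<times> 'a) list"
    proof -
      have "(\<lambda>(t, w). lG w) (last vs) \<le> sum_list (map (\<lambda>(t, w). lG w) vs)"
        using that(1) by (intro member_le_sum_list) auto
      then show ?thesis using that(2) by (cases "last vs") auto
    qed
    \<comment> \<open>The word is read from the right. What has been read is either inside
      \<open>G\<close> or a block of \<open>G\<close> followed by a nonempty reduced word. Bounds
      are kept only for the letters \<open>bs\<close> and \<open>w\<close> of the open block, since
      \<open>us\<close> is never touched again except through its left end.\<close>
    have state: "(\<forall>(n, g)\<in>set ws. g \<in> G) \<or>
       (\<exists>bs n w us. ?good bs \<and> B \<le> \<bar>n\<bar> \<and> w \<in> G \<and> lG w \<le> R \<and> red us \<and> us \<noteq> [] \<and>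
          power_word M c ws = (power_word M c bs \<otimes> (c [^] (n::int) \<otimes> w)) \<otimes> sp us)"
      using all nc
    proof (induction ws)
      case (Cons p ws)
      obtain n g where p: "p = (n, g)" by fastforce
      have g: "g \<in> H" "lH g \<le> R" "B \<le> \<bar>n\<bar>" using Cons.prems KB p by auto
      have "\<forall>(n, g)\<in>set (butlast ws). g \<otimes> c \<noteq> c \<otimes> g" using Cons.prems(2) by (auto split: if_splits)
      then consider (1) "\<forall>(n, g)\<in>set ws. g \<in> G"
        | (2) bs m w us where "?good bs" "B \<le> \<bar>m\<bar>" "w \<in> G" "lG w \<le> R" "red us" "us \<noteq> []"
          "power_word M c ws = (power_word M c bs \<otimes> (c [^] (m::int) \<otimes> w)) \<otimes> sp us"
        using Cons.IH Cons.prems by auto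
      then show ?case
      proof cases
        case 1
        show ?thesis
        proof (cases "g \<in> G")
          case True
          then show ?thesis using 1 p by auto
        next
          case False
          obtain w0 vs where w: "w0 \<in> G" "red vs" "g = w0 \<otimes> sp vs" "lG w0 + sum_list (map (\<lambda>(t, w). lG w) vs) \<le> lH g"
            using lH[OF g(1)] by blast
          then have "vs \<noteq> []" using False by auto
          have y: "power_word M c ws \<in> G" using 1 c by (intro power_word_closed[OF G_sub])
          obtain us where us: "us \<noteq> []" "red us" "sp us = sp vs \<otimes> (power_word M c ws \<otimes> sp [])"
            using append_to_last[of vs "power_word M c ws" "[]"] w \<open>vs \<noteq> []\<close> y by auto
          have "power_word M c (p # ws) = (power_word M c [] \<otimes> (c [^] n \<otimes> w0)) \<otimes> sp us"
            using p w us y c by (simp add: m_assoc)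
          moreover have "lG w0 \<le> R" using w(4) g(2) by simp
          ultimately show ?thesis using us g w
            by (intro disjI2 exI[of _ "[]"] exI[of _ n] exI[of _ w0] exI[of _ us]) simp
        qed
      next
        case 2
        define y where "y = power_word M c bs \<otimes> (c [^] m \<otimes> w)"
        have bsG: "power_word M c bs \<in> G" using 2(1) c by (intro power_word_closed[OF G_sub]) auto
        have cG: "c [^] m \<in> G" for m :: int using c by (rule subgroup_int_pow_closed[OF G_sub])
        have yG: "y \<in> G" using bsG cG 2(3) by (simp add: y_def)
        \<comment> \<open>Then \<open>g\<close> is not the last letter, so it does not commute with
          \<open>c\<close>.\<close>
        have "ws \<noteq> []"
        proof
          assume "ws = []"
          then have "y \<otimes> sp us = \<one>" using 2(7) by (simp add: y_def)
          then show False using normal_form[OF yG 2(5,6)] by simp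
        qed
        then have gnc: "g \<otimes> c \<noteq> c \<otimes> g" using Cons.prems(2) p by auto
        show ?thesis
        proof (cases "g \<in> G")
          case True
          have "power_word M c (p # ws) = (power_word M c (p # bs) \<otimes> (c [^] m \<otimes> w)) \<otimes> sp us"
            using 2(7) p True bsG c 2(3,5) by (simp add: m_assoc)
          moreover have "?good (p # bs)" using 2(1) p True g lG_H[OF True] gnc by (auto simp: R1_def)
          ultimately show ?thesis using 2
            by (intro disjI2 exI[of _ "p # bs"] exI[of _ m] exI[of _ w] exI[of _ us]) blast
        next
          case False
          obtain w0 vs where w0: "w0 \<in> G" "red vs" "g = w0 \<otimes> sp vs" "lG w0 + sum_list (map (\<lambda>(t, w). lG w) vs) \<le> lH g"
            using lH[OF g(1)] by blast
          then have "vs \<noteq> []" using False by auto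
          have lw: "snd (last vs) \<in> G"
          proof -
            have "x \<in> set vs \<Longrightarrow> snd x \<in> G" for x using w0(2) by (induction vs) auto
            then show ?thesis using \<open>vs \<noteq> []\<close> by simp
          qed
          have "snd (last vs) \<otimes> y \<notin> C"
            unfolding y_def using lw w0(4) g(2) lastG[OF \<open>vs \<noteq> []\<close>] 2 by (intro closing) auto
          then obtain us' where us': "us' \<noteq> []" "red us'" "sp us' = sp vs \<otimes> (y \<otimes> sp us)"
            using append_to_last[of vs y us] w0 \<open>vs \<noteq> []\<close> yG 2 by auto
          have "power_word M c (p # ws) = (power_word M c [] \<otimes> (c [^] n \<otimes> w0)) \<otimes> sp us'"
            using p w0 us' yG c 2(5) unfolding 2(7)[folded y_def] power_word.simps by (simp add: m_assoc 2(7)[folded y_def])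
          moreover have "lG w0 \<le> R" using w0(4) g(2) by simp
          ultimately show ?thesis using us' g w0
            by (intro disjI2 exI[of _ "[]"] exI[of _ n] exI[of _ w0] exI[of _ us']) simp
        qed
      qed
    qed simp
    show ?thesis
    proof (cases "\<forall>(n, g)\<in>set ws. g \<in> G")
      case True
      show ?thesis
      proof (rule K[of ws R1])
        show "\<forall>(n, g)\<in>set ws. g \<in> G \<and> lG g \<le> R1 \<and> int (K * (R1 + 1)) \<le> \<bar>n\<bar>"
          using all True KB lG_H unfolding B_def R1_def by fastforce
      qed (use ws nc in auto)
    next
      case False
      then obtain bs n w us where s: "?good bs" "w \<in> G" "red us" "us \<noteq> []"
          "power_word M c ws = (power_word M c bs \<otimes> (c [^] (n::int) \<otimes> w)) \<otimes> sp us" using state by blast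
      have "power_word M c bs \<in> G" using s(1) c by (intro power_word_closed[OF G_sub]) auto
      moreover have "c [^] n \<in> G" using c by (rule subgroup_int_pow_closed[OF G_sub])
      ultimately have "power_word M c bs \<otimes> (c [^] n \<otimes> w) \<in> G" using s(2) by simp
      then show ?thesis using normal_form[of _ us] s by metis
    qed
  qed
  then show ?thesis unfolding big_powers_def by blast
qed

end

section \<open>Conjugacy types of elements, and the step of the induction\<close>

context amalgam
begin

text \<open>Cyclic reduction. If the last letter of \<open>G\<close> times \<open>w0\<close> lies in
  \<open>C\<close>, the last and first letters of \<open>T\<close> merge under a rotation and the
  number of syllables drops. The three outcomes are fixing a vertex of either kind and translating
  along an axis.\<close>

lemma conj_cases_word:
  "w0 \<in> G \<Longrightarrow> red ws \<Longrightarrow> \<exists>x\<in>H. \<exists>c0. w0 \<otimes> sp ws = x \<otimes> c0 \<otimes> inv x \<and>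
     (c0 \<in> G \<or> (\<exists>t\<in>T. \<exists>z\<in>C. c0 = t \<otimes> z) \<or> (\<exists>vs. red vs \<and> vs \<noteq> [] \<and> snd (last vs) \<notin> C \<and> c0 = sp vs))"
proof (induction "length ws" arbitrary: w0 ws rule: less_induct)
  case less
  show ?case
  proof (cases "ws = []")
    case True
    then show ?thesis using less.prems by (intro bexI[of _ \<one>] exI[of _ w0]) auto
  next
    case False
    then obtain vs t w where ws: "ws = vs @ [(t, w)]" by (metis prod.exhaust rev_exhaust)
    have vs: "red vs" "t \<in> T" "t \<noteq> \<one>" "w \<in> G" using less.prems ws red_appendD[of vs "[(t, w)]"] by auto
    define z where "z = w \<otimes> w0"
    have zG: "z \<in> G" using vs less.prems by (simp add: z_def)
    have spw: "sp ws = sp vs \<otimes> (t \<otimes> w)" using ws vs sp_append[of vs "[(t, w)]"] by simp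
    have conj: "w0 \<otimes> sp ws = w0 \<otimes> (sp vs \<otimes> (t \<otimes> z)) \<otimes> inv w0"
      using spw vs less.prems by (simp add: z_def m_assoc)
    show ?thesis
    proof (cases "z \<in> C")
      case False
      have "red (vs @ [(t, z)])"
      proof -
        have "red (us @ [(t, w)]) \<Longrightarrow> red (us @ [(t, z)])" for us
        proof (induction us)
          case (Cons p us) then show ?case by (cases p) auto
        qed (use zG in auto)
        then show ?thesis using less.prems ws by simp
      qed
      moreover have "sp (vs @ [(t, z)]) = sp vs \<otimes> (t \<otimes> z)" using vs zG sp_append[of vs "[(t, z)]"] by simp
      ultimately show ?thesis using False conj less.prems G_H
        by (intro bexI[of _ w0] exI[of _ "sp vs \<otimes> (t \<otimes> z)"] conjI disjI2 exI[of _ "vs @ [(t, z)]"]) auto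
    next
      case True
      show ?thesis
      proof (cases vs)
        case Nil
        then have "w0 \<otimes> sp ws = w0 \<otimes> (t \<otimes> z) \<otimes> inv w0" using conj vs zG by simp
        then show ?thesis using True vs less.prems G_H by blast
      next
        case (Cons p mid)
        obtain t1 w1 where p: "p = (t1, w1)" by fastforce
        have t1: "t1 \<in> T" "t1 \<noteq> \<one>" "w1 \<in> G" "red mid" "mid \<noteq> [] \<longrightarrow> w1 \<notin> C" using vs Cons p by auto
        \<comment> \<open>Conjugation by \<open>inv (t \<otimes> z)\<close> rotates the last
          syllable to the front.\<close>
        define y where "y = w0 \<otimes> inv (t \<otimes> z)"
        have tzH: "t \<otimes> z \<in> H" "w0 \<in> H" using vs zG G_H T_H less.prems by auto
        have yH: "y \<in> H" using tzH by (simp add: y_def)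
        have midH: "sp mid \<in> carrier M" using t1 by simp
        have spvs: "sp vs = t1 \<otimes> (w1 \<otimes> sp mid)" using Cons p by simp
        have tz: "t \<otimes> z = z \<otimes> t" using CT[OF True vs(2)] by simp
        have rot: "w0 \<otimes> sp ws = y \<otimes> (z \<otimes> ((t \<otimes> t1) \<otimes> (w1 \<otimes> sp mid))) \<otimes> inv y"
        proof -
          have "y \<otimes> (z \<otimes> ((t \<otimes> t1) \<otimes> (w1 \<otimes> sp mid))) \<otimes> inv y
              = w0 \<otimes> (inv (t \<otimes> z) \<otimes> ((z \<otimes> t) \<otimes> (sp vs \<otimes> ((t \<otimes> z) \<otimes> inv w0))))"
            using vs zG t1 midH less.prems spvs by (simp add: y_def inv_mult_group m_assoc)
          also have "\<dots> = w0 \<otimes> sp ws"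
            unfolding conj tz[symmetric] using vs zG less.prems by (simp add: m_assoc inv_mult_group)
          finally show ?thesis by simp
        qed
        have "\<exists>u0 us. u0 \<in> G \<and> red us \<and> length us < length ws \<and> z \<otimes> ((t \<otimes> t1) \<otimes> (w1 \<otimes> sp mid)) = u0 \<otimes> sp us"
        proof (cases "t \<otimes> t1 = \<one>")
          case True
          then show ?thesis using t1 zG midH ws Cons
            by (intro exI[of _ "z \<otimes> w1"] exI[of _ mid]) (auto simp: m_assoc)
        next
          case False
          then show ?thesis using t1 zG ws Cons vs
            by (intro exI[of _ z] exI[of _ "(t \<otimes> t1, w1) # mid"]) auto
        qed
        then obtain u0 us where u: "u0 \<in> G" "red us" "length us < length ws"
          "z \<otimes> ((t \<otimes> t1) \<otimes> (w1 \<otimes> sp mid)) = u0 \<otimes> sp us" by blast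
        obtain x c0 where x: "x \<in> H" "u0 \<otimes> sp us = x \<otimes> c0 \<otimes> inv x"
          and c0: "c0 \<in> G \<or> (\<exists>t\<in>T. \<exists>z\<in>C. c0 = t \<otimes> z) \<or> (\<exists>vs. red vs \<and> vs \<noteq> [] \<and> snd (last vs) \<notin> C \<and> c0 = sp vs)"
          using less.hyps[OF u(3,1,2)] by blast
        have "c0 \<in> carrier M" using c0 by auto
        then have "w0 \<otimes> sp ws = (y \<otimes> x) \<otimes> c0 \<otimes> inv (y \<otimes> x)"
          using rot u(4) x yH by (simp add: inv_mult_group m_assoc)
        then show ?thesis using c0 x yH by (intro bexI[of _ "y \<otimes> x"] exI[of _ c0]) auto
      qed
    qed
  qed
qed

end

context amalgam_csa
begin

theorem big_powers_step:
  assumes u: "u \<in> G" "u \<noteq> \<one>" and C: "C = {g \<in> G. g \<otimes> u = u \<otimes> g}"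
    and tf: "\<And>h k. h \<in> H \<Longrightarrow> h \<noteq> \<one> \<Longrightarrow> k > 0 \<Longrightarrow> h [^] (k::nat) \<noteq> \<one>"
    and t0: "t0 \<in> T" "t0 \<noteq> \<one>"
    and IH: "\<And>c. c \<in> G \<Longrightarrow> c \<noteq> \<one> \<Longrightarrow> rank_one M G c \<Longrightarrow> has_big_powers M G c"
    and c: "c \<in> H" "c \<noteq> \<one>" "rank_one M H c"
  shows "has_big_powers M H c"
proof -
  have uC: "u \<in> C" using C u by blast
  \<comment> \<open>\<open>u\<close> and \<open>t\<close> would have nontrivial powers in common,
    but \<open>T\<close> meets \<open>G\<close> trivially and there is no torsion.\<close>
  have excl: False if d: "d \<in> H" "rank_one M H d" "u \<otimes> d = d \<otimes> u" "t \<in> T" "t \<noteq> \<one>" "t \<otimes> d = d \<otimes> t" for d t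
  proof -
    obtain a b :: int where ab: "a \<noteq> 0" "b \<noteq> 0" "u [^] a = t [^] b"
      using d(2)[unfolded rank_one_def, rule_format, OF G_H[OF u(1)] T_H[OF d(4)] u(2) d(5) d(3) d(6)] by blast
    have "t [^] b \<in> T" using d(4) by (rule subgroup_int_pow_closed[OF T_sub])
    moreover have "u [^] a \<in> G" using u(1) by (rule subgroup_int_pow_closed[OF G_sub])
    ultimately have "t [^] b = \<one>" using T_Int_G ab by metis
    then have "t [^] \<bar>b\<bar> = \<one>" using int_pow_neg[of t b] d(4) by (cases "b \<ge> 0") auto
    then have "t [^] nat \<bar>b\<bar> = \<one>" using int_pow_int[of M t "nat \<bar>b\<bar>"] by simp
    moreover have "nat \<bar>b\<bar> > 0" using ab by simp
    ultimately show False using tf[OF T_H[OF d(4)] d(5)] by blast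
  qed
  obtain w0 ws where w: "w0 \<in> G" "red ws" "c = w0 \<otimes> sp ws" using exists_red c by blast
  obtain x c0 where x: "x \<in> H" "c = x \<otimes> c0 \<otimes> inv x"
    and c0: "c0 \<in> G \<or> (\<exists>t\<in>T. \<exists>z\<in>C. c0 = t \<otimes> z) \<or> (\<exists>vs. red vs \<and> vs \<noteq> [] \<and> snd (last vs) \<notin> C \<and> c0 = sp vs)"
    using conj_cases_word[OF w(1,2)] unfolding w(3) by blast
  have c0H: "c0 \<in> H" using c0 G_H T_H red_H by auto
  have rank_conj: "rank_one M H d" if d: "d \<in> H" "y \<in> H" and r: "rank_one M H (y \<otimes> d \<otimes> inv y)" for d y
    unfolding rank_one_def
  proof (intro ballI impI)
    fix p q assume p: "p \<in> H" "p \<noteq> \<one>" "p \<otimes> d = d \<otimes> p" and q: "q \<in> H" "q \<noteq> \<one>" "q \<otimes> d = d \<otimes> q"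
    have com: "(y \<otimes> p \<otimes> inv y) \<otimes> (y \<otimes> d \<otimes> inv y) = (y \<otimes> d \<otimes> inv y) \<otimes> (y \<otimes> p \<otimes> inv y)"
      if "p \<in> H" "p \<otimes> d = d \<otimes> p" for p
    proof -
      have "(y \<otimes> p \<otimes> inv y) \<otimes> (y \<otimes> d \<otimes> inv y) = y \<otimes> (p \<otimes> d) \<otimes> inv y" using that(1) d by (simp add: m_assoc)
      also have "\<dots> = (y \<otimes> d \<otimes> inv y) \<otimes> (y \<otimes> p \<otimes> inv y)" unfolding that(2) using that(1) d by (simp add: m_assoc)
      finally show ?thesis .
    qed
    have ne: "y \<otimes> p \<otimes> inv y \<noteq> \<one>" if "p \<in> H" "p \<noteq> \<one>" for p
    proof
      assume "y \<otimes> p \<otimes> inv y = \<one>"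
      then have "inv y \<otimes> (y \<otimes> p \<otimes> inv y) \<otimes> y = inv y \<otimes> \<one> \<otimes> y" by simp
      then show False using d that by (simp add: m_assoc)
    qed
    have "\<exists>(a::int) (b::int). a \<noteq> 0 \<and> b \<noteq> 0 \<and> (y \<otimes> p \<otimes> inv y) [^] a = (y \<otimes> q \<otimes> inv y) [^] b"
      using r com[OF p(1,3)] com[OF q(1,3)] ne[OF p(1,2)] ne[OF q(1,2)] p q d unfolding rank_one_def by simp
    then obtain a b :: int where ab: "a \<noteq> 0" "b \<noteq> 0" "(y \<otimes> p \<otimes> inv y) [^] a = (y \<otimes> q \<otimes> inv y) [^] b" by blast
    then have "y \<otimes> p [^] a \<otimes> inv y = y \<otimes> q [^] b \<otimes> inv y" using conj_int_pow p q d by simp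
    then have "p [^] a = q [^] b" using p q d by simp
    then show "\<exists>(a::int) (b::int). a \<noteq> 0 \<and> b \<noteq> 0 \<and> p [^] a = q [^] b" using ab by blast
  qed
  have r0: "rank_one M H c0" using rank_conj[OF c0H x(1)] c(3) x(2) by simp
  have c01: "c0 \<noteq> \<one>" using c(2) x by auto
  have "has_big_powers M H c0"
    using c0
  proof (elim disjE)
    assume cG: "c0 \<in> G"
    have "rank_one M G c0" using r0 G_H unfolding rank_one_def by blast
    then obtain lG where lG: "group_norm M G lG" "big_powers M G lG c0"
      using IH[OF cG c01] unfolding has_big_powers_def by blast
    obtain lH where lH: "group_norm M H lH" "\<And>h. h \<in> H \<Longrightarrow> \<exists>w0 ws. w0 \<in> G \<and> red ws \<and> h = w0 \<otimes> sp ws \<and>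
        lG w0 + sum_list (map (\<lambda>(t, w). lG w) ws) \<le> lH h" using exists_norm[OF lG(1)] by blast
    \<comment> \<open>Otherwise a conjugate \<open>d\<close> of \<open>c0\<close> would lie in
      \<open>C\<close> and thus commute with \<open>u\<close> and with the stable letter
      \<open>t0\<close>.\<close>
    have no_conj: "(w \<otimes> u \<otimes> inv w) \<otimes> c0 \<noteq> c0 \<otimes> (w \<otimes> u \<otimes> inv w)" if w: "w \<in> G" for w
    proof
      assume "(w \<otimes> u \<otimes> inv w) \<otimes> c0 = c0 \<otimes> (w \<otimes> u \<otimes> inv w)"
      then have com: "u \<otimes> (inv w \<otimes> c0 \<otimes> w) = (inv w \<otimes> c0 \<otimes> w) \<otimes> u"
        using commute_conj_iff[of w c0 u] w cG u by simp
      define d where "d = inv w \<otimes> c0 \<otimes> w"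
      have dG: "d \<in> G" using w cG by (simp add: d_def)
      have "w \<otimes> d \<otimes> inv w = c0" using w cG by (simp add: d_def m_assoc)
      then have rd: "rank_one M H d" using rank_conj[of d w] r0 dG w G_H by simp
      have com': "u \<otimes> d = d \<otimes> u" using com unfolding d_def .
      have "d \<in> C" unfolding C using dG com' by (intro CollectI conjI) (rule dG, rule com'[symmetric])
      then have "t0 \<otimes> d = d \<otimes> t0" using CT[OF _ t0(1)] by (metis (no_types))
      then show False using excl[OF G_H[OF dG] rd com' t0] by blast
    qed
    have "big_powers M H lH c0"
      using big_powers_elliptic[OF cG u(1) C no_conj lG lH] by blast
    then show ?thesis using lH(1) unfolding has_big_powers_def by blast
  next
    assume "\<exists>t\<in>T. \<exists>z\<in>C. c0 = t \<otimes> z"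
    then obtain t z where tz: "t \<in> T" "z \<in> C" "c0 = t \<otimes> z" by blast
    have zu: "z \<otimes> u = u \<otimes> z" using tz C by blast
    have ut: "u \<otimes> t = t \<otimes> u" using CT[OF uC tz(1)] .
    have "u \<otimes> c0 = (u \<otimes> t) \<otimes> z" using tz u by (simp add: m_assoc)
    also have "\<dots> = t \<otimes> (u \<otimes> z)" unfolding ut using tz u by (simp add: m_assoc)
    also have "\<dots> = c0 \<otimes> u" unfolding zu[symmetric] using tz u by (simp add: m_assoc)
    finally have uc: "u \<otimes> c0 = c0 \<otimes> u" .
    have False
    proof (cases "t = \<one>")
      case True
      then have "c0 = z" using tz by simp
      then show False using excl[OF c0H r0 uc t0] CT[OF tz(2) t0(1)] by simp
    next
      case False
      have "z \<otimes> t = t \<otimes> z" using CT tz by blast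
      then have "t \<otimes> c0 = c0 \<otimes> t" using tz by (simp add: m_assoc)
      then show False using excl[OF c0H r0 uc tz(1) False] by blast
    qed
    then show ?thesis ..
  next
    assume "\<exists>vs. red vs \<and> vs \<noteq> [] \<and> snd (last vs) \<notin> C \<and> c0 = sp vs"
    then show ?thesis using big_powers_cyc_reduced norm_tlen unfolding has_big_powers_def by blast
  qed
  then obtain l where l: "group_norm M H l" "big_powers M H l c0" unfolding has_big_powers_def by blast
  have "big_powers M H l c" unfolding x(2) using big_powers_conj[OF H_sub l(1) x(1) c0H l(2)] .
  then show ?thesis using l(1) unfolding has_big_powers_def by blast
qed

end

section \<open>Extensions of centralizers\<close>

text \<open>A leading letter is rotated to the end, where it joins the exempt last letter; its norm
  at most doubles, and so does the constant.\<close>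

lemma (in group) big_powers_open:
  assumes S: "subgroup S G" and l: "group_norm G S l" and c: "c \<in> S" and bp: "big_powers G S l c"
  obtains K :: nat where "\<And>R ws h. h \<in> S \<Longrightarrow> l h \<le> R \<Longrightarrow> ws \<noteq> [] \<Longrightarrow>
     \<forall>(n, g)\<in>set ws. g \<in> S \<and> l g \<le> R \<and> int (K * (R + 1)) \<le> \<bar>n\<bar> \<Longrightarrow>
     \<forall>(n, g)\<in>set (butlast ws). g \<otimes> c \<noteq> c \<otimes> g \<Longrightarrow> h \<otimes> power_word G c ws \<noteq> \<one>"
proof -
  have Scar: "y \<in> carrier G" if "y \<in> S" for y using subgroup.mem_carrier[OF S that] .
  obtain K where K: "\<And>R ws. ws \<noteq> [] \<Longrightarrow> \<forall>(n, g)\<in>set ws. g \<in> S \<and> l g \<le> R \<and> int (K * (R + 1)) \<le> \<bar>n\<bar> \<Longrightarrow>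
     \<forall>(n, g)\<in>set (butlast ws). g \<otimes> c \<noteq> c \<otimes> g \<Longrightarrow> power_word G c ws \<noteq> \<one>"
    using bp unfolding big_powers_def by blast
  have "h \<otimes> power_word G c ws \<noteq> \<one>"
    if h: "h \<in> S" "l h \<le> R" and ws: "ws \<noteq> []"
      and all: "\<forall>(n, g)\<in>set ws. g \<in> S \<and> l g \<le> R \<and> int (2 * K * (R + 1)) \<le> \<bar>n\<bar>"
      and nc: "\<forall>(n, g)\<in>set (butlast ws). g \<otimes> c \<noteq> c \<otimes> g" for R ws h
  proof
    assume eq: "h \<otimes> power_word G c ws = \<one>"
    obtain us n g where us: "ws = us @ [(n, g)]" using ws by (metis prod.exhaust rev_exhaust)
    define B where "B = int (K * (2 * R + 1))"
    have "K * (2 * R + 1) \<le> 2 * K * (R + 1)" by (simp add: algebra_simps)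
    then have B: "B \<le> int (2 * K * (R + 1))" unfolding B_def by (simp only: of_nat_le_iff)
    have g: "g \<in> S" "l g \<le> R" "B \<le> \<bar>n\<bar>" using all us B by auto
    have us': "b \<in> S" "l b \<le> R" "B \<le> \<bar>a\<bar>" if "(a, b) \<in> set us" for a b using all us B that by auto
    have pus: "power_word G c us \<in> carrier G" using us' c Scar by (intro power_word_carrier) auto
    have "power_word G c (us @ [(n, g \<otimes> h)]) \<noteq> \<one>"
    proof (rule K[of _ "2 * R"])
      have "l (g \<otimes> h) \<le> l g + l h" "g \<otimes> h \<in> S" using l g h S by (auto simp: group_norm_def intro: subgroup.m_closed)
      moreover have "l b \<le> 2 * R" if "(a, b) \<in> set us" for a b using us'(2)[OF that] by simp
      ultimately show "\<forall>(n, g)\<in>set (us @ [(n, g \<otimes> h)]). g \<in> S \<and> l g \<le> 2 * R \<and> int (K * (2 * R + 1)) \<le> \<bar>n\<bar>"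
        unfolding B_def[symmetric] using us' g h by auto
    qed (use us nc in auto)
    moreover have "power_word G c (us @ [(n, g \<otimes> h)]) = power_word G c ws \<otimes> h"
    proof -
      have "power_word G c (us @ [(n, x)]) = power_word G c us \<otimes> (c [^] n \<otimes> x)" if "x \<in> carrier G" for x
        using us' that c Scar by (subst power_word_append) auto
      then show ?thesis using us g h c Scar pus by (simp add: m_assoc)
    qed
    moreover have "power_word G c ws \<otimes> h = \<one>"
    proof -
      have "power_word G c ws \<in> carrier G" using all c Scar by (intro power_word_carrier) auto
      then show ?thesis using eq h Scar inv_comm by blast
    qed
    ultimately show False by simp
  qed
  then show ?thesis using that[of "2 * K"] by blast
qed

text \<open>The top nonzero digit contributes at least \<open>P^(k0 + 1)\<close>, all lower ones
  together at most \<open>R P^k0\<close>. Exponents start at 1, so that even the lowest digit alone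
  gives at least \<open>P - R\<close>.\<close>

lemma base_expansion_large:
  fixes v :: "nat \<Rightarrow> int" and P :: nat
  assumes v: "\<exists>k<m. v k \<noteq> 0" and R: "(\<Sum>k<m. \<bar>v k\<bar>) \<le> int R" and P: "R < P"
  shows "int P - int R \<le> \<bar>\<Sum>k<m. v k * int P ^ (k + 1)\<bar>"
proof -
  define k0 where "k0 = Max {k. k < m \<and> v k \<noteq> 0}"
  have fin: "finite {k. k < m \<and> v k \<noteq> 0}" by simp
  have "k0 \<in> {k. k < m \<and> v k \<noteq> 0}" unfolding k0_def using v by (intro Max_in) auto
  then have k0: "k0 < m" "v k0 \<noteq> 0" by auto
  have zero: "v k = 0" if "k0 < k" "k < m" for k
  proof (rule ccontr)
    assume "v k \<noteq> 0"
    then have "k \<le> k0" unfolding k0_def using fin that by (intro Max_ge) auto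
    then show False using that by simp
  qed
  have "(\<Sum>k<m. v k * int P ^ (k + 1)) = (\<Sum>k<Suc k0. v k * int P ^ (k + 1))"
    using k0 zero by (intro sum.mono_neutral_right) auto
  also have "\<dots> = (\<Sum>k<k0. v k * int P ^ (k + 1)) + v k0 * int P ^ (k0 + 1)" by simp
  finally have eq: "(\<Sum>k<m. v k * int P ^ (k + 1)) = (\<Sum>k<k0. v k * int P ^ (k + 1)) + v k0 * int P ^ (k0 + 1)" .
  have r1: "\<bar>\<Sum>k<k0. v k * int P ^ (k + 1)\<bar> \<le> (\<Sum>k<k0. \<bar>v k\<bar> * int P ^ k0)"
  proof (rule order_trans[OF sum_abs sum_mono])
    fix k assume "k \<in> {..<k0}"
    then have "int P ^ (k + 1) \<le> int P ^ k0" using P by (intro power_increasing) auto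
    then show "\<bar>v k * int P ^ (k + 1)\<bar> \<le> \<bar>v k\<bar> * int P ^ k0" by (simp add: abs_mult mult_left_mono)
  qed
  have r2: "(\<Sum>k<k0. \<bar>v k\<bar>) * int P ^ k0 \<le> int R * int P ^ k0"
  proof (rule mult_right_mono)
    have "(\<Sum>k<k0. \<bar>v k\<bar>) \<le> (\<Sum>k<m. \<bar>v k\<bar>)" using k0 by (intro sum_mono2) auto
    then show "(\<Sum>k<k0. \<bar>v k\<bar>) \<le> int R" using R by simp
  qed simp
  have rest: "\<bar>\<Sum>k<k0. v k * int P ^ (k + 1)\<bar> \<le> int R * int P ^ k0"
    using r1 r2 by (simp add: sum_distrib_right)
  have "1 * (int P * int P ^ k0) \<le> \<bar>v k0\<bar> * (int P * int P ^ k0)" using k0 by (intro mult_right_mono) auto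
  then have "int P * int P ^ k0 \<le> \<bar>v k0 * int P ^ (k0 + 1)\<bar>" by (simp add: abs_mult)
  then have "int P * int P ^ k0 - int R * int P ^ k0 \<le> \<bar>\<Sum>k<m. v k * int P ^ (k + 1)\<bar>" using rest eq by linarith
  moreover have "(int P - int R) * 1 \<le> (int P - int R) * int P ^ k0" using P by (intro mult_left_mono) auto
  ultimately show ?thesis by (simp add: algebra_simps)
qed

section \<open>Generators and retractions of an extension of a centralizer\<close>

lemma is_amalgam_ex:
  fixes H K :: "'h monoid"
  assumes "is_amalgam G A C \<alpha> \<beta> H i j" "group K" "f \<in> hom G K" "g \<in> hom A K" "\<forall>c\<in>C. f (\<alpha> c) = g (\<beta> c)"
  shows "\<exists>h\<in>hom H K. (\<forall>x\<in>carrier G. h (i x) = f x) \<and> (\<forall>y\<in>carrier A. h (j y) = g y)"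
  using assms unfolding is_amalgam_def by blast

text \<open>The subgroup generated by both images is a test group on the same type. The induced map
  into it, followed by the inclusion, agrees with the identity on the images and hence everywhere by
  uniqueness.\<close>

lemma amalgam_generates:
  fixes H :: "'h monoid"
  assumes am: "is_amalgam G A C \<alpha> \<beta> H i j"
  shows "carrier H = generate H (i ` carrier G \<union> j ` carrier A)"
proof -
  have H: "group H" and i: "i \<in> hom G H" and j: "j \<in> hom A H" and c: "\<forall>c\<in>C. i (\<alpha> c) = j (\<beta> c)"
    using am unfolding is_amalgam_def by auto
  have uniq: "h1 z = h2 z" if "h1 \<in> hom H H" "h2 \<in> hom H H" "\<forall>x\<in>carrier G. h1 (i x) = i x" "\<forall>y\<in>carrier A. h1 (j y) = j y"
    "\<forall>x\<in>carrier G. h2 (i x) = i x" "\<forall>y\<in>carrier A. h2 (j y) = j y" "z \<in> carrier H" for h1 h2 z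
    using am that H i j c unfolding is_amalgam_def by blast
  define U where "U = i ` carrier G \<union> j ` carrier A"
  have UH: "U \<subseteq> carrier H" using i j by (auto simp: U_def hom_def)
  have sub: "subgroup (generate H U) H" by (rule group.generate_is_subgroup[OF H UH])
  define K where "K = H\<lparr>carrier := generate H U\<rparr>"
  have K: "group K" unfolding K_def by (rule subgroup.subgroup_is_group[OF sub H])
  have iK: "i \<in> hom G K" using i by (auto simp: hom_def K_def U_def intro: generate.incl)
  have jK: "j \<in> hom A K" using j by (auto simp: hom_def K_def U_def intro: generate.incl)
  obtain h where h: "h \<in> hom H K" "\<forall>x\<in>carrier G. h (i x) = i x" "\<forall>y\<in>carrier A. h (j y) = j y"
    using is_amalgam_ex[OF am K iK jK c] by blast
  have KH: "generate H U \<subseteq> carrier H" using sub by (rule subgroup.subset)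
  have hH: "h \<in> hom H H" using h(1) KH by (auto simp: hom_def K_def)
  have id: "id \<in> hom H H" by (auto simp: hom_def)
  have "\<forall>z\<in>carrier H. h z = id z"
    using uniq[OF hH id h(2,3)] by simp
  then have "carrier H \<subseteq> generate H U" using h(1) by (force simp: hom_def K_def)
  then show ?thesis using KH by (auto simp: U_def)
qed

text \<open>Copies a group onto another type, so that it can serve as a test group in the universal
  property.\<close>

lemma (in group) transport_group:
  fixes e :: "'a \<Rightarrow> 'h"
  assumes e: "inj_on e (carrier G)"
  obtains K :: "'h monoid" where "group K" "e \<in> hom G K" "inv_into (carrier G) e \<in> hom K G"
proof -
  define d where "d = inv_into (carrier G) e"
  define K :: "'h monoid" where "K = \<lparr>carrier = e ` carrier G, monoid.mult = (\<lambda>x y. e (d x \<otimes> d y)), one = e \<one>\<rparr>"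
  have d: "d (e x) = x" if "x \<in> carrier G" for x using e that by (simp add: d_def)
  have "group K"
  proof (rule groupI)
    fix x assume "x \<in> carrier K"
    then obtain a where a: "a \<in> carrier G" "x = e a" by (auto simp: K_def)
    then show "\<exists>y\<in>carrier K. y \<otimes>\<^bsub>K\<^esub> x = \<one>\<^bsub>K\<^esub>"
      by (intro bexI[of _ "e (inv a)"]) (auto simp: K_def d)
  qed (auto simp: K_def d m_assoc)
  moreover have "e \<in> hom G K" by (auto simp: hom_def K_def d)
  moreover have "inv_into (carrier G) e \<in> hom K G" unfolding d_def[symmetric] by (auto simp: hom_def K_def d)
  ultimately show ?thesis using that by blast
qed

locale centralizer_extension = G: group G + M: group M for G :: "'g monoid" and M :: "'h monoid" (structure) +
  fixes u :: 'g and m :: nat and SH :: "'h set" and i :: "'g \<Rightarrow> 'h" and j :: "'g \<times> (nat \<Rightarrow> int) \<Rightarrow> 'h"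
  assumes u: "u \<in> carrier G" and SH: "subgroup SH M"
    and am: "is_amalgam G (ext_factor G (centralizer G u) m) (centralizer G u) id (\<lambda>c. (c, \<lambda>_. 0)) (M\<lparr>carrier := SH\<rparr>) i j"
begin

abbreviation "C0 \<equiv> centralizer G u"

definition "V = {v :: nat \<Rightarrow> int. \<forall>k\<ge>m. v k = 0}"

definition "st v = j (\<one>\<^bsub>G\<^esub>, v)"

text \<open>The exponent of \<open>u\<close> assigned to \<open>st v\<close> when the k-th stable
  letter goes to the power \<open>p k\<close> of \<open>u\<close>.\<close>

definition "pair p v = (\<Sum>k<m. v k * p k :: int)"

lemma C0: "c \<in> C0 \<longleftrightarrow> c \<in> carrier G \<and> c \<otimes>\<^bsub>G\<^esub> u = u \<otimes>\<^bsub>G\<^esub> c"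
  by (auto simp: centralizer_def)

lemma one_C0: "\<one>\<^bsub>G\<^esub> \<in> C0" using u by (simp add: C0)

lemma carrier_ext: "carrier (ext_factor G C0 m) = C0 \<times> V"
  by (auto simp: ext_factor_def V_def)

lemma mult_ext: "(a, v) \<otimes>\<^bsub>ext_factor G C0 m\<^esub> (b, w) = (a \<otimes>\<^bsub>G\<^esub> b, \<lambda>k. v k + w k)"
  by (simp add: ext_factor_def)

lemma i_hom: "i \<in> hom G (M\<lparr>carrier := SH\<rparr>)" and j_hom: "j \<in> hom (ext_factor G C0 m) (M\<lparr>carrier := SH\<rparr>)"
  and ij: "c \<in> C0 \<Longrightarrow> i c = j (c, \<lambda>_. 0)"
  using am unfolding is_amalgam_def by auto

lemma i_mult: "x \<in> carrier G \<Longrightarrow> y \<in> carrier G \<Longrightarrow> i (x \<otimes>\<^bsub>G\<^esub> y) = i x \<otimes> i y"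
  and i_SH: "x \<in> carrier G \<Longrightarrow> i x \<in> SH"
  using i_hom by (auto simp: hom_def)

lemma SH_M: "x \<in> SH \<Longrightarrow> x \<in> carrier M" using subgroup.mem_carrier[OF SH] .

lemma i_M [simp]: "x \<in> carrier G \<Longrightarrow> i x \<in> carrier M" using i_SH SH_M by blast

lemma i_one: "i \<one>\<^bsub>G\<^esub> = \<one>"
proof -
  have "i \<one>\<^bsub>G\<^esub> \<otimes> i \<one>\<^bsub>G\<^esub> = i \<one>\<^bsub>G\<^esub>" using i_mult[of "\<one>\<^bsub>G\<^esub>" "\<one>\<^bsub>G\<^esub>"] by simp
  then show ?thesis by simp
qed

lemma i_inv: assumes "x \<in> carrier G" shows "i (inv\<^bsub>G\<^esub> x) = inv (i x)"
proof -
  have "i (inv\<^bsub>G\<^esub> x) \<otimes> i x = \<one>" using i_mult[of "inv\<^bsub>G\<^esub> x" x] i_one assms by simp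
  then show ?thesis using assms by (intro M.inv_equality[symmetric]) auto
qed

lemma j_mult: "a \<in> C0 \<Longrightarrow> b \<in> C0 \<Longrightarrow> v \<in> V \<Longrightarrow> w \<in> V \<Longrightarrow> j (a \<otimes>\<^bsub>G\<^esub> b, \<lambda>k. v k + w k) = j (a, v) \<otimes> j (b, w)"
  using j_hom hom_mult[OF j_hom, of "(a, v)" "(b, w)"] by (simp add: carrier_ext mult_ext)

lemma V_zero: "(\<lambda>_. 0) \<in> V" and V_add: "v \<in> V \<Longrightarrow> w \<in> V \<Longrightarrow> (\<lambda>k. v k + w k) \<in> V"
  and V_neg: "v \<in> V \<Longrightarrow> (\<lambda>k. - v k) \<in> V"
  by (auto simp: V_def)

lemma st_SH: "v \<in> V \<Longrightarrow> st v \<in> SH"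
  using hom_in_carrier[OF j_hom, of "(\<one>\<^bsub>G\<^esub>, v)"] one_C0 by (simp add: st_def carrier_ext)

lemma st_M [simp]: "v \<in> V \<Longrightarrow> st v \<in> carrier M" using st_SH SH_M by blast

lemma st_add: "v \<in> V \<Longrightarrow> w \<in> V \<Longrightarrow> st (\<lambda>k. v k + w k) = st v \<otimes> st w"
  using j_mult[of "\<one>\<^bsub>G\<^esub>" "\<one>\<^bsub>G\<^esub>" v w] one_C0 by (simp add: st_def)

lemma st_zero: "st (\<lambda>_. 0) = \<one>"
  using ij[OF one_C0] i_one by (simp add: st_def)

lemma st_neg: assumes "v \<in> V" shows "st (\<lambda>k. - v k) = inv (st v)"
proof -
  have "st (\<lambda>k. - v k) \<otimes> st v = \<one>" using st_add[of "\<lambda>k. - v k" v] assms V_neg st_zero by simp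
  then show ?thesis using assms V_neg by (intro M.inv_equality[symmetric]) auto
qed

lemma j_split: "c \<in> C0 \<Longrightarrow> v \<in> V \<Longrightarrow> j (c, v) = i c \<otimes> st v" "c \<in> C0 \<Longrightarrow> v \<in> V \<Longrightarrow> j (c, v) = st v \<otimes> i c"
  using j_mult[of c "\<one>\<^bsub>G\<^esub>" "\<lambda>_. 0" v] j_mult[of "\<one>\<^bsub>G\<^esub>" c v "\<lambda>_. 0"] one_C0 V_zero ij[of c]
  by (auto simp: st_def C0)

sublocale splitting M "i ` carrier G" "st ` V" "i ` C0"
proof -
  have C0c: "a \<in> carrier G" if "a \<in> C0" for a using that by (simp add: C0)
  have C0s: "a \<otimes>\<^bsub>G\<^esub> b \<in> C0" "inv\<^bsub>G\<^esub> a \<in> C0" if "a \<in> C0" "b \<in> C0" for a b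
  proof -
    show "a \<otimes>\<^bsub>G\<^esub> b \<in> C0" using that u unfolding C0 by (metis G.m_assoc G.m_closed)
    show "inv\<^bsub>G\<^esub> a \<in> C0" using that u G.commute_inv unfolding C0 by auto
  qed
  have 1: "subgroup (i ` carrier G) M"
    by (intro M.subgroupI) (auto simp: i_inv[symmetric] i_mult[symmetric])
  have 2: "subgroup (st ` V) M"
  proof (rule M.subgroupI)
    show "st ` V \<subseteq> carrier M" "st ` V \<noteq> {}" using V_zero by auto
    show "inv a \<in> st ` V" if "a \<in> st ` V" for a using that by (auto simp: st_neg[symmetric] intro!: imageI V_neg)
    show "a \<otimes> b \<in> st ` V" if "a \<in> st ` V" "b \<in> st ` V" for a b
      using that by (auto simp: st_add[symmetric] intro!: imageI V_add)
  qed
  have 3: "subgroup (i ` C0) M"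
  proof (rule M.subgroupI)
    show "i ` C0 \<subseteq> carrier M" using C0c by auto
    show "i ` C0 \<noteq> {}" using one_C0 by blast
    show "inv a \<in> i ` C0" if "a \<in> i ` C0" for a using that C0s(2) C0c by (auto simp: i_inv[symmetric])
    show "a \<otimes> b \<in> i ` C0" if "a \<in> i ` C0" "b \<in> i ` C0" for a b
      using that C0s(1) C0c by (auto simp: i_mult[symmetric])
  qed
  have 4: "i ` C0 \<subseteq> i ` carrier G" by (auto simp: C0)
  have 5: "c \<otimes> t = t \<otimes> c" if "c \<in> i ` C0" "t \<in> st ` V" for c t using that j_split by auto
  show "splitting M (i ` carrier G) (st ` V) (i ` C0)"
    by (intro splitting.intro splitting_axioms.intro M.is_group 1 2 3 4 5)
qed

lemma H_eq: "H = SH"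
proof
  show "H \<subseteq> SH" unfolding H_def
    by (rule M.generate_subgroup_incl[OF _ SH]) (auto simp: i_SH st_SH)
  have "SH = generate (M\<lparr>carrier := SH\<rparr>) (i ` carrier G \<union> j ` carrier (ext_factor G C0 m))"
    using amalgam_generates[OF am] by simp
  also have "\<dots> = generate M (i ` carrier G \<union> j ` carrier (ext_factor G C0 m))"
  proof (rule M.generate_consistent)
    show "i ` carrier G \<union> j ` carrier (ext_factor G C0 m) \<subseteq> SH"
      using i_SH hom_in_carrier[OF j_hom] by auto
  qed (rule SH)
  also have "\<dots> \<subseteq> H"
  proof (rule M.generate_subgroup_incl[OF _ H_sub])
    show "i ` carrier G \<union> j ` carrier (ext_factor G C0 m) \<subseteq> H"
      using j_split by (auto simp: carrier_ext G_H T_H C0)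
  qed
  finally show "SH \<subseteq> H" .
qed

text \<open>The universal property is applied to a copy of \<open>G\<close> on the type of the
  amalgam, and the induced map is carried back to \<open>G\<close>.\<close>

lemma retraction:
  fixes p :: "nat \<Rightarrow> int" and e :: "'g \<Rightarrow> 'h"
  assumes e: "inj_on e (carrier G)"
  obtains \<phi> where "\<phi> \<in> hom (M\<lparr>carrier := SH\<rparr>) G" "\<And>x. x \<in> carrier G \<Longrightarrow> \<phi> (i x) = x"
    "\<And>v. v \<in> V \<Longrightarrow> \<phi> (st v) = u [^]\<^bsub>G\<^esub> pair p v"
proof -
  obtain K :: "'h monoid" where K: "group K" "e \<in> hom G K" "inv_into (carrier G) e \<in> hom K G"
    using G.transport_group[OF e] by blast
  define d where "d = inv_into (carrier G) e"
  have d: "d (e x) = x" if "x \<in> carrier G" for x using e that by (simp add: d_def)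
  \<comment> \<open>Multiplicative because \<open>C0\<close> centralizes \<open>u\<close>, and the
    identity on the amalgamated subgroup.\<close>
  define f where "f = (\<lambda>(c, v). c \<otimes>\<^bsub>G\<^esub> u [^]\<^bsub>G\<^esub> pair p v)"
  have fc: "f (c, v) \<in> carrier G" if "c \<in> C0" for c v using that u by (simp add: f_def C0)
  have fm: "f (a \<otimes>\<^bsub>G\<^esub> b, \<lambda>k. v k + w k) = f (a, v) \<otimes>\<^bsub>G\<^esub> f (b, w)" if "a \<in> C0" "b \<in> C0" for a b v w
  proof -
    have ab: "a \<in> carrier G" "b \<in> carrier G" using that C0 by auto
    have "b \<otimes>\<^bsub>G\<^esub> u [^]\<^bsub>G\<^esub> (1 * pair p v) = u [^]\<^bsub>G\<^esub> (1 * pair p v) \<otimes>\<^bsub>G\<^esub> b"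
      using that u C0 by (intro G.conj_rel_pow) auto
    then have com: "u [^]\<^bsub>G\<^esub> pair p v \<otimes>\<^bsub>G\<^esub> b = b \<otimes>\<^bsub>G\<^esub> u [^]\<^bsub>G\<^esub> pair p v" by simp
    have "pair p (\<lambda>k. v k + w k) = pair p v + pair p w" by (simp add: pair_def sum.distrib algebra_simps)
    then have "f (a \<otimes>\<^bsub>G\<^esub> b, \<lambda>k. v k + w k) = a \<otimes>\<^bsub>G\<^esub> (b \<otimes>\<^bsub>G\<^esub> u [^]\<^bsub>G\<^esub> pair p v) \<otimes>\<^bsub>G\<^esub> u [^]\<^bsub>G\<^esub> pair p w"
      using ab u by (simp add: f_def G.int_pow_mult G.m_assoc)
    also have "\<dots> = f (a, v) \<otimes>\<^bsub>G\<^esub> f (b, w)"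
      unfolding com[symmetric] using ab u by (simp add: f_def G.m_assoc)
    finally show ?thesis .
  qed
  have fhom: "(\<lambda>y. e (f y)) \<in> hom (ext_factor G C0 m) K"
  proof (rule homI)
    show "e (f y) \<in> carrier K" if "y \<in> carrier (ext_factor G C0 m)" for y
      using that fc hom_in_carrier[OF K(2)] by (auto simp: carrier_ext)
    show "e (f (x \<otimes>\<^bsub>ext_factor G C0 m\<^esub> y)) = e (f x) \<otimes>\<^bsub>K\<^esub> e (f y)"
      if "x \<in> carrier (ext_factor G C0 m)" "y \<in> carrier (ext_factor G C0 m)" for x y
      using that fc fm hom_mult[OF K(2)] by (auto simp: carrier_ext mult_ext)
  qed
  have comp: "\<forall>c\<in>C0. e (id c) = e (f (c, \<lambda>_. 0))" by (auto simp: f_def pair_def C0)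
  have "\<exists>h\<in>hom (M\<lparr>carrier := SH\<rparr>) K. (\<forall>x\<in>carrier G. h (i x) = e x) \<and>
      (\<forall>y\<in>carrier (ext_factor G C0 m). h (j y) = e (f y))"
    by (rule is_amalgam_ex[OF am K(1,2) fhom comp])
  then obtain h where h: "h \<in> hom (M\<lparr>carrier := SH\<rparr>) K" "\<And>x. x \<in> carrier G \<Longrightarrow> h (i x) = e x"
    "\<And>y. y \<in> carrier (ext_factor G C0 m) \<Longrightarrow> h (j y) = e (f y)" by blast
  have "d \<circ> h \<in> hom (M\<lparr>carrier := SH\<rparr>) G" using h(1) K(3) unfolding d_def by (rule hom_compose)
  moreover have "(d \<circ> h) (i x) = x" if "x \<in> carrier G" for x using h(2) d that by simp
  moreover have "(d \<circ> h) (st v) = u [^]\<^bsub>G\<^esub> pair p v" if "v \<in> V" for v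
    using h(3)[of "(\<one>\<^bsub>G\<^esub>, v)"] d fc[OF one_C0, of v] that one_C0 u by (simp add: st_def carrier_ext f_def)
  ultimately show ?thesis using that by blast
qed

end

section \<open>Discrimination\<close>

lemma hom_power_word:
  assumes "group G" "group K" "\<psi> \<in> hom G K" "c \<in> carrier G"
  shows "\<forall>(n, g)\<in>set ws. g \<in> carrier G \<Longrightarrow> \<psi> (power_word G c ws) = power_word K (\<psi> c) (map (\<lambda>(n, g). (n, \<psi> g)) ws)"
proof (induction ws)
  case Nil
  then show ?case using hom_one[OF assms(3,1,2)] by simp
next
  case (Cons p ws)
  interpret G: group G by fact
  interpret group_hom G K \<psi> using assms by (simp add: group_hom_def group_hom_axioms_def)
  obtain n g where p: "p = (n, g)" by fastforce
  have "power_word G c ws \<in> carrier G" using Cons.prems assms by (intro G.power_word_carrier) auto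
  then show ?case using Cons p assms by (simp add: hom_int_pow)
qed

lemma finite_bounded:
  fixes f :: "'a \<Rightarrow> nat"
  assumes "finite A"
  obtains R where "\<And>x. x \<in> A \<Longrightarrow> f x \<le> R"
  using assms finite_nat_set_iff_bounded_le[of "f ` A"] by auto

text \<open>In the usual terminology: \<open>G\<close> is fully residually
  \<open>\<Gamma>\<close>.\<close>

definition discriminated :: "('a, 'm) monoid_scheme \<Rightarrow> ('b, 'n) monoid_scheme \<Rightarrow> bool" where
  "discriminated G \<Gamma> \<longleftrightarrow> (\<forall>Y. finite Y \<longrightarrow> Y \<subseteq> carrier G \<longrightarrow> \<one>\<^bsub>G\<^esub> \<notin> Y \<longrightarrow> (\<exists>\<psi>\<in>hom G \<Gamma>. \<forall>x\<in>Y. \<psi> x \<noteq> \<one>\<^bsub>\<Gamma>\<^esub>))"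

lemma discriminated_pairs:
  fixes G (structure)
  assumes "group G" "group \<Gamma>" "discriminated G \<Gamma>" "finite D" "D \<subseteq> carrier G \<times> carrier G" "\<And>a b. (a, b) \<in> D \<Longrightarrow> a \<noteq> b"
  obtains \<psi> where "\<psi> \<in> hom G \<Gamma>" "\<And>a b. (a, b) \<in> D \<Longrightarrow> \<psi> a \<noteq> \<psi> b"
proof -
  interpret G: group G by fact
  define q where "q = (\<lambda>(a, b). a \<otimes> inv b)"
  have sub: "q ` D \<subseteq> carrier G" using assms(5) by (auto simp: q_def)
  have notin: "\<one> \<notin> q ` D"
  proof
    assume "\<one> \<in> q ` D"
    then obtain a b where ab: "(a, b) \<in> D" "a \<otimes> inv b = \<one>" by (auto simp: q_def)
    then have "a \<in> carrier G" "b \<in> carrier G" using assms(5) by auto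
    then have "a = b" using ab(2) G.inv_solve_right[of "\<one>" a b] by simp
    then show False using assms(6) ab by blast
  qed
  obtain \<psi> where \<psi>: "\<psi> \<in> hom G \<Gamma>" "\<forall>x\<in>q ` D. \<psi> x \<noteq> \<one>\<^bsub>\<Gamma>\<^esub>"
    using assms(3)[unfolded discriminated_def, rule_format, OF finite_imageI[OF assms(4)] sub notin] by blast
  interpret group_hom G \<Gamma> \<psi> using \<psi> assms by (simp add: group_hom_def group_hom_axioms_def)
  have "\<psi> a \<noteq> \<psi> b" if ab: "(a, b) \<in> D" for a b
  proof
    assume "\<psi> a = \<psi> b"
    moreover have "a \<in> carrier G" "b \<in> carrier G" using ab assms(5) by auto
    ultimately have "\<psi> (q (a, b)) = \<one>\<^bsub>\<Gamma>\<^esub>" by (simp add: q_def)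
    then show False using \<psi>(2) ab by blast
  qed
  then show ?thesis using that \<psi>(1) by blast
qed

lemma discriminated_torsion_free:
  fixes G (structure)
  assumes G: "group G" "group \<Gamma>" "discriminated G \<Gamma>" and tf: "torsion_free \<Gamma>"
  shows "torsion_free G"
  unfolding torsion_free_def
proof (intro ballI impI allI)
  fix g and k :: nat assume g: "g \<in> carrier G" "g \<noteq> \<one>" and k: "0 < k"
  interpret G: group G by fact
  obtain \<psi> where \<psi>: "\<psi> \<in> hom G \<Gamma>" "\<And>a b. (a, b) \<in> {(g, \<one>)} \<Longrightarrow> \<psi> a \<noteq> \<psi> b"
    using discriminated_pairs[OF G, of "{(g, \<one>)}"] g by auto
  interpret group_hom G \<Gamma> \<psi> using \<psi> G by (simp add: group_hom_def group_hom_axioms_def)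
  have "\<psi> g \<noteq> \<one>\<^bsub>\<Gamma>\<^esub>" using \<psi>(2) by auto
  then have "\<psi> (g [^] k) \<noteq> \<one>\<^bsub>\<Gamma>\<^esub>" using tf k g by (simp add: hom_nat_pow torsion_free_def)
  then show "g [^] k \<noteq> \<one>" by auto
qed

text \<open>Each clause is a universal sentence: a counterexample consists of equations and finitely
  many inequations, and a discriminating map preserves both.
  \<open>discriminated_torsion_free\<close> has the same reason.\<close>

lemma discriminated_csa:
  fixes G (structure)
  assumes G: "group G" "group \<Gamma>" "discriminated G \<Gamma>" and csa: "csa \<Gamma> (carrier \<Gamma>)"
  shows "csa G (carrier G)"
  unfolding csa_def
proof (intro conjI ballI impI)
  interpret G: group G by fact
  fix x y z assume xyz: "x \<in> carrier G" "y \<in> carrier G" "z \<in> carrier G" "y \<noteq> \<one>"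
    and com: "x \<otimes> y = y \<otimes> x" "y \<otimes> z = z \<otimes> y"
  show "x \<otimes> z = z \<otimes> x"
  proof (rule ccontr)
    assume ne: "x \<otimes> z \<noteq> z \<otimes> x"
    define D where "D = {(y, \<one>), (x \<otimes> z, z \<otimes> x)}"
    have D: "finite D" "D \<subseteq> carrier G \<times> carrier G" "\<And>a b. (a, b) \<in> D \<Longrightarrow> a \<noteq> b"
      using xyz ne by (auto simp: D_def)
    obtain \<psi> where \<psi>: "\<psi> \<in> hom G \<Gamma>" "\<And>a b. (a, b) \<in> D \<Longrightarrow> \<psi> a \<noteq> \<psi> b"
      using discriminated_pairs[OF G D] by blast
    interpret group_hom G \<Gamma> \<psi> using \<psi> G by (simp add: group_hom_def group_hom_axioms_def)
    have n: "\<psi> y \<noteq> \<one>\<^bsub>\<Gamma>\<^esub>" "\<psi> x \<otimes>\<^bsub>\<Gamma>\<^esub> \<psi> z \<noteq> \<psi> z \<otimes>\<^bsub>\<Gamma>\<^esub> \<psi> x"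
      using \<psi>(2)[of y "\<one>"] \<psi>(2)[of "x \<otimes> z" "z \<otimes> x"] xyz by (auto simp: D_def)
    have "\<psi> x \<otimes>\<^bsub>\<Gamma>\<^esub> \<psi> y = \<psi> y \<otimes>\<^bsub>\<Gamma>\<^esub> \<psi> x" "\<psi> y \<otimes>\<^bsub>\<Gamma>\<^esub> \<psi> z = \<psi> z \<otimes>\<^bsub>\<Gamma>\<^esub> \<psi> y"
      using com xyz by (simp_all flip: hom_mult)
    moreover have "\<psi> x \<in> carrier \<Gamma>" "\<psi> y \<in> carrier \<Gamma>" "\<psi> z \<in> carrier \<Gamma>" using xyz by auto
    ultimately show False using csa n unfolding csa_def by blast
  qed
next
  interpret G: group G by fact
  fix x g assume xg: "x \<in> carrier G" "g \<in> carrier G" "x \<noteq> \<one>"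
    and com: "(g \<otimes> x \<otimes> inv g) \<otimes> x = x \<otimes> (g \<otimes> x \<otimes> inv g)"
  show "g \<otimes> x = x \<otimes> g"
  proof (rule ccontr)
    assume ne: "g \<otimes> x \<noteq> x \<otimes> g"
    define D where "D = {(x, \<one>), (g \<otimes> x, x \<otimes> g)}"
    have D: "finite D" "D \<subseteq> carrier G \<times> carrier G" "\<And>a b. (a, b) \<in> D \<Longrightarrow> a \<noteq> b"
      using xg ne by (auto simp: D_def)
    obtain \<psi> where \<psi>: "\<psi> \<in> hom G \<Gamma>" "\<And>a b. (a, b) \<in> D \<Longrightarrow> \<psi> a \<noteq> \<psi> b"
      using discriminated_pairs[OF G D] by blast
    interpret group_hom G \<Gamma> \<psi> using \<psi> G by (simp add: group_hom_def group_hom_axioms_def)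
    have n: "\<psi> x \<noteq> \<one>\<^bsub>\<Gamma>\<^esub>" "\<psi> g \<otimes>\<^bsub>\<Gamma>\<^esub> \<psi> x \<noteq> \<psi> x \<otimes>\<^bsub>\<Gamma>\<^esub> \<psi> g"
      using \<psi>(2)[of x "\<one>"] \<psi>(2)[of "g \<otimes> x" "x \<otimes> g"] xg by (auto simp: D_def)
    have "\<psi> ((g \<otimes> x \<otimes> inv g) \<otimes> x) = \<psi> (x \<otimes> (g \<otimes> x \<otimes> inv g))" by (simp only: com)
    then have "(\<psi> g \<otimes>\<^bsub>\<Gamma>\<^esub> \<psi> x \<otimes>\<^bsub>\<Gamma>\<^esub> inv\<^bsub>\<Gamma>\<^esub> \<psi> g) \<otimes>\<^bsub>\<Gamma>\<^esub> \<psi> x = \<psi> x \<otimes>\<^bsub>\<Gamma>\<^esub> (\<psi> g \<otimes>\<^bsub>\<Gamma>\<^esub> \<psi> x \<otimes>\<^bsub>\<Gamma>\<^esub> inv\<^bsub>\<Gamma>\<^esub> \<psi> g)"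
      using xg by simp
    moreover have "\<psi> x \<in> carrier \<Gamma>" "\<psi> g \<in> carrier \<Gamma>" using xg by auto
    ultimately show False using csa n unfolding csa_def by blast
  qed
qed

context centralizer_extension
begin

definition "lift vws = map (\<lambda>(v, w). (st v, i w)) vws"

text \<open>Reducedness is expressed on the side of \<open>G\<close> and \<open>V\<close>, before
  applying \<open>i\<close> and \<open>st\<close>, so that the words can be mapped by a retraction
  and tested there.\<close>

definition "good_word vws \<longleftrightarrow> (\<forall>(v, w)\<in>set vws. v \<in> V \<and> st v \<noteq> \<one> \<and> w \<in> carrier G) \<and> (\<forall>(v, w)\<in>set (butlast vws). w \<notin> C0)"

lemma red_lift: "red ws \<Longrightarrow> \<exists>vws. ws = lift vws \<and> good_word vws"
proof (induction ws)
  case Nil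
  then show ?case by (intro exI[of _ "[]"]) (simp add: lift_def good_word_def)
next
  case (Cons p ws)
  then obtain vws where vws: "ws = lift vws" "good_word vws" by (cases p) auto
  obtain v w where p: "p = (st v, i w)" "v \<in> V" "w \<in> carrier G" "st v \<noteq> \<one>" "ws \<noteq> [] \<longrightarrow> i w \<notin> i ` C0"
    using Cons.prems by (cases p) auto
  then have "ws \<noteq> [] \<longrightarrow> w \<notin> C0" by blast
  then have "good_word ((v, w) # vws)" using vws p by (auto simp: good_word_def lift_def)
  then show ?case using vws p by (intro exI[of _ "(v, w) # vws"]) (simp add: lift_def)
qed

lemma good_word_Cons: "good_word ((v, w) # vws) \<Longrightarrow> good_word vws \<and> v \<in> V \<and> w \<in> carrier G"
  by (auto simp: good_word_def split: if_splits)

lemma sp_lift_SH: "good_word vws \<Longrightarrow> sp (lift vws) \<in> SH"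
proof (induction vws)
  case Nil
  then show ?case using subgroup.one_closed[OF SH] by (simp add: lift_def)
next
  case (Cons p vws)
  obtain v w where p: "p = (v, w)" by fastforce
  then have "good_word vws" "v \<in> V" "w \<in> carrier G" using Cons.prems good_word_Cons by auto
  then show ?case using Cons p subgroup.m_closed[OF SH] i_SH st_SH by (simp add: lift_def)
qed

lemma retract_lift:
  assumes \<phi>: "\<phi> \<in> hom (M\<lparr>carrier := SH\<rparr>) G" "\<And>x. x \<in> carrier G \<Longrightarrow> \<phi> (i x) = x"
    "\<And>v. v \<in> V \<Longrightarrow> \<phi> (st v) = u [^]\<^bsub>G\<^esub> pair p v"
  shows "good_word vws \<Longrightarrow> \<phi> (sp (lift vws)) = power_word G u (map (\<lambda>(v, w). (pair p v, w)) vws)"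
proof (induction vws)
  case Nil
  have "group (M\<lparr>carrier := SH\<rparr>)" by (rule subgroup.subgroup_is_group[OF SH M.is_group])
  then have "\<phi> \<one> = \<one>\<^bsub>G\<^esub>" using hom_one[OF \<phi>(1) _ G.is_group] by simp
  then show ?case by (simp add: lift_def)
next
  case (Cons q vws)
  obtain v w where q: "q = (v, w)" by fastforce
  then have g: "good_word vws" "v \<in> V" "w \<in> carrier G" using Cons.prems good_word_Cons by auto
  have mult: "\<phi> (a \<otimes> b) = \<phi> a \<otimes>\<^bsub>G\<^esub> \<phi> b" if "a \<in> SH" "b \<in> SH" for a b
    using hom_mult[OF \<phi>(1), of a b] that by simp
  have s: "st v \<in> SH" "i w \<in> SH" "sp (lift vws) \<in> SH" using g st_SH i_SH sp_lift_SH by auto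
  have "i w \<otimes> sp (lift vws) \<in> SH" using s subgroup.m_closed[OF SH] by blast
  then have "\<phi> (sp (lift (q # vws))) = u [^]\<^bsub>G\<^esub> pair p v \<otimes>\<^bsub>G\<^esub> (w \<otimes>\<^bsub>G\<^esub> \<phi> (sp (lift vws)))"
    using q s g \<phi>(2,3) by (simp add: lift_def mult)
  moreover have "power_word G u (map (\<lambda>(v, w). (pair p v, w)) vws) \<in> carrier G"
    using g(1) u by (intro G.power_word_carrier) (auto simp: good_word_def)
  ultimately show ?case using Cons.IH[OF g(1)] q g u by (simp add: G.m_assoc)
qed

lemma st_nontrivial: "v \<in> V \<Longrightarrow> st v \<noteq> \<one> \<Longrightarrow> \<exists>k<m. v k \<noteq> 0"
proof (rule ccontr)
  assume v: "v \<in> V" "st v \<noteq> \<one>" "\<not> (\<exists>k<m. v k \<noteq> 0)"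
  have "v = (\<lambda>_. 0)"
  proof
    fix k
    show "v k = 0" using v(1,3) by (cases "k < m") (auto simp: V_def)
  qed
  then show False using v(2) st_zero by simp
qed

text \<open>A map \<open>\<psi>0\<close> from \<open>G\<close> to \<Gamma> is chosen first, keeping
  \<open>u\<close> nontrivial and the interior letters outside its centralizer. Only then is the
  base \<open>P\<close> of the retraction chosen, against the big powers constant of the image of
  \<open>u\<close>. The claim concerns words and so contains the normal form theorem.\<close>

lemma word_discrimination:
  fixes \<Gamma> :: "('c, 'n) monoid_scheme" and e :: "'g \<Rightarrow> 'h"
  assumes \<Gamma>: "group \<Gamma>" and bp: "\<And>c. c \<in> carrier \<Gamma> \<Longrightarrow> c \<noteq> \<one>\<^bsub>\<Gamma>\<^esub> \<Longrightarrow> has_big_powers \<Gamma> (carrier \<Gamma>) c"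
    and disc: "discriminated G \<Gamma>" and u1: "u \<noteq> \<one>\<^bsub>G\<^esub>" and e: "inj_on e (carrier G)"
    and W: "finite W" "\<And>w0 vws. (w0, vws) \<in> W \<Longrightarrow> w0 \<in> carrier G \<and> good_word vws \<and> (vws = [] \<longrightarrow> w0 \<noteq> \<one>\<^bsub>G\<^esub>)"
  shows "\<exists>\<psi>\<in>hom (M\<lparr>carrier := SH\<rparr>) \<Gamma>. \<forall>(w0, vws)\<in>W. \<psi> (i w0 \<otimes> sp (lift vws)) \<noteq> \<one>\<^bsub>\<Gamma>\<^esub>"
proof -
  interpret \<Gamma>: group \<Gamma> by (rule \<Gamma>)
  \<comment> \<open>Pairs to be kept apart: \<open>u\<close> from \<one>, words without stable
    letters from \<one>, and \<open>w u\<close> from \<open>u w\<close> for every interior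
    letter.\<close>
  define D where "D = insert (u, \<one>\<^bsub>G\<^esub>) ((\<lambda>x. (fst x, \<one>\<^bsub>G\<^esub>)) ` {x \<in> W. snd x = []} \<union>
    (\<Union>x\<in>W. (\<lambda>(v, w). (w \<otimes>\<^bsub>G\<^esub> u, u \<otimes>\<^bsub>G\<^esub> w)) ` set (butlast (snd x))))"
  have finD: "finite D" using W(1) by (simp add: D_def)
  have inW: "w \<in> carrier G \<and> w \<notin> C0" if "(w0, vws) \<in> W" "(v, w) \<in> set (butlast vws)" for w0 vws v w
    using W(2)[OF that(1)] that(2) in_set_butlastD[OF that(2)] by (auto simp: good_word_def)
  have DG: "D \<subseteq> carrier G \<times> carrier G" using u W(2) inW by (fastforce simp: D_def)
  have Dne: "a \<noteq> b" if "(a, b) \<in> D" for a b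
    using that u1 W(2) inW by (fastforce simp: D_def C0)
  obtain \<psi>0 where \<psi>0: "\<psi>0 \<in> hom G \<Gamma>" "\<And>a b. (a, b) \<in> D \<Longrightarrow> \<psi>0 a \<noteq> \<psi>0 b"
    using discriminated_pairs[OF G.is_group \<Gamma> disc finD DG Dne] by blast
  interpret \<psi>0: group_hom G \<Gamma> \<psi>0 using \<psi>0 \<Gamma> by (simp add: group_hom_def group_hom_axioms_def)
  define u' where "u' = \<psi>0 u"
  have u': "u' \<in> carrier \<Gamma>" "u' \<noteq> \<one>\<^bsub>\<Gamma>\<^esub>" using u \<psi>0(2)[of u "\<one>\<^bsub>G\<^esub>"] by (auto simp: u'_def D_def)
  obtain l where l: "group_norm \<Gamma> (carrier \<Gamma>) l" "big_powers \<Gamma> (carrier \<Gamma>) l u'"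
    using bp[OF u'] unfolding has_big_powers_def by blast
  obtain K where K: "\<And>R ws h. h \<in> carrier \<Gamma> \<Longrightarrow> l h \<le> R \<Longrightarrow> ws \<noteq> [] \<Longrightarrow>
     \<forall>(n, g)\<in>set ws. g \<in> carrier \<Gamma> \<and> l g \<le> R \<and> int (K * (R + 1)) \<le> \<bar>n\<bar> \<Longrightarrow>
     \<forall>(n, g)\<in>set (butlast ws). g \<otimes>\<^bsub>\<Gamma>\<^esub> u' \<noteq> u' \<otimes>\<^bsub>\<Gamma>\<^esub> g \<Longrightarrow> h \<otimes>\<^bsub>\<Gamma>\<^esub> power_word \<Gamma> u' ws \<noteq> \<one>\<^bsub>\<Gamma>\<^esub>"
    using \<Gamma>.big_powers_open[OF \<Gamma>.subgroup_self l(1) u'(1) l(2)] by blast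
  obtain R where R: "\<And>a. a \<in> (\<Union>x\<in>W. insert (fst x) (snd ` set (snd x))) \<Longrightarrow> l (\<psi>0 a) \<le> R"
    using finite_bounded[of "\<Union>x\<in>W. insert (fst x) (snd ` set (snd x))" "\<lambda>a. l (\<psi>0 a)"] W(1) by auto
  obtain Q where Q: "\<And>v. v \<in> (\<Union>x\<in>W. fst ` set (snd x)) \<Longrightarrow> nat (\<Sum>k<m. \<bar>v k\<bar>) \<le> Q"
    using finite_bounded[of "\<Union>x\<in>W. fst ` set (snd x)" "\<lambda>v. nat (\<Sum>k<m. \<bar>v k\<bar>)"] W(1) by auto
  \<comment> \<open>\<open>Q\<close> bounds the digit sums, so \<open>P - Q\<close> exceeds the
    threshold \<open>K (R + 1)\<close>.\<close>
  define P where "P = K * (R + 1) + Q + 1"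
  obtain \<phi> where \<phi>: "\<phi> \<in> hom (M\<lparr>carrier := SH\<rparr>) G" "\<And>x. x \<in> carrier G \<Longrightarrow> \<phi> (i x) = x"
    "\<And>v. v \<in> V \<Longrightarrow> \<phi> (st v) = u [^]\<^bsub>G\<^esub> pair (\<lambda>k. int P ^ (k + 1)) v"
    using retraction[OF e, of "\<lambda>k. int P ^ (k + 1)"] by blast
  define \<psi> where "\<psi> = \<psi>0 \<circ> \<phi>"
  have "\<psi> \<in> hom (M\<lparr>carrier := SH\<rparr>) \<Gamma>" unfolding \<psi>_def using \<phi>(1) \<psi>0(1) by (rule hom_compose)
  moreover have "\<psi> (i w0 \<otimes> sp (lift vws)) \<noteq> \<one>\<^bsub>\<Gamma>\<^esub>" if x: "(w0, vws) \<in> W" for w0 vws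
  proof -
    have w: "w0 \<in> carrier G" "good_word vws" "vws = [] \<longrightarrow> w0 \<noteq> \<one>\<^bsub>G\<^esub>" using W(2)[OF x] by auto
    define ns where "ns = map (\<lambda>(v, w). (pair (\<lambda>k. int P ^ (k + 1)) v, w)) vws"
    have nsG: "\<forall>(n, g)\<in>set ns. g \<in> carrier G" using w(2) by (auto simp: ns_def good_word_def)
    have "\<phi> (i w0 \<otimes> sp (lift vws)) = w0 \<otimes>\<^bsub>G\<^esub> power_word G u ns"
      using hom_mult[OF \<phi>(1), of "i w0" "sp (lift vws)"] i_SH[OF w(1)] sp_lift_SH[OF w(2)] \<phi>(2)[OF w(1)]
        retract_lift[OF \<phi> w(2)] by (simp add: ns_def)
    then have eq: "\<psi> (i w0 \<otimes> sp (lift vws)) = \<psi>0 w0 \<otimes>\<^bsub>\<Gamma>\<^esub> power_word \<Gamma> u' (map (\<lambda>(n, g). (n, \<psi>0 g)) ns)"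
      using hom_power_word[OF G.is_group \<Gamma> \<psi>0(1) u nsG] G.power_word_carrier[OF u nsG] w(1) by (simp add: \<psi>_def u'_def)
    show ?thesis
    proof (cases "vws = []")
      case True
      then have "(w0, \<one>\<^bsub>G\<^esub>) \<in> D" using x by (force simp: D_def)
      then have "\<psi>0 w0 \<noteq> \<one>\<^bsub>\<Gamma>\<^esub>" using \<psi>0(2) by force
      then show ?thesis using eq True w(1) by (simp add: ns_def)
    next
      case False
      show ?thesis unfolding eq
      proof (rule K[of _ R])
        show "\<psi>0 w0 \<in> carrier \<Gamma>" using w(1) by simp
        show "l (\<psi>0 w0) \<le> R" using R x by force
        show "map (\<lambda>(n, g). (n, \<psi>0 g)) ns \<noteq> []" using False by (simp add: ns_def)
        define B where "B = int (K * (R + 1))"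
        have "w \<in> carrier G \<and> l (\<psi>0 w) \<le> R \<and> B \<le> \<bar>pair (\<lambda>k. int P ^ (k + 1)) v\<bar>" if vw: "(v, w) \<in> set vws" for v w
        proof -
          have v: "v \<in> V" "st v \<noteq> \<one>" "w \<in> carrier G" using w(2) vw by (auto simp: good_word_def)
          have "w \<in> (\<Union>x\<in>W. insert (fst x) (snd ` set (snd x)))"
            using vw by (intro UN_I[OF x] insertI2 image_eqI[of _ _ "(v, w)"]) simp_all
          then have "l (\<psi>0 w) \<le> R" by (rule R)
          moreover have "v \<in> (\<Union>x\<in>W. fst ` set (snd x))"
            using vw by (intro UN_I[OF x] image_eqI[of _ _ "(v, w)"]) simp_all
          then have "nat (\<Sum>k<m. \<bar>v k\<bar>) \<le> Q" by (rule Q)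
          then have "(\<Sum>k<m. \<bar>v k\<bar>) \<le> int Q" by simp
          then have "int P - int Q \<le> \<bar>\<Sum>k<m. v k * int P ^ (k + 1)\<bar>"
            by (intro base_expansion_large st_nontrivial[OF v(1,2)]) (auto simp: P_def)
          ultimately show ?thesis using v by (simp add: pair_def P_def B_def)
        qed
        then show "\<forall>(n, g)\<in>set (map (\<lambda>(n, g). (n, \<psi>0 g)) ns). g \<in> carrier \<Gamma> \<and> l g \<le> R \<and> int (K * (R + 1)) \<le> \<bar>n\<bar>"
          unfolding B_def[symmetric] by (fastforce simp: ns_def)
        have "\<psi>0 w \<otimes>\<^bsub>\<Gamma>\<^esub> u' \<noteq> u' \<otimes>\<^bsub>\<Gamma>\<^esub> \<psi>0 w" if vw: "(v, w) \<in> set (butlast vws)" for v w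
        proof -
          have "(w \<otimes>\<^bsub>G\<^esub> u, u \<otimes>\<^bsub>G\<^esub> w) \<in> D" using x vw by (force simp: D_def)
          then have "\<psi>0 (w \<otimes>\<^bsub>G\<^esub> u) \<noteq> \<psi>0 (u \<otimes>\<^bsub>G\<^esub> w)" by (rule \<psi>0(2))
          then show ?thesis using inW[OF x vw] u by (simp add: u'_def)
        qed
        then show "\<forall>(n, g)\<in>set (butlast (map (\<lambda>(n, g). (n, \<psi>0 g)) ns)). g \<otimes>\<^bsub>\<Gamma>\<^esub> u' \<noteq> u' \<otimes>\<^bsub>\<Gamma>\<^esub> g"
          by (auto simp: ns_def map_butlast[symmetric])
      qed
    qed
  qed
  ultimately show ?thesis by blast
qed

end

section \<open>Climbing the tower\<close>

lemma (in group) power_word_consistent: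
  "subgroup S G \<Longrightarrow> c \<in> S \<Longrightarrow> power_word (G\<lparr>carrier := S\<rparr>) c ws = power_word G c ws"
proof (induction ws)
  case (Cons p ws)
  then show ?case by (cases p) (simp add: int_pow_consistent[symmetric])
qed simp

text \<open>The norm is pulled back along \<open>\<psi>\<close>, and injectivity keeps noncommuting
  letters noncommuting. This starts the induction at the bottom of the tower, an isomorphic copy of
  \<Gamma>.\<close>

lemma (in group) has_big_powers_embed:
  assumes S: "subgroup S G" and \<Gamma>: "group \<Gamma>" and \<psi>: "\<psi> \<in> hom (G\<lparr>carrier := S\<rparr>) \<Gamma>" "inj_on \<psi> S"
    and c: "c \<in> S" and bp: "has_big_powers \<Gamma> (carrier \<Gamma>) (\<psi> c)"
  shows "has_big_powers G S c"
proof -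
  have GS: "group (G\<lparr>carrier := S\<rparr>)" by (rule subgroup.subgroup_is_group[OF S is_group])
  interpret h: group_hom "G\<lparr>carrier := S\<rparr>" \<Gamma> \<psi> using GS \<Gamma> \<psi> by (simp add: group_hom_def group_hom_axioms_def)
  have mult: "\<psi> (x \<otimes> y) = \<psi> x \<otimes>\<^bsub>\<Gamma>\<^esub> \<psi> y" if "x \<in> S" "y \<in> S" for x y using h.hom_mult[of x y] that by simp
  have inv: "\<psi> (inv x) = inv\<^bsub>\<Gamma>\<^esub> \<psi> x" if "x \<in> S" for x
    using h.hom_inv[of x] that m_inv_consistent[OF S that] by simp
  have one: "\<psi> \<one> = \<one>\<^bsub>\<Gamma>\<^esub>" using h.hom_one by simp
  have cl: "\<psi> x \<in> carrier \<Gamma>" if "x \<in> S" for x using h.hom_closed[of x] that by simp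
  obtain l where l: "group_norm \<Gamma> (carrier \<Gamma>) l" "big_powers \<Gamma> (carrier \<Gamma>) l (\<psi> c)"
    using bp unfolding has_big_powers_def by blast
  have n: "group_norm G S (\<lambda>x. l (\<psi> x))"
    using l(1) cl mult inv one S unfolding group_norm_def by auto
  obtain K where K: "\<And>R ws. ws \<noteq> [] \<Longrightarrow> \<forall>(n, g)\<in>set ws. g \<in> carrier \<Gamma> \<and> l g \<le> R \<and> int (K * (R + 1)) \<le> \<bar>n\<bar> \<Longrightarrow>
     \<forall>(n, g)\<in>set (butlast ws). g \<otimes>\<^bsub>\<Gamma>\<^esub> \<psi> c \<noteq> \<psi> c \<otimes>\<^bsub>\<Gamma>\<^esub> g \<Longrightarrow> power_word \<Gamma> (\<psi> c) ws \<noteq> \<one>\<^bsub>\<Gamma>\<^esub>"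
    using l(2) unfolding big_powers_def by blast
  have "power_word G c ws \<noteq> \<one>"
    if ws: "ws \<noteq> []" and all: "\<forall>(n, g)\<in>set ws. g \<in> S \<and> l (\<psi> g) \<le> R \<and> int (K * (R + 1)) \<le> \<bar>n\<bar>"
      and nc: "\<forall>(n, g)\<in>set (butlast ws). g \<otimes> c \<noteq> c \<otimes> g" for R ws
  proof
    assume eq: "power_word G c ws = \<one>"
    define B where "B = int (K * (R + 1))"
    have all': "b \<in> S" "l (\<psi> b) \<le> R" "B \<le> \<bar>a\<bar>" if "(a, b) \<in> set ws" for a b using all that by (auto simp: B_def)
    have "\<forall>(n, g)\<in>set ws. g \<in> carrier (G\<lparr>carrier := S\<rparr>)" using all' by auto
    then have "power_word \<Gamma> (\<psi> c) (map (\<lambda>(n, g). (n, \<psi> g)) ws) = \<psi> (power_word (G\<lparr>carrier := S\<rparr>) c ws)"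
      using hom_power_word[OF GS \<Gamma> \<psi>(1), of c ws] c by simp
    then have "power_word \<Gamma> (\<psi> c) (map (\<lambda>(n, g). (n, \<psi> g)) ws) = \<one>\<^bsub>\<Gamma>\<^esub>"
      using power_word_consistent[OF S c] eq one by simp
    moreover have "power_word \<Gamma> (\<psi> c) (map (\<lambda>(n, g). (n, \<psi> g)) ws) \<noteq> \<one>\<^bsub>\<Gamma>\<^esub>"
    proof (rule K[of _ R])
      show "map (\<lambda>(n, g). (n, \<psi> g)) ws \<noteq> []" using ws by simp
      show "\<forall>(n, g)\<in>set (map (\<lambda>(n, g). (n, \<psi> g)) ws). g \<in> carrier \<Gamma> \<and> l g \<le> R \<and> int (K * (R + 1)) \<le> \<bar>n\<bar>"
        unfolding B_def[symmetric] using all' cl by auto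
      have "\<psi> b \<otimes>\<^bsub>\<Gamma>\<^esub> \<psi> c \<noteq> \<psi> c \<otimes>\<^bsub>\<Gamma>\<^esub> \<psi> b" if ab: "(a, b) \<in> set (butlast ws)" for a b
      proof
        have b: "b \<in> S" using all'(1)[OF in_set_butlastD[OF ab]] .
        assume "\<psi> b \<otimes>\<^bsub>\<Gamma>\<^esub> \<psi> c = \<psi> c \<otimes>\<^bsub>\<Gamma>\<^esub> \<psi> b"
        then have "\<psi> (b \<otimes> c) = \<psi> (c \<otimes> b)" using mult b c by simp
        then have "b \<otimes> c = c \<otimes> b" using \<psi>(2) b c subgroup.m_closed[OF S] by (auto dest: inj_onD)
        then show False using nc ab by auto
      qed
      then show "\<forall>(n, g)\<in>set (butlast (map (\<lambda>(n, g). (n, \<psi> g)) ws)). g \<otimes>\<^bsub>\<Gamma>\<^esub> \<psi> c \<noteq> \<psi> c \<otimes>\<^bsub>\<Gamma>\<^esub> g"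
        by (auto simp: map_butlast[symmetric])
    qed
    ultimately show False by simp
  qed
  then have "big_powers G S (\<lambda>x. l (\<psi> x)) c" unfolding big_powers_def by blast
  then show ?thesis using n unfolding has_big_powers_def by blast
qed

lemma (in group) csa_consistent:
  assumes S: "subgroup S G" and csa: "csa (G\<lparr>carrier := S\<rparr>) S"
  shows "csa G S"
  unfolding csa_def
proof (intro conjI ballI impI)
  fix x y z assume "x \<in> S" "y \<in> S" "z \<in> S" "y \<noteq> \<one>" "x \<otimes> y = y \<otimes> x" "y \<otimes> z = z \<otimes> y"
  then show "x \<otimes> z = z \<otimes> x"
    using conjunct1[OF csa[unfolded csa_def], rule_format, of x y z] by simp
next
  fix x g assume "x \<in> S" "g \<in> S" "x \<noteq> \<one>" "(g \<otimes> x \<otimes> inv g) \<otimes> x = x \<otimes> (g \<otimes> x \<otimes> inv g)"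
  then show "g \<otimes> x = x \<otimes> g"
    using conjunct2[OF csa[unfolded csa_def], rule_format, of x g] m_inv_consistent[OF S, of g] by simp
qed

lemma extension_step:
  fixes M :: "'b monoid" (structure) and \<Gamma> :: "('c, 'n) monoid_scheme"
  assumes M: "group M" and SG: "subgroup SG M" and SH: "subgroup SH M" and sub: "SG \<subseteq> SH"
    and ext: "centralizer_ext (M\<lparr>carrier := SG\<rparr>) u m (M\<lparr>carrier := SH\<rparr>) id"
    and \<Gamma>: "group \<Gamma>" "torsion_free \<Gamma>" "csa \<Gamma> (carrier \<Gamma>)"
      "\<And>c. c \<in> carrier \<Gamma> \<Longrightarrow> c \<noteq> \<one>\<^bsub>\<Gamma>\<^esub> \<Longrightarrow> has_big_powers \<Gamma> (carrier \<Gamma>) c"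
    and disc: "discriminated (M\<lparr>carrier := SG\<rparr>) \<Gamma>"
    and nonab: "\<exists>x\<in>SG. \<exists>y\<in>SG. x \<otimes> y \<noteq> y \<otimes> x"
    and IH: "\<And>c. c \<in> SG \<Longrightarrow> c \<noteq> \<one> \<Longrightarrow> rank_one M SG c \<Longrightarrow> has_big_powers M SG c"
  shows "discriminated (M\<lparr>carrier := SH\<rparr>) \<Gamma> \<and>
    (\<forall>c\<in>SH. c \<noteq> \<one> \<longrightarrow> rank_one M SH c \<longrightarrow> has_big_powers M SH c)"
proof -
  interpret M: group M by (rule M)
  define C where "C = centralizer (M\<lparr>carrier := SG\<rparr>) u"
  have C: "C = {g \<in> SG. g \<otimes> u = u \<otimes> g}" by (simp add: C_def centralizer_def)
  have grp: "group (M\<lparr>carrier := SG\<rparr>)" and uS: "u \<in> SG"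
    and comm: "comm_group (M\<lparr>carrier := C\<rparr>)"
    using ext by (auto simp: centralizer_ext_def C_def)
  obtain j where j: "is_amalgam (M\<lparr>carrier := SG\<rparr>) (ext_factor (M\<lparr>carrier := SG\<rparr>) C m) C id (\<lambda>c. (c, \<lambda>_. 0)) (M\<lparr>carrier := SH\<rparr>) id j"
    using ext unfolding centralizer_ext_def C_def by blast
  interpret ce: centralizer_extension "M\<lparr>carrier := SG\<rparr>" M u m SH id j
    using grp uS SH j M by (simp add: centralizer_extension_def centralizer_extension_axioms_def C_def)
  have e1: "id ` carrier (M\<lparr>carrier := SG\<rparr>) = SG" and e2: "id ` centralizer (M\<lparr>carrier := SG\<rparr>) u = C"
    by (simp_all add: C_def)
  define T where "T = ce.st ` ce.V"
  have split: "splitting M SG T C" using ce.splitting_axioms unfolding e1 e2 T_def .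
  interpret sp: splitting M SG T C by (rule split)
  have H: "sp.H = SH" using ce.H_eq unfolding e1 e2 T_def .
  \<comment> \<open>Otherwise the centralizer would be the whole nonabelian group, against its
    commutativity.\<close>
  have u1: "u \<noteq> \<one>"
  proof
    assume "u = \<one>"
    then have "g \<otimes> u = u \<otimes> g" if "g \<in> SG" for g using sp.G_simps(1)[OF that] by simp
    then have "C = SG" unfolding C by blast
    moreover obtain x y where xy: "x \<in> SG" "y \<in> SG" "x \<otimes> y \<noteq> y \<otimes> x" using nonab by blast
    moreover have "comm_monoid (M\<lparr>carrier := C\<rparr>)" using comm by (simp only: comm_group_def)
    ultimately show False using comm_monoid.m_comm[of "M\<lparr>carrier := C\<rparr>" x y] by simp
  qed
  have red_eq: "red_word M (id ` carrier (M\<lparr>carrier := SG\<rparr>)) (ce.st ` ce.V) (id ` centralizer (M\<lparr>carrier := SG\<rparr>) u) = red_word M SG T C"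
    unfolding e1 e2 T_def ..
  \<comment> \<open>Both groups are subgroups of \<open>M\<close>, so \<open>id\<close> is the
    embedding into the type of the amalgam.\<close>
  have wd: "\<exists>\<psi>\<in>hom (M\<lparr>carrier := SH\<rparr>) \<Gamma>. \<forall>(w0, vws)\<in>W. \<psi> (w0 \<otimes> syl_prod M (ce.lift vws)) \<noteq> \<one>\<^bsub>\<Gamma>\<^esub>"
    if "finite W" "\<And>w0 vws. (w0, vws) \<in> W \<Longrightarrow> w0 \<in> SG \<and> ce.good_word vws \<and> (vws = [] \<longrightarrow> w0 \<noteq> \<one>)" for W
    using ce.word_discrimination[OF \<Gamma>(1,4) disc, of id W] u1 that by simp
  have lift: "\<exists>vws. ws = ce.lift vws \<and> ce.good_word vws" if "sp.red ws" for ws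
    using ce.red_lift[of ws] that unfolding red_eq by blast
  have HG: "group (M\<lparr>carrier := SH\<rparr>)" by (rule subgroup.subgroup_is_group[OF SH M])
  have disc_H: "discriminated (M\<lparr>carrier := SH\<rparr>) \<Gamma>"
    unfolding discriminated_def
  proof (intro allI impI)
    fix Y assume Y: "finite Y" "Y \<subseteq> carrier (M\<lparr>carrier := SH\<rparr>)" "\<one>\<^bsub>M\<lparr>carrier := SH\<rparr>\<^esub> \<notin> Y"
    have "\<exists>w0 vws. w0 \<in> SG \<and> ce.good_word vws \<and> (vws = [] \<longrightarrow> w0 \<noteq> \<one>) \<and> h = w0 \<otimes> syl_prod M (ce.lift vws)"
      if h: "h \<in> Y" for h
    proof -
      have "h \<in> sp.H" using h Y H by auto
      then obtain w0 ws where w: "w0 \<in> SG" "sp.red ws" "h = w0 \<otimes> syl_prod M ws" using sp.exists_red by blast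
      then obtain vws where v: "ws = ce.lift vws" "ce.good_word vws" using lift by blast
      have "vws = [] \<longrightarrow> w0 \<noteq> \<one>" using w v h Y by (auto simp: ce.lift_def)
      then show ?thesis using w v by blast
    qed
    then obtain a b where ab: "\<And>h. h \<in> Y \<Longrightarrow> a h \<in> SG \<and> ce.good_word (b h) \<and> (b h = [] \<longrightarrow> a h \<noteq> \<one>) \<and>
        h = a h \<otimes> syl_prod M (ce.lift (b h))" by metis
    have ab1: "a h \<in> SG \<and> ce.good_word (b h) \<and> (b h = [] \<longrightarrow> a h \<noteq> \<one>)" if "h \<in> Y" for h
      using ab[OF that] by (elim conjE) (intro conjI)
    have ab2: "h = a h \<otimes> syl_prod M (ce.lift (b h))" if "h \<in> Y" for h
      using ab[OF that] by (elim conjE)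
    have WY: "w0 \<in> SG \<and> ce.good_word vws \<and> (vws = [] \<longrightarrow> w0 \<noteq> \<one>)"
      if "(w0, vws) \<in> (\<lambda>h. (a h, b h)) ` Y" for w0 vws
      using that ab1 by auto
    obtain \<psi> where \<psi>: "\<psi> \<in> hom (M\<lparr>carrier := SH\<rparr>) \<Gamma>"
      "\<forall>(w0, vws)\<in>(\<lambda>h. (a h, b h)) ` Y. \<psi> (w0 \<otimes> syl_prod M (ce.lift vws)) \<noteq> \<one>\<^bsub>\<Gamma>\<^esub>"
      using wd[OF finite_imageI[OF Y(1)] WY] by blast
    have "\<psi> h \<noteq> \<one>\<^bsub>\<Gamma>\<^esub>" if h: "h \<in> Y" for h
    proof -
      have "\<psi> (a h \<otimes> syl_prod M (ce.lift (b h))) \<noteq> \<one>\<^bsub>\<Gamma>\<^esub>" using \<psi>(2) h by auto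
      then show ?thesis using arg_cong[OF ab2[OF h], of \<psi>] by (simp only: not_False_eq_True)
    qed
    then show "\<exists>\<psi>\<in>hom (M\<lparr>carrier := SH\<rparr>) \<Gamma>. \<forall>x\<in>Y. \<psi> x \<noteq> \<one>\<^bsub>\<Gamma>\<^esub>" using \<psi>(1) by blast
  qed
  have csaH: "csa M SH"
    using discriminated_csa[OF HG \<Gamma>(1) disc_H \<Gamma>(3)] by (intro M.csa_consistent[OF SH]) simp
  have tfH: "h [^] k \<noteq> \<one>" if "h \<in> SH" "h \<noteq> \<one>" "k > 0" for h and k :: nat
    using discriminated_torsion_free[OF HG \<Gamma>(1) disc_H \<Gamma>(2)] that M.nat_pow_consistent[of h k SH]
    unfolding torsion_free_def by simp
  have nf: "w0 \<otimes> syl_prod M ws \<noteq> \<one>" if w: "w0 \<in> SG" "sp.red ws" "ws \<noteq> []" for w0 ws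
  proof
    assume eq: "w0 \<otimes> syl_prod M ws = \<one>"
    obtain vws where v: "ws = ce.lift vws" "ce.good_word vws" using lift[OF w(2)] by blast
    have "vws \<noteq> []" using v w by (auto simp: ce.lift_def)
    then obtain \<psi> where \<psi>: "\<psi> \<in> hom (M\<lparr>carrier := SH\<rparr>) \<Gamma>" "\<psi> (w0 \<otimes> syl_prod M (ce.lift vws)) \<noteq> \<one>\<^bsub>\<Gamma>\<^esub>"
      using wd[of "{(w0, vws)}"] w v by auto
    then show False using eq v hom_one[OF \<psi>(1) HG \<Gamma>(1)] by simp
  qed
  \<comment> \<open>\<open>c\<close> and its conjugate both commute with \<open>u\<close>, hence
    with each other; the CSA property makes \<open>w\<close> commute with \<open>c\<close> and then,
    by transitivity, with \<open>u\<close>.\<close>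
  have mal: "c = \<one>" if w: "w \<in> SG" "w \<notin> C" and c: "c \<in> C" and d: "inv w \<otimes> (c \<otimes> w) \<in> C" for w c
  proof (rule ccontr)
    assume c1: "c \<noteq> \<one>"
    define g where "g = inv w"
    define d' where "d' = g \<otimes> c \<otimes> inv g"
    have cG: "c \<in> SG" using sp.C_simps(1)[OF c] .
    have wM: "w \<in> carrier M" "c \<in> carrier M" using sp.G_simps(1)[OF w(1)] sp.G_simps(1)[OF cG] .
    have eq: "d' = inv w \<otimes> (c \<otimes> w)" using wM by (simp add: d'_def g_def M.m_assoc)
    have d': "d' \<in> C" using d unfolding eq .
    have inS: "g \<in> SH" "w \<in> SH" "c \<in> SH" "d' \<in> SH" "u \<in> SH"
      using sp.G_simps(4)[OF w(1)] w(1) cG sp.C_simps(1)[OF d'] uS sub unfolding g_def by blast+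
    have cu: "c \<otimes> u = u \<otimes> c" "d' \<otimes> u = u \<otimes> d'" using c d' unfolding C by blast+
    note ct = conjunct1[OF csaH[unfolded csa_def], rule_format]
    have "d' \<otimes> c = c \<otimes> d'" using ct[OF inS(4) inS(5) inS(3) u1 cu(2) cu(1)[symmetric]] .
    then have "g \<otimes> c = c \<otimes> g"
      unfolding d'_def by (rule conjunct2[OF csaH[unfolded csa_def], rule_format, OF inS(3) inS(1) c1])
    then have "w \<otimes> c = c \<otimes> w" using M.commute_inv[of g c] wM by (simp add: g_def)
    then have "w \<otimes> u = u \<otimes> w" using ct[OF inS(2) inS(3) inS(5) c1 _ cu(1)] by blast
    then show False using w C by blast
  qed
  interpret ac: amalgam_csa M SG T C
    using nf mal csaH H by unfold_locales auto
  have "has_big_powers M SH c" if c: "c \<in> SH" "c \<noteq> \<one>" "rank_one M SH c" for c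
  proof (cases "\<exists>t0\<in>T. t0 \<noteq> \<one>")
    case True
    then obtain t0 where t0: "t0 \<in> T" "t0 \<noteq> \<one>" by blast
    show ?thesis
      using ac.big_powers_step[OF uS u1 C _ t0 IH, of c] tfH c unfolding H by blast
  next
    \<comment> \<open>All stable letters are trivial, as in an extension of rank 0, and the group
      does not grow.\<close>
    case False
    have "SH \<subseteq> SG" unfolding H[symmetric] sp.H_def
      using False by (intro M.generate_subgroup_incl[OF _ SG]) auto
    then have "SH = SG" using sub by blast
    then show ?thesis using IH c by simp
  qed
  then show ?thesis using disc_H by blast
qed

theorem iterated_ext_big_powers:
  fixes \<Gamma> :: "('a, 'm) monoid_scheme" and G :: "'b monoid" (structure)
  assumes it: "iterated_ext \<Gamma> G" and nonab: "non_abelian \<Gamma>"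
    and \<Gamma>: "group \<Gamma>" "torsion_free \<Gamma>" "csa \<Gamma> (carrier \<Gamma>)"
      "\<And>c. c \<in> carrier \<Gamma> \<Longrightarrow> c \<noteq> \<one>\<^bsub>\<Gamma>\<^esub> \<Longrightarrow> has_big_powers \<Gamma> (carrier \<Gamma>) c"
  shows "non_abelian G \<and> torsion_free G \<and>
    (\<forall>c\<in>carrier G. c \<noteq> \<one> \<longrightarrow> rank_one G (carrier G) c \<longrightarrow> has_big_powers G (carrier G) c)"
proof -
  obtain Ss :: "'b set list" where G: "group G" and Ss: "Ss \<noteq> []" "\<And>l. l < length Ss \<Longrightarrow> subgroup (Ss ! l) G"
    "last Ss = carrier G" "\<Gamma> \<cong> G\<lparr>carrier := hd Ss\<rparr>"
    and ch: "\<And>l. Suc l < length Ss \<Longrightarrow> Ss ! l \<subseteq> Ss ! Suc l \<and>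
           (\<exists>u m. centralizer_ext (G\<lparr>carrier := Ss ! l\<rparr>) u m (G\<lparr>carrier := Ss ! Suc l\<rparr>) id)"
    using it unfolding iterated_ext_def by blast
  interpret G: group G by (rule G)
  obtain f where f: "f \<in> iso \<Gamma> (G\<lparr>carrier := hd Ss\<rparr>)" using Ss(4) by (auto simp: is_iso_def)
  define \<psi> where "\<psi> = inv_into (carrier \<Gamma>) f"
  have \<psi>: "\<psi> \<in> iso (G\<lparr>carrier := hd Ss\<rparr>) \<Gamma>" unfolding \<psi>_def by (rule group.iso_set_sym[OF \<Gamma>(1) f])
  have S0: "subgroup (hd Ss) G" using Ss(1) Ss(2)[of 0] by (simp add: hd_conv_nth)
  have \<psi>h: "\<psi> \<in> hom (G\<lparr>carrier := hd Ss\<rparr>) \<Gamma>" "inj_on \<psi> (hd Ss)" using \<psi> by (auto simp: iso_def bij_betw_def)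
  have G0: "group (G\<lparr>carrier := hd Ss\<rparr>)" by (rule subgroup.subgroup_is_group[OF S0 G])
  have \<psi>1: "\<psi> \<one> = \<one>\<^bsub>\<Gamma>\<^esub>" using hom_one[OF \<psi>h(1) G0 \<Gamma>(1)] by simp
  have \<psi>ne: "\<psi> x \<noteq> \<one>\<^bsub>\<Gamma>\<^esub>" if "x \<in> hd Ss" "x \<noteq> \<one>" for x
    using \<psi>h(2) \<psi>1 that subgroup.one_closed[OF S0] by (metis inj_onD)
  obtain x y where xy: "x \<in> carrier \<Gamma>" "y \<in> carrier \<Gamma>" "x \<otimes>\<^bsub>\<Gamma>\<^esub> y \<noteq> y \<otimes>\<^bsub>\<Gamma>\<^esub> x"
    using nonab unfolding non_abelian_def by blast
  have fxy: "f x \<in> hd Ss" "f y \<in> hd Ss" "f x \<otimes> f y \<noteq> f y \<otimes> f x"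
  proof -
    have fh: "f \<in> hom \<Gamma> (G\<lparr>carrier := hd Ss\<rparr>)" "inj_on f (carrier \<Gamma>)" using f by (auto simp: iso_def bij_betw_def)
    show "f x \<in> hd Ss" "f y \<in> hd Ss" using fh xy by (auto simp: hom_def)
    have "f (x \<otimes>\<^bsub>\<Gamma>\<^esub> y) \<noteq> f (y \<otimes>\<^bsub>\<Gamma>\<^esub> x)"
      using fh(2) xy group.is_monoid[OF \<Gamma>(1)] by (metis inj_onD monoid.m_closed)
    then show "f x \<otimes> f y \<noteq> f y \<otimes> f x" using fh(1) xy by (auto simp: hom_def)
  qed
  \<comment> \<open>\<open>hd Ss \<subseteq> S\<close> is carried along because the noncommuting
    pair that excludes \<open>u = \<one>\<close> comes from the bottom group.\<close>
  let ?Q = "\<lambda>S. hd Ss \<subseteq> S \<and> discriminated (G\<lparr>carrier := S\<rparr>) \<Gamma> \<and>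
     (\<forall>c\<in>S. c \<noteq> \<one> \<longrightarrow> rank_one G S c \<longrightarrow> has_big_powers G S c)"
  have "l < length Ss \<Longrightarrow> ?Q (Ss ! l)" for l
  proof (induction l)
    case 0
    have hd: "Ss ! 0 = hd Ss" using Ss(1) by (simp add: hd_conv_nth)
    have "discriminated (G\<lparr>carrier := hd Ss\<rparr>) \<Gamma>"
      unfolding discriminated_def
    proof (intro allI impI)
      fix Y assume "finite Y" "Y \<subseteq> carrier (G\<lparr>carrier := hd Ss\<rparr>)" "\<one>\<^bsub>G\<lparr>carrier := hd Ss\<rparr>\<^esub> \<notin> Y"
      then show "\<exists>\<psi>\<in>hom (G\<lparr>carrier := hd Ss\<rparr>) \<Gamma>. \<forall>x\<in>Y. \<psi> x \<noteq> \<one>\<^bsub>\<Gamma>\<^esub>"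
        using \<psi>h(1) \<psi>ne by (intro bexI[of _ \<psi>]) auto
    qed
    moreover have "has_big_powers G (hd Ss) c" if "c \<in> hd Ss" "c \<noteq> \<one>" for c
    proof (rule G.has_big_powers_embed[OF S0 \<Gamma>(1) \<psi>h that(1)])
      have "\<psi> c \<in> carrier \<Gamma>" using \<psi>h(1) that by (auto simp: hom_def)
      then show "has_big_powers \<Gamma> (carrier \<Gamma>) (\<psi> c)" using \<Gamma>(4) \<psi>ne[OF that] by blast
    qed
    ultimately show ?case unfolding hd by blast
  next
    case (Suc l)
    then have Q: "?Q (Ss ! l)" by simp
    obtain u m where ext: "centralizer_ext (G\<lparr>carrier := Ss ! l\<rparr>) u m (G\<lparr>carrier := Ss ! Suc l\<rparr>) id"
      and sub: "Ss ! l \<subseteq> Ss ! Suc l" using ch[OF Suc.prems] by blast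
    have "\<exists>x\<in>Ss ! l. \<exists>y\<in>Ss ! l. x \<otimes> y \<noteq> y \<otimes> x" using fxy Q by blast
    then have "discriminated (G\<lparr>carrier := Ss ! Suc l\<rparr>) \<Gamma> \<and>
      (\<forall>c\<in>Ss ! Suc l. c \<noteq> \<one> \<longrightarrow> rank_one G (Ss ! Suc l) c \<longrightarrow> has_big_powers G (Ss ! Suc l) c)"
      using Q Suc.prems by (intro extension_step[OF G Ss(2) Ss(2) sub ext \<Gamma>]) auto
    then show ?case using Q sub by blast
  qed
  from this[of "length Ss - 1"] have Q: "?Q (carrier G)" using Ss(1,3) by (simp add: last_conv_nth)
  have "discriminated G \<Gamma>" using Q by simp
  then have "torsion_free G" by (rule discriminated_torsion_free[OF G \<Gamma>(1) _ \<Gamma>(2)])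
  moreover have "non_abelian G" using fxy Q unfolding non_abelian_def by blast
  ultimately show ?thesis using Q by blast
qed

lemma (in group) cyclic_rank_one:
  assumes u: "u \<in> carrier G" and cyc: "cyclic_subset G (centralizer G u)"
  shows "rank_one G (carrier G) u"
  unfolding rank_one_def
proof (intro ballI impI)
  obtain e where e: "e \<in> carrier G" "centralizer G u = {e [^] (k::int) | k. True}"
    using cyc unfolding cyclic_subset_def by blast
  fix x y assume "x \<in> carrier G" "y \<in> carrier G" and ne: "x \<noteq> \<one>" "y \<noteq> \<one>" and "x \<otimes> u = u \<otimes> x" "y \<otimes> u = u \<otimes> y"
  then have "x \<in> centralizer G u" "y \<in> centralizer G u" by (auto simp: centralizer_def)
  then obtain a b :: int where ab: "x = e [^] a" "y = e [^] b" unfolding e(2) by blast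
  then have "a \<noteq> 0" "b \<noteq> 0" using ne by auto
  moreover have "x [^] b = y [^] a" using ab e(1) by (simp add: int_pow_pow mult.commute)
  ultimately show "\<exists>(a::int) (b::int). a \<noteq> 0 \<and> b \<noteq> 0 \<and> x [^] a = y [^] b" by blast
qed

section \<open>The complexity bound\<close>

lemma hyperbolic_big_powers:
  assumes "hyperbolic_group \<Gamma>" "torsion_free \<Gamma>"
  shows "group \<Gamma> \<and> csa \<Gamma> (carrier \<Gamma>) \<and>
    (\<forall>c\<in>carrier \<Gamma>. c \<noteq> \<one>\<^bsub>\<Gamma>\<^esub> \<longrightarrow> has_big_powers \<Gamma> (carrier \<Gamma>) c)"
proof -
  obtain T \<delta> where "hyp_group \<Gamma> (\<lambda>g. real (word_len \<Gamma> T g)) \<delta>" using hyperbolic_group_hyp_group[OF assms] by blast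
  then interpret hyp_group \<Gamma> "\<lambda>g. real (word_len \<Gamma> T g)" \<delta> .
  have "group_norm \<Gamma> (carrier \<Gamma>) (word_len \<Gamma> T)"
    using L_one L_inv L_mult unfolding group_norm_def by (auto simp flip: of_nat_add)
  then have "has_big_powers \<Gamma> (carrier \<Gamma>) c" if "c \<in> carrier \<Gamma>" "c \<noteq> \<one>\<^bsub>\<Gamma>\<^esub>" for c
    using big_powers_carrier[OF that, of "word_len \<Gamma> T"] unfolding has_big_powers_def by auto
  then show ?thesis using csa_carrier is_group by blast
qed

lemma (in fg_group) word_len_power_word:
  assumes u: "u \<in> carrier G"
  shows "\<forall>(n, g)\<in>set ns. g \<in> carrier G \<Longrightarrow>
    word_len G T (power_word G u ns) \<le> sum_list (map (\<lambda>(n, g). nat \<bar>n\<bar> * word_len G T u + word_len G T g) ns)"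
proof (induction ns)
  case (Cons p ns)
  obtain n g where p: "p = (n, g)" by fastforce
  have g: "g \<in> carrier G" "u [^] n \<in> carrier G" "power_word G u ns \<in> carrier G"
    using Cons.prems p u by (auto intro!: power_word_carrier)
  have "word_len G T (u [^] n \<otimes> g \<otimes> power_word G u ns) \<le> word_len G T (u [^] n \<otimes> g) + word_len G T (power_word G u ns)"
    "word_len G T (u [^] n \<otimes> g) \<le> word_len G T (u [^] n) + word_len G T g"
    using g by (auto intro!: word_len_mult)
  then show ?case using Cons p word_len_pow[OF u, of n] by fastforce
qed simp

text \<open>The balls of a finite group stabilize, so the complexity takes finitely many values,
  whatever value \<open>LEAST\<close> returns when no discriminating map exists.\<close>

lemma disc_complexity_bounded:
  assumes "finite (carrier G')"
  shows "\<exists>K. \<forall>R. disc_complexity G' S G T R \<le> K"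
proof -
  obtain N where N: "\<And>g. g \<in> carrier G' \<Longrightarrow> word_len G' S g \<le> N"
    using finite_bounded[OF assms, of "word_len G' S"] by blast
  have "disc_complexity G' S G T R = disc_complexity G' S G T (min R N)" for R
  proof -
    have "word_len G' S g \<le> R \<longleftrightarrow> word_len G' S g \<le> min R N" if "g \<in> carrier G'" for g using N[OF that] by auto
    then have "(\<forall>g\<in>carrier G'. word_len G' S g \<le> R \<and> g \<noteq> \<one>\<^bsub>G'\<^esub> \<longrightarrow> \<phi> g \<noteq> \<one>\<^bsub>G\<^esub>) \<longleftrightarrow>
      (\<forall>g\<in>carrier G'. word_len G' S g \<le> min R N \<and> g \<noteq> \<one>\<^bsub>G'\<^esub> \<longrightarrow> \<phi> g \<noteq> \<one>\<^bsub>G\<^esub>)" for \<phi> by blast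
    then show ?thesis unfolding disc_complexity_def by simp
  qed
  moreover obtain K where "\<And>R. R \<in> {..N} \<Longrightarrow> disc_complexity G' S G T R \<le> K"
    using finite_bounded[of "{..N}" "disc_complexity G' S G T"] by blast
  ultimately show ?thesis by (metis atMost_iff min.cobounded2)
qed

lemma infinite_embedding:
  assumes "countable A" "infinite (UNIV :: 'b set)"
  obtains e :: "'a \<Rightarrow> 'b" where "inj_on e A"
proof -
  obtain f :: "nat \<Rightarrow> 'b" where f: "inj f" using iffD1[OF infinite_iff_countable_subset assms(2)] by blast
  have "inj_on (\<lambda>a. f (to_nat_on A a)) A"
    using comp_inj_on[OF inj_on_to_nat_on[OF assms(1)] inj_on_subset[OF f subset_UNIV]] by (simp add: comp_def)
  then show ?thesis using that by blast
qed

context centralizer_extension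
begin

text \<open>The retraction sending only the k-th stable letter to \<open>u\<close> recovers the k-th
  coordinate, as \<open>u\<close> has infinite order. Hence a norm on Z^n can be read on the stable
  letters.\<close>

lemma st_inj:
  assumes tf: "torsion_free G" and u1: "u \<noteq> \<one>\<^bsub>G\<^esub>" and e: "inj_on (e :: 'g \<Rightarrow> 'h) (carrier G)"
  shows "inj_on st V"
proof (rule inj_onI)
  fix v w assume v: "v \<in> V" and w: "w \<in> V" and eq: "st v = st w"
  have "v k = w k" for k
  proof (cases "k < m")
    case True
    define p :: "nat \<Rightarrow> int" where "p = (\<lambda>k'. if k' = k then 1 else 0)"
    have pair: "pair p x = x k" for x using True by (simp add: pair_def p_def if_distrib cong: if_cong)
    obtain \<phi> where "\<And>v. v \<in> V \<Longrightarrow> \<phi> (st v) = u [^]\<^bsub>G\<^esub> pair p v" using retraction[OF e, of p] by blast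
    then have "u [^]\<^bsub>G\<^esub> v k = u [^]\<^bsub>G\<^esub> w k" using v w eq pair by metis
    then have "u [^]\<^bsub>G\<^esub> (v k - w k) = \<one>\<^bsub>G\<^esub>" using u by (simp add: G.int_pow_diff)
    then have "u [^]\<^bsub>G\<^esub> \<bar>v k - w k\<bar> = \<one>\<^bsub>G\<^esub>" using G.int_pow_neg[of u "v k - w k"] u by (auto simp: abs_if)
    then have "u [^]\<^bsub>G\<^esub> nat \<bar>v k - w k\<bar> = \<one>\<^bsub>G\<^esub>" using int_pow_int[of G u "nat \<bar>v k - w k\<bar>"] by simp
    then have "\<not> 0 < nat \<bar>v k - w k\<bar>" using tf u u1 unfolding torsion_free_def by blast
    then show ?thesis by simp
  next
    case False
    then show ?thesis using v w by (simp add: V_def)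
  qed
  then show "v = w" by blast
qed

end

theorem disc_complexity_dominated:
  fixes G :: "'b monoid" (structure) and G' :: "'c monoid"
  assumes inf: "infinite (UNIV :: 'c set)" and tf: "torsion_free G" and nonab: "non_abelian G"
    and bp: "\<And>c. c \<in> carrier G \<Longrightarrow> c \<noteq> \<one> \<Longrightarrow> rank_one G (carrier G) c \<Longrightarrow> has_big_powers G (carrier G) c"
    and ext: "cyclic_centralizer_ext G n G'" and S: "fin_gen_set G' S" and T: "fin_gen_set G T"
  shows "dominated (disc_complexity G' S G T) (\<lambda>R. R ^ n)"
proof -
  obtain u i j where cyc: "cyclic_subset G (centralizer G u)" and G: "group G" and u: "u \<in> carrier G"
    and comm: "comm_group (G\<lparr>carrier := centralizer G u\<rparr>)"
    and am: "is_amalgam G (ext_factor G (centralizer G u) n) (centralizer G u) id (\<lambda>c. (c, \<lambda>_. 0)) G' i j"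
    using ext unfolding cyclic_centralizer_ext_def centralizer_ext_def by blast
  interpret G: fg_group G T using G T by (simp add: fg_group_def fg_group_axioms_def)
  have G': "group G'" using am by (simp add: is_amalgam_def)
  interpret G': fg_group G' S using G' S by (simp add: fg_group_def fg_group_axioms_def)
  interpret ce: centralizer_extension G G' u n "carrier G'" i j
    using G G' u am by (simp add: centralizer_extension_def centralizer_extension_axioms_def G'.subgroup_self)
  obtain e :: "'b \<Rightarrow> 'c" where e: "inj_on e (carrier G)" using infinite_embedding[OF G.countable_carrier inf] by blast
  have u1: "u \<noteq> \<one>"
  proof
    assume "u = \<one>"
    then have "centralizer G u = carrier G" by (auto simp: centralizer_def)
    moreover have "comm_monoid (G\<lparr>carrier := centralizer G u\<rparr>)" using comm by (simp only: comm_group_def)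
    ultimately have "x \<otimes> y = y \<otimes> x" if "x \<in> carrier G" "y \<in> carrier G" for x y
      using comm_monoid.m_comm[of G x y] that by simp
    then show False using nonab unfolding non_abelian_def by blast
  qed
  obtain l where l: "group_norm G (carrier G) l" "big_powers G (carrier G) l u"
    using bp[OF u u1 G.cyclic_rank_one[OF u cyc]] unfolding has_big_powers_def by blast
  obtain K0 where K0: "\<And>R ws h. h \<in> carrier G \<Longrightarrow> l h \<le> R \<Longrightarrow> ws \<noteq> [] \<Longrightarrow>
     \<forall>(n, g)\<in>set ws. g \<in> carrier G \<and> l g \<le> R \<and> int (K0 * (R + 1)) \<le> \<bar>n\<bar> \<Longrightarrow>
     \<forall>(n, g)\<in>set (butlast ws). g \<otimes> u \<noteq> u \<otimes> g \<Longrightarrow> h \<otimes> power_word G u ws \<noteq> \<one>"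
    using G.big_powers_open[OF G.subgroup_self l(1) u l(2)] by blast
  \<comment> \<open>With all exponents 0 the retraction kills the stable letters. It inverts
    \<open>i\<close> and so carries the norm of \<open>G\<close> to its image in the
    amalgam.\<close>
  obtain \<phi>0 where "\<phi>0 \<in> hom (G'\<lparr>carrier := carrier G'\<rparr>) G" and \<phi>0i: "\<And>x. x \<in> carrier G \<Longrightarrow> \<phi>0 (i x) = x"
    using ce.retraction[OF e, of "\<lambda>_. 0"] by blast
  then have "group_hom G' G \<phi>0" using G G' by (simp add: group_hom_def group_hom_axioms_def)
  then interpret \<phi>0: group_hom G' G \<phi>0 .
  define lG where "lG = (\<lambda>x. l (\<phi>0 x))"
  have nG: "group_norm G' (i ` carrier G) lG"
    using l(1) unfolding group_norm_def lG_def by auto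
  define nv where "nv = (\<lambda>v :: nat \<Rightarrow> int. nat (\<Sum>k<n. \<bar>v k\<bar>))"
  define lT where "lT = (\<lambda>t. nv (inv_into ce.V ce.st t))"
  have lT: "lT (ce.st v) = nv v" if "v \<in> ce.V" for v
    using that inv_into_f_f[OF ce.st_inj[OF tf u1 e]] by (simp add: lT_def)
  have nT: "group_norm G' (ce.st ` ce.V) lT"
    unfolding group_norm_def
  proof (intro conjI ballI)
    show "lT \<one>\<^bsub>G'\<^esub> = 0" using lT[OF ce.V_zero] ce.st_zero by (simp add: nv_def)
    show "lT (inv\<^bsub>G'\<^esub> t) = lT t" if t: "t \<in> ce.st ` ce.V" for t
    proof -
      obtain v where v: "v \<in> ce.V" "t = ce.st v" using t by blast
      then show ?thesis using lT[OF v(1)] lT[OF ce.V_neg[OF v(1)]] ce.st_neg[OF v(1)] by (simp add: nv_def)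
    qed
    show "lT (s \<otimes>\<^bsub>G'\<^esub> t) \<le> lT s + lT t" if st: "s \<in> ce.st ` ce.V" "t \<in> ce.st ` ce.V" for s t
    proof -
      obtain v w where v: "v \<in> ce.V" "s = ce.st v" "w \<in> ce.V" "t = ce.st w" using st by blast
      have "(\<Sum>k<n. \<bar>v k + w k\<bar>) \<le> (\<Sum>k<n. \<bar>v k\<bar>) + (\<Sum>k<n. \<bar>w k\<bar>)"
        unfolding sum.distrib[symmetric] by (intro sum_mono) linarith
      moreover have "0 \<le> (\<Sum>k<n. \<bar>v k\<bar>)" "0 \<le> (\<Sum>k<n. \<bar>w k\<bar>)" by (auto intro: sum_nonneg)
      ultimately have "nv (\<lambda>k. v k + w k) \<le> nv v + nv w" unfolding nv_def by linarith
      then show ?thesis using v lT[OF v(1)] lT[OF v(3)] lT[OF ce.V_add[OF v(1,3)]] ce.st_add[OF v(1,3)] by simp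
    qed
  qed
  let ?wt = "\<lambda>x. if x \<in> i ` carrier G then lG x else lT x"
  define S' where "S' = S \<union> (\<lambda>x. inv\<^bsub>G'\<^esub> x) ` S"
  have S': "finite S'" "S' \<subseteq> carrier G'" using G'.T_finite G'.T_carrier by (auto simp: S'_def)
  have "\<exists>xs. set xs \<subseteq> i ` carrier G \<union> ce.st ` ce.V \<and> list_prod G' xs = y" if "y \<in> S'" for y
    using ce.exists_letters[of y] that S' ce.H_eq by auto
  then obtain ls where ls: "\<And>y. y \<in> S' \<Longrightarrow> set (ls y) \<subseteq> i ` carrier G \<union> ce.st ` ce.V \<and> list_prod G' (ls y) = y" by metis
  obtain W where W: "\<And>y. y \<in> S' \<Longrightarrow> sum_list (map ?wt (ls y)) \<le> W"
    using finite_bounded[OF S'(1), of "\<lambda>y. sum_list (map ?wt (ls y))"] by blast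
  have letters: "\<exists>xs. set xs \<subseteq> i ` carrier G \<union> ce.st ` ce.V \<and> list_prod G' xs = eval_word G' w \<and>
      sum_list (map ?wt xs) \<le> W * length w" if "fst ` set w \<subseteq> S" for w
    using that
  proof (induction w)
    case Nil
    then show ?case by (intro exI[of _ "[]"]) simp
  next
    case (Cons p w)
    obtain x b where p: "p = (x, b)" by fastforce
    obtain xs where xs: "set xs \<subseteq> i ` carrier G \<union> ce.st ` ce.V" "list_prod G' xs = eval_word G' w"
      "sum_list (map ?wt xs) \<le> W * length w" using Cons by auto
    define y where "y = (if b then x else inv\<^bsub>G'\<^esub> x)"
    have y: "y \<in> S'" using Cons.prems p by (auto simp: y_def S'_def)
    have app: "list_prod G' (xs @ ys) = list_prod G' xs \<otimes>\<^bsub>G'\<^esub> list_prod G' ys"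
      if "set xs \<subseteq> carrier G'" "set ys \<subseteq> carrier G'" for xs ys
    proof -
      have cl: "list_prod G' zs \<in> carrier G'" if "set zs \<subseteq> carrier G'" for zs using that by (induction zs) auto
      show ?thesis using that cl by (induction xs) (auto simp: G'.m_assoc)
    qed
    have sub: "set xs \<subseteq> carrier G'" "set (ls y) \<subseteq> carrier G'" using xs(1) ls[OF y] ce.GT_carrier by blast+
    have "list_prod G' (ls y @ xs) = y \<otimes>\<^bsub>G'\<^esub> eval_word G' w" using app[OF sub(2,1)] ls[OF y] xs(2) by simp
    moreover have "sum_list (map ?wt (ls y @ xs)) \<le> W * length (p # w)" using W[OF y] xs(3) by simp
    ultimately show ?case using ls[OF y] xs(1) p
      by (intro exI[of _ "ls y @ xs"]) (simp add: G'.eval_word_Cons y_def)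
  qed
  \<comment> \<open>A word of length \<open>R\<close> in the generators has weight at most
    \<open>W R\<close>, and reducing it does not increase the weight.\<close>
  have form: "\<exists>w0 vws. w0 \<in> carrier G \<and> ce.good_word vws \<and> g = i w0 \<otimes>\<^bsub>G'\<^esub> syl_prod G' (ce.lift vws) \<and>
      l w0 \<le> W * R \<and> (\<forall>(v, w)\<in>set vws. l w \<le> W * R \<and> nv v \<le> W * R)"
    if g: "g \<in> carrier G'" "word_len G' S g \<le> R" for g R
  proof -
    obtain w where w: "fst ` set w \<subseteq> S" "length w = word_len G' S g" "eval_word G' w = g"
      using G'.word_len_word[OF g(1)] by blast
    obtain xs where xs: "set xs \<subseteq> i ` carrier G \<union> ce.st ` ce.V" "list_prod G' xs = g"
      "sum_list (map ?wt xs) \<le> W * length w" using letters[OF w(1)] w(3) by auto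
    obtain v0 ws where ws: "v0 \<in> i ` carrier G" "ce.red ws" "v0 \<otimes>\<^bsub>G'\<^esub> syl_prod G' ws = g"
      "lG v0 + sum_list (map (\<lambda>(t, w). lT t + lG w) ws) \<le> sum_list (map ?wt xs)"
      using ce.reduce[OF nG nT xs(1)] xs(2) by auto
    have "W * length w \<le> W * R" using w(2) g(2) by simp
    then have le: "sum_list (map ?wt xs) \<le> W * R" using xs(3) by (rule le_trans[rotated])
    obtain w0 where w0: "w0 \<in> carrier G" "v0 = i w0" using ws(1) by blast
    obtain vws where vws: "ws = ce.lift vws" "ce.good_word vws" using ce.red_lift[OF ws(2)] by blast
    have "l w \<le> W * R \<and> nv v \<le> W * R" if vw: "(v, w) \<in> set vws" for v w
    proof -
      have v: "v \<in> ce.V" "w \<in> carrier G" using vws(2) vw by (auto simp: ce.good_word_def)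
      have "(ce.st v, i w) \<in> set ws" using vws(1) vw by (force simp: ce.lift_def)
      then have "(\<lambda>(t, w). lT t + lG w) (ce.st v, i w) \<le> sum_list (map (\<lambda>(t, w). lT t + lG w) ws)"
        by (intro member_le_sum_list) force+
      then show ?thesis using ws(4) le lT[OF v(1)] \<phi>0i[OF v(2)] by (simp add: lG_def)
    qed
    moreover have "l w0 \<le> W * R" using ws(4) le \<phi>0i[OF w0(1)] w0 by (simp add: lG_def)
    ultimately show ?thesis using w0 ws(3) vws by blast
  qed
  have "\<exists>a b. a \<in> carrier G \<and> ce.good_word b \<and> x = i a \<otimes>\<^bsub>G'\<^esub> syl_prod G' (ce.lift b)" if "x \<in> S" for x
    using form[of x "word_len G' S x"] that G'.T_carrier by blast
  then obtain a b where ab: "\<And>x. x \<in> S \<Longrightarrow> a x \<in> carrier G \<and> ce.good_word (b x) \<and> x = i (a x) \<otimes>\<^bsub>G'\<^esub> syl_prod G' (ce.lift (b x))"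
    by metis
  \<comment> \<open>The reduced forms of the generators are fixed once and for all. Only the
    exponents depend on the radius, each by a factor of at most \<open>P^n\<close> per unit of
    \<open>nv\<close>.\<close>
  let ?cost = "\<lambda>x. word_len G T (a x) + sum_list (map (\<lambda>(v, w). nv v * word_len G T u + word_len G T w) (b x))"
  obtain A where A: "\<And>x. x \<in> S \<Longrightarrow> ?cost x \<le> A"
    using finite_bounded[OF G'.T_finite, of ?cost] by blast
  \<comment> \<open>\<open>Max\<close> of an empty set would be unspecified.\<close>
  have Sne: "S \<noteq> {}"
  proof
    assume "S = {}"
    then have "carrier G' = {\<one>\<^bsub>G'\<^esub>}" using G'.T_gen G'.generate_empty by simp
    then have "i u = \<one>\<^bsub>G'\<^esub>" using ce.i_SH[OF u] by auto
    then have "\<phi>0 (i u) = \<one>" by simp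
    then show False using \<phi>0i[OF u] u1 by simp
  qed
  \<comment> \<open>\<open>P = (K0 + 1) (W R + 1)\<close> is at most
    \<open>(K0 + 1) (W + 1) (R + 1)\<close>; the factor 2 turns \<open>R + 1\<close> into
    \<open>R\<close> once \<open>R \<ge> 1\<close>.\<close>
  define K1 where "K1 = 2 * ((K0 + 1) * (W + 1))"
  \<comment> \<open>\<open>P\<close> exceeds the digit bound \<open>W R\<close> by more than the big
    powers threshold at norm \<open>W R\<close>.\<close>
  have bound: "disc_complexity G' S G T R \<le> A * P ^ n" if P: "P = K0 * (W * R + 1) + W * R + 1" for P R
  proof -
    define p where "p = (\<lambda>k. int P ^ (k + 1))"
    obtain \<phi> where \<phi>: "\<phi> \<in> hom (G'\<lparr>carrier := carrier G'\<rparr>) G" "\<And>x. x \<in> carrier G \<Longrightarrow> \<phi> (i x) = x"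
      "\<And>v. v \<in> ce.V \<Longrightarrow> \<phi> (ce.st v) = u [^] ce.pair p v"
      using ce.retraction[OF e, of p] by blast
    have \<phi>hom: "\<phi> \<in> hom G' G" using \<phi>(1) by simp
    have \<phi>word: "\<phi> (i w0 \<otimes>\<^bsub>G'\<^esub> syl_prod G' (ce.lift vws)) = w0 \<otimes> power_word G u (map (\<lambda>(v, w). (ce.pair p v, w)) vws)"
      if "w0 \<in> carrier G" "ce.good_word vws" for w0 vws
      using hom_mult[OF \<phi>hom, of "i w0" "syl_prod G' (ce.lift vws)"] ce.i_SH[OF that(1)] ce.sp_lift_SH[OF that(2)] \<phi>(2)[OF that(1)]
        ce.retract_lift[OF \<phi> that(2)] by simp
    have nontriv: "\<phi> g \<noteq> \<one>" if g: "g \<in> carrier G'" "word_len G' S g \<le> R" "g \<noteq> \<one>\<^bsub>G'\<^esub>" for g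
    proof -
      obtain w0 vws where w: "w0 \<in> carrier G" "ce.good_word vws" "g = i w0 \<otimes>\<^bsub>G'\<^esub> syl_prod G' (ce.lift vws)"
        "l w0 \<le> W * R" "\<And>v w. (v, w) \<in> set vws \<Longrightarrow> l w \<le> W * R \<and> nv v \<le> W * R" using form[OF g(1,2)] by blast
      show ?thesis
      proof (cases "vws = []")
        case True
        then have "g = i w0" using w(1,3) by (simp add: ce.lift_def)
        then have "w0 \<noteq> \<one>" using g(3) ce.i_one by auto
        then show ?thesis using \<open>g = i w0\<close> \<phi>(2)[OF w(1)] by simp
      next
        case False
        define B where "B = int (K0 * (W * R + 1))"
        have "w \<in> carrier G \<and> l w \<le> W * R \<and> B \<le> \<bar>ce.pair p v\<bar>" if vw: "(v, w) \<in> set vws" for v w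
        proof -
          have v: "v \<in> ce.V" "ce.st v \<noteq> \<one>\<^bsub>G'\<^esub>" "w \<in> carrier G" using w(2) vw by (auto simp: ce.good_word_def)
          have "(\<Sum>k<n. \<bar>v k\<bar>) \<le> int (W * R)" using w(5)[OF vw] unfolding nv_def by linarith
          then have "int P - int (W * R) \<le> \<bar>\<Sum>k<n. v k * int P ^ (k + 1)\<bar>"
            using P by (intro base_expansion_large ce.st_nontrivial[OF v(1,2)]) auto
          moreover have "B \<le> int P - int (W * R)" using P by (simp add: B_def)
          ultimately show ?thesis using v w(5)[OF vw] by (simp add: ce.pair_def p_def)
        qed
        then have 1: "\<forall>(n, g)\<in>set (map (\<lambda>(v, w). (ce.pair p v, w)) vws). g \<in> carrier G \<and> l g \<le> W * R \<and> int (K0 * (W * R + 1)) \<le> \<bar>n\<bar>"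
          unfolding B_def[symmetric] by auto
        have "w \<otimes> u \<noteq> u \<otimes> w" if vw: "(v, w) \<in> set (butlast vws)" for v w
          using w(2) vw in_set_butlastD[OF vw] by (auto simp: ce.good_word_def ce.C0)
        then have 2: "\<forall>(n, g)\<in>set (butlast (map (\<lambda>(v, w). (ce.pair p v, w)) vws)). g \<otimes> u \<noteq> u \<otimes> g"
          by (auto simp: map_butlast[symmetric])
        show ?thesis unfolding w(3) \<phi>word[OF w(1,2)] using K0[OF w(1,4) _ 1 2] False by simp
      qed
    qed
    have "disc_complexity G' S G T R \<le> Max ((\<lambda>x. word_len G T (\<phi> x)) ` S)"
      unfolding disc_complexity_def using \<phi>hom nontriv by (intro Least_le) blast
    also have "\<dots> \<le> A * P ^ n"
    proof (intro Max.boundedI)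
      show "finite ((\<lambda>x. word_len G T (\<phi> x)) ` S)" using G'.T_finite by simp
      show "(\<lambda>x. word_len G T (\<phi> x)) ` S \<noteq> {}" using Sne by simp
      fix k assume "k \<in> (\<lambda>x. word_len G T (\<phi> x)) ` S"
      then obtain x where x: "x \<in> S" "k = word_len G T (\<phi> x)" by blast
      have abx: "a x \<in> carrier G" "ce.good_word (b x)"
        using conjunct1[OF ab[OF x(1)]] conjunct1[OF conjunct2[OF ab[OF x(1)]]] .
      have xeq: "x = i (a x) \<otimes>\<^bsub>G'\<^esub> syl_prod G' (ce.lift (b x))"
        using conjunct2[OF conjunct2[OF ab[OF x(1)]]] .
      let ?ns = "map (\<lambda>(v, w). (ce.pair p v, w)) (b x)"
      have nsG: "\<forall>(n, g)\<in>set ?ns. g \<in> carrier G" using abx(2) by (auto simp: ce.good_word_def)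
      have P1: "1 \<le> P ^ n" using P by simp
      \<comment> \<open>Every power occurring in the exponent is at most \<open>P^n\<close>; this is
        where the degree of the polynomial comes from.\<close>
      have pairle: "nat \<bar>ce.pair p v\<bar> \<le> nv v * P ^ n" for v
      proof -
        have "\<bar>ce.pair p v\<bar> \<le> (\<Sum>k<n. \<bar>v k\<bar> * int P ^ n)"
          unfolding ce.pair_def
        proof (rule order_trans[OF sum_abs sum_mono])
          fix k assume "k \<in> {..<n}"
          then have "int P ^ (k + 1) \<le> int P ^ n" using P by (intro power_increasing) auto
          then show "\<bar>v k * p k\<bar> \<le> \<bar>v k\<bar> * int P ^ n" by (simp add: abs_mult mult_left_mono p_def)
        qed
        moreover have "(\<Sum>k<n. \<bar>v k\<bar> * int P ^ n) = int (nv v * P ^ n)"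
          by (simp add: nv_def sum_nonneg flip: sum_distrib_right)
        ultimately show ?thesis by linarith
      qed
      have "k = word_len G T (a x \<otimes> power_word G u ?ns)"
        using x(2) arg_cong[OF xeq, of \<phi>] \<phi>word[OF abx] by (simp only:)
      then have "k \<le> word_len G T (a x) + word_len G T (power_word G u ?ns)"
        using G.word_len_mult[OF abx(1) G.power_word_carrier[OF u nsG]] by (simp only:)
      moreover have "word_len G T (power_word G u ?ns) \<le> sum_list (map (\<lambda>(n, g). nat \<bar>n\<bar> * word_len G T u + word_len G T g) ?ns)"
        by (rule G.word_len_power_word[OF u nsG])
      moreover have "sum_list (map (\<lambda>(n, g). nat \<bar>n\<bar> * word_len G T u + word_len G T g) ?ns)
          \<le> sum_list (map (\<lambda>y. (case y of (v, w) \<Rightarrow> nv v * word_len G T u + word_len G T w) * P ^ n) (b x))"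
        unfolding map_map
      proof (rule sum_list_mono)
        fix y assume "y \<in> set (b x)"
        obtain v w where y: "y = (v, w)" by fastforce
        have "nat \<bar>ce.pair p v\<bar> * word_len G T u \<le> nv v * P ^ n * word_len G T u" using pairle[of v] by (rule mult_right_mono) simp
        moreover have "word_len G T w \<le> word_len G T w * P ^ n" using P1 by simp
        ultimately have "nat \<bar>ce.pair p v\<bar> * word_len G T u + word_len G T w \<le> nv v * P ^ n * word_len G T u + word_len G T w * P ^ n"
          by (rule add_mono)
        also have "\<dots> = (nv v * word_len G T u + word_len G T w) * P ^ n" by (simp add: algebra_simps)
        finally show "((\<lambda>(n, g). nat \<bar>n\<bar> * word_len G T u + word_len G T g) \<circ> (\<lambda>(v, w). (ce.pair p v, w))) y
          \<le> (case y of (v, w) \<Rightarrow> nv v * word_len G T u + word_len G T w) * P ^ n"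
          by (simp only: y comp_def prod.case)
      qed
      moreover have "word_len G T (a x) \<le> word_len G T (a x) * P ^ n" using P1 by simp
      ultimately have "k \<le> ?cost x * P ^ n" unfolding sum_list_mult_const distrib_right by linarith
      also have "\<dots> \<le> A * P ^ n" using A[OF x(1)] by (rule mult_right_mono) simp
      finally show "k \<le> A * P ^ n" .
    qed
    finally show ?thesis .
  qed
  define K where "K = A + K1 + A * K1 ^ n"
  have "disc_complexity G' S G T R \<le> K * (K * R) ^ n + K" for R
  proof -
    define P where "P = K0 * (W * R + 1) + W * R + 1"
    have PK: "2 * P \<le> K1 * (R + 1)" unfolding P_def K1_def by (simp add: algebra_simps)
    have b: "disc_complexity G' S G T R \<le> A * P ^ n" using bound[OF P_def] .
    show ?thesis
    proof (cases "R = 0")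
      \<comment> \<open>For \<open>n > 0\<close> the main term vanishes at radius 0, so the additive
        constant has to cover this case.\<close>
      case True
      then have "P \<le> K1" using PK by simp
      then have "A * P ^ n \<le> A * K1 ^ n" by (intro mult_left_mono power_mono) auto
      also have "\<dots> \<le> K" by (simp add: K_def)
      finally show ?thesis using b by linarith
    next
      case False
      then have "K1 * (R + 1) \<le> K1 * (2 * R)" by (intro mult_left_mono) auto
      then have "2 * P \<le> 2 * (K1 * R)" using PK by (simp only: mult.left_commute)
      then have "P \<le> K1 * R" by simp
      also have "\<dots> \<le> K * R" by (simp add: K_def)
      finally have "P ^ n \<le> (K * R) ^ n" by (intro power_mono) auto
      then have "A * P ^ n \<le> K * (K * R) ^ n" by (intro mult_mono) (auto simp: K_def)
      then show ?thesis using b by linarith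
    qed
  qed
  then show ?thesis unfolding dominated_def by blast
qed

theorem theoremC:
  fixes \<Gamma> :: "'a monoid" and G :: "'b monoid" and G' :: "'c monoid"
    and n :: nat and S :: "'c set" and T :: "'b set"
  assumes "hyperbolic_group \<Gamma>" and "non_abelian \<Gamma>" and "torsion_free \<Gamma>"
    and "iterated_ext \<Gamma> G"
    and "cyclic_centralizer_ext G n G'"
    and "fin_gen_set G' S" and "fin_gen_set G T"
  shows "dominated (disc_complexity G' S G T) (\<lambda>R. R ^ n)"
proof (cases "finite (UNIV :: 'c set)")
  \<comment> \<open>A finite element type need not have room for a copy of \<open>G\<close>; but
    then \<open>G'\<close> is finite and its complexity bounded.\<close>
  case True
  then have "finite (carrier G')" by (rule finite_subset[OF subset_UNIV])
  then obtain K where "\<forall>R. disc_complexity G' S G T R \<le> K" using disc_complexity_bounded by blast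
  then show ?thesis unfolding dominated_def by (intro exI[of _ K] allI trans_le_add2) simp
next
  case False
  note \<Gamma> = hyperbolic_big_powers[OF assms(1,3)]
  have "non_abelian G \<and> torsion_free G \<and>
    (\<forall>c\<in>carrier G. c \<noteq> \<one>\<^bsub>G\<^esub> \<longrightarrow> rank_one G (carrier G) c \<longrightarrow> has_big_powers G (carrier G) c)"
    by (rule iterated_ext_big_powers[OF assms(4,2) conjunct1[OF \<Gamma>] assms(3) conjunct1[OF conjunct2[OF \<Gamma>]]])
      (rule conjunct2[OF conjunct2[OF \<Gamma>], rule_format])
  then show ?thesis by (intro disc_complexity_dominated[OF False _ _ _ assms(5-7)]) auto
qed

end
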